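(* Let $(\mathcal{E},\mathcal{F})$ be a resistance form on a set $X$ whose resistance metric space $(X,R)$ is compact, $\mu$ a Borel probability measure on $X$ with full support such that $(\mathcal{E},\mathcal{F})$ is a strongly local Dirichlet form on $L^2(X,\mu)$, $\{V_n\}_{n\in\mathbb{N}}$ a non-decreasing sequence of nonempty finite subsets of $X$ with dense union, and $\mu_n$ a probability measure on $V_n$ charging every point of $V_n$, with $\mu_n\to\mu$ weakly. Let $b_1,\dots,b_N\in C(X)$, $h_1,\dots,h_N\in\mathcal{F}$, assume that Assumption A or Assumption B holds, and let $\mathcal{A}$, $\mathcal{A}^n$ and the constant $\lambda>0$ be as defined in the context. Let $\{G_\alpha\}_{\alpha>\lambda}$ (resp. $\{G^{(n)}_\alpha\}_{\alpha>\lambda}$) be the strongly continuous resolvent on $L^2(X,\mu)$ (resp. $L^2(V_n,\mu_n)$) associated with $(\mathcal{A},\mathcal{F})$ (resp. $(\mathcal{A}^n,l(V_n))$, for $n$ large enough). Then for all $\alpha>\lambda$, $\{G^{(n)}_\alpha\}_{n}$ strongly K-S converges to $G_\alpha$; that is, whenever $u_n\in L^2(V_n,\mu_n)$ strongly K-S converges to $u\in L^2(X,\mu)$, $G^{(n)}_\alpha u_n$ strongly K-S converges to $G_\alpha u$.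
   Context: Notation: $l(A)$ is the space of real functions on a set $A$; for a bilinear form $\mathcal{B}$, $\mathcal{B}(f):=\mathcal{B}(f,f)$, and $\mathcal{B}_\alpha:=\mathcal{B}+\alpha(\cdot,\cdot)_{L^2}$ (the $L^2$ space being $L^2(X,\mu)$ or $L^2(V_n,\mu_n)$). Resistance form on $X$: a pair $(\mathcal{E},\mathcal{F})$, $\mathcal{F}$ a linear subspace of $l(X)$ containing the constants, $\mathcal{E}\colon\mathcal{F}\times\mathcal{F}\to\mathbb{R}$ bilinear, such that (RF1) $\mathcal{E}$ is symmetric, nonnegative, and $\mathcal{E}(f)=0$ iff $f$ is constant; (RF2) $\mathcal{F}$ modulo constants with $\mathcal{E}$ is a Hilbert space; (RF3) for every finite $V\subset X$, every function on $V$ is the restriction of some $f\in\mathcal{F}$; (RF4) $R(x,y):=\sup\{|f(x)-f(y)|^2/\mathcal{E}(f): f\in\mathcal{F}\text{ nonconstant}\}<\infty$ for all $x,y$; (RF5) if $f\in\mathcal{F}$ then $0\vee f\wedge1\in\mathcal{F}$ and $\mathcal{E}(0\vee f\wedge 1)\le\mathcal{E}(f)$. $R$ is a metric, the resistance metric; topological notions on $X$ refer to $R$. When $(X,R)$ is compact, $\mathcal{F}\subset C(X)$ densely in sup norm. Harmonic extension: for nonempty finite $V\subset X$ and $f\in l(V)$, $\widehat f\in\mathcal{F}$ is the unique minimizer of $\mathcal{E}$ among elements of $\mathcal{F}$ equal to $f$ on $V$; the trace of $\mathcal{E}$ onto $V$ is $(f,g)\mapsto\mathcal{E}(\widehat f,\widehat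 g)$ on $l(V)$. $\mathcal{E}^n$ denotes the trace of $\mathcal{E}$ onto $V_n$. Strongly local: $\mathcal{E}(f,g)=0$ whenever $f,g\in\mathcal{F}$ and there is an open $U\supset\operatorname{supp}g$ on which $f$ is constant. Energy measures: for $f\in\mathcal{F}$, $\nu_f$ is the unique finite Borel measure with $\int_X g\,d\nu_f=2\mathcal{E}(fg,f)-\mathcal{E}(g,f^2)$ for all $g\in\mathcal{F}$; $\nu_{f,g}:=\frac12(\nu_{f+g}-\nu_f-\nu_g)$. Forms: $\mathcal{Q}(f,g):=\sum_{i=1}^N\frac12\int_X b_i g\,d\nu_{f,h_i}$ and $\mathcal{A}:=\mathcal{E}+\mathcal{Q}$ on $\mathcal{F}$. Let $c_{n,x,y}=c_{n,y,x}\ge0$ ($x\ne y$ in $V_n$) be the unique numbers with $\mathcal{E}^n(f,g)=\frac12\sum_{x\ne y}c_{n,x,y}(f(x)-f(y))(g(x)-g(y))$. On $l(V_n)$, $\mathcal{Q}^n(f,g):=\sum_{i=1}^N\frac12\sum_{x,y\in V_n,x\ne y}c_{n,x,y}b_i(x)g(x)(f(x)-f(y))(h_i(x)-h_i(y))$ and $\mathcal{A}^n:=\mathcal{E}^n+\mathcal{Q}^n$. Conditions: (I) $\sum_{i,j=1}^N\int_X b_ib_j\,d\nu_{h_i,h_j}<2(\mathrm{diam}_RX)^{-1}$. (II) For every $x\in X$, $\mathcal{E}\big(\sum_{i=1}^N b_i(x)h_i\big)\le(\mathrm{diam}_RX)^{-1}$. (III) For every $n$, $X\setminus V_n$ has finitely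 many connected components $\{U_\gamma\}_{\gamma\in\Lambda_n}$, and for every $x\in X$ the sets $\bigcup_{\gamma\in\Lambda_n,\,x\in\mathrm{Cl}(U_\gamma)}\mathrm{Cl}(U_\gamma)$, $n\in\mathbb{N}$, form a fundamental system of neighbourhoods of $x$. Assumption A: (I) and (II). Assumption B: (I) and (III). Constants: fix $\delta>0$, $s>0$ with $\big(\frac12\sum_{i,j}\int_Xb_ib_j\,d\nu_{h_i,h_j}\big)^{1/2}\big((\mathrm{diam}_RX)^{1/2}+\delta\big)<s<1$, and set $\lambda:=(4\delta)^{-1}\big((\mathrm{diam}_RX)^{1/2}+\delta\big)^{-1}$. Under Assumption A or B, $(\mathcal{A},\mathcal{F})$ and, for $n$ large enough, $(\mathcal{A}^n,l(V_n))$ are closed forms with this $\lambda$: $\mathcal{A}_\lambda(u)\ge0$; $\mathcal{A}_{\lambda+1}(\cdot)^{1/2}$ is a complete norm on the domain; $|\mathcal{A}(u,v)|\le K\mathcal{A}_\lambda(u)^{1/2}\mathcal{A}_\lambda(v)^{1/2}$ for some $K\ge1$ (same for $\mathcal{A}^n$). The associated resolvent is characterized by $G_\alpha u\in\mathcal{F}$ and $\mathcal{A}_\alpha(G_\alpha u,v)=(u,v)_{L^2}$ for all $u\in L^2$, $v\in\mathcal{F}$, $\alpha>\lambda$ (same for $\mathcal{A}^n$). Strong K-S convergence: $u_n\in L^2(V_n,\mu_n)$ strongly K-S converges to $u\in L^2(X,\mu)$ if there are $\varphi_m\in C(X)$ with $\lim_m\|\varphi_m-u\|_{L^2(X,\mu)}=0$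 and $\lim_m\limsup_n\|\varphi_m|_{V_n}-u_n\|_{L^2(V_n,\mu_n)}=0$. *)

theory Defs
  imports "HOL-Probability.Probability"
begin

text \<open>
  The set \<open>X\<close> is the universe of a type \<open>'a\<close>. A form \<open>E\<close> with domain \<open>F\<close> is a function on pairs of
  real functions of which only the values on \<open>F \<times> F\<close> matter.
\<close>

type_synonym 'a form = "('a \<Rightarrow> real) \<Rightarrow> ('a \<Rightarrow> real) \<Rightarrow> real"


section \<open>Resistance forms\<close>

text \<open>
  The supremum is taken in \<open>[0, \<infinity>]\<close>, so that it is \<open>0\<close> when \<open>X\<close> is a single point and
  there is no nonconstant function.
\<close>

definition resistance :: "'a form \<Rightarrow> ('a \<Rightarrow> real) set \<Rightarrow> 'a \<Rightarrow> 'a \<Rightarrow> ennreal" where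
  "resistance E F x y =
     (SUP f\<in>{f \<in> F. \<not> f constant_on UNIV}. ennreal (\<bar>f x - f y\<bar>\<^sup>2 / E f f))"

locale resistance_form =
  fixes E :: "'a form" and F :: "('a \<Rightarrow> real) set"
  assumes const_mem: "(\<lambda>_. c) \<in> F"
    and add_mem: "f \<in> F \<Longrightarrow> g \<in> F \<Longrightarrow> (\<lambda>x. f x + g x) \<in> F"
    and scale_mem: "f \<in> F \<Longrightarrow> (\<lambda>x. c * f x) \<in> F"
    and add_left: "f \<in> F \<Longrightarrow> g \<in> F \<Longrightarrow> k \<in> F \<Longrightarrow> E (\<lambda>x. f x + g x) k = E f k + E g k"
    and scale_left: "f \<in> F \<Longrightarrow> g \<in> F \<Longrightarrow> E (\<lambda>x. c * f x) g = c * E f g"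
    and RF1_sym: "f \<in> F \<Longrightarrow> g \<in> F \<Longrightarrow> E f g = E g f"
    and RF1_nonneg: "f \<in> F \<Longrightarrow> 0 \<le> E f f"
    and RF1_zero: "f \<in> F \<Longrightarrow> E f f = 0 \<longleftrightarrow> f constant_on UNIV"
    \<comment> \<open>RF2: completeness of \<open>F\<close> modulo constants, stated with representatives\<close>
    and RF2: "(\<And>n::nat. u n \<in> F) \<Longrightarrow>
          (\<And>e. e > 0 \<Longrightarrow> \<exists>M. \<forall>m\<ge>M. \<forall>n\<ge>M. E (\<lambda>x. u m x - u n x) (\<lambda>x. u m x - u n x) < e) \<Longrightarrow>
          \<exists>f\<in>F. (\<lambda>n. E (\<lambda>x. u n x - f x) (\<lambda>x. u n x - f x)) \<longlonglongrightarrow> 0"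
    and RF3: "finite V \<Longrightarrow> \<exists>f\<in>F. \<forall>x\<in>V. f x = w x"
    and RF4: "resistance E F x y < \<infinity>"
    and RF5_mem: "f \<in> F \<Longrightarrow> (\<lambda>x. max 0 (min 1 (f x))) \<in> F"
    and RF5_le: "f \<in> F \<Longrightarrow>
          E (\<lambda>x. max 0 (min 1 (f x))) (\<lambda>x. max 0 (min 1 (f x))) \<le> E f f"

text \<open>
  Real functions on a finite set \<open>V\<close> are represented by functions on \<open>X\<close>; the
  notions below depend only on their values on \<open>V\<close>.
\<close>

definition harmonic_extension ::
    "'a form \<Rightarrow> ('a \<Rightarrow> real) set \<Rightarrow> 'a set \<Rightarrow> ('a \<Rightarrow> real) \<Rightarrow> ('a \<Rightarrow> real)" where
  "harmonic_extension E F V f =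
     (THE u. u \<in> F \<and> (\<forall>x\<in>V. u x = f x) \<and>
        (\<forall>v\<in>F. (\<forall>x\<in>V. v x = f x) \<longrightarrow> E u u \<le> E v v))"

definition trace_form :: "'a form \<Rightarrow> ('a \<Rightarrow> real) set \<Rightarrow> 'a set \<Rightarrow> 'a form" where
  "trace_form E F V f g = E (harmonic_extension E F V f) (harmonic_extension E F V g)"

text \<open>The conductances are set to \<open>0\<close> outside the pairs of distinct points of \<open>V\<close>.\<close>

definition conductance :: "'a form \<Rightarrow> ('a \<Rightarrow> real) set \<Rightarrow> 'a set \<Rightarrow> 'a \<Rightarrow> 'a \<Rightarrow> real" where
  "conductance E F V =
     (THE c. (\<forall>x y. c x y = c y x) \<and> (\<forall>x y. 0 \<le> c x y) \<and>
        (\<forall>x y. x \<notin> V \<or> y \<notin> V \<or> x = y \<longrightarrow> c x y = 0) \<and>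
        (\<forall>f g. trace_form E F V f g =
           1/2 * (\<Sum>x\<in>V. \<Sum>y\<in>V - {x}. c x y * (f x - f y) * (g x - g y))))"


section \<open>\<open>L\<^sup>2\<close> spaces and Dirichlet forms\<close>

definition L2_space :: "'a measure \<Rightarrow> ('a \<Rightarrow> real) set" where
  "L2_space M = {f \<in> borel_measurable M. integrable M (\<lambda>x. (f x)\<^sup>2)}"

definition L2_inner :: "'a measure \<Rightarrow> ('a \<Rightarrow> real) \<Rightarrow> ('a \<Rightarrow> real) \<Rightarrow> real" where
  "L2_inner M f g = (LINT x|M. f x * g x)"

definition L2_norm :: "'a measure \<Rightarrow> ('a \<Rightarrow> real) \<Rightarrow> real" where
  "L2_norm M f = sqrt (L2_inner M f f)"

definition form_shift :: "'a measure \<Rightarrow> 'a form \<Rightarrow> real \<Rightarrow> 'a form" where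
  "form_shift M B \<alpha> f g = B f g + \<alpha> * L2_inner M f g"

text \<open>
  Elements of the domain are functions rather than classes. This is harmless for resistance
  forms and measures of full support, since then \<open>F\<close> consists of continuous functions.
\<close>

definition dirichlet_form :: "'a measure \<Rightarrow> 'a form \<Rightarrow> ('a \<Rightarrow> real) set \<Rightarrow> bool" where
  "dirichlet_form M E F \<longleftrightarrow>
     \<comment> \<open>linear subspace, dense in \<open>L\<^sup>2\<close>\<close>
     F \<subseteq> L2_space M \<and> (\<lambda>_. 0) \<in> F \<and>
     (\<forall>f\<in>F. \<forall>g\<in>F. (\<lambda>x. f x + g x) \<in> F) \<and> (\<forall>c. \<forall>f\<in>F. (\<lambda>x. c * f x) \<in> F) \<and>
     (\<forall>u\<in>L2_space M. \<forall>e>0. \<exists>f\<in>F. L2_norm M (\<lambda>x. f x - u x) < e) \<and>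
     \<comment> \<open>nonnegative symmetric bilinear form\<close>
     (\<forall>f\<in>F. \<forall>g\<in>F. \<forall>k\<in>F. E (\<lambda>x. f x + g x) k = E f k + E g k) \<and>
     (\<forall>c. \<forall>f\<in>F. \<forall>g\<in>F. E (\<lambda>x. c * f x) g = c * E f g) \<and>
     (\<forall>f\<in>F. \<forall>g\<in>F. E f g = E g f) \<and> (\<forall>f\<in>F. 0 \<le> E f f) \<and>
     \<comment> \<open>closedness\<close>
     (\<forall>u::nat \<Rightarrow> 'a \<Rightarrow> real. (\<forall>n. u n \<in> F) \<longrightarrow>
        (\<forall>e>0. \<exists>K. \<forall>m\<ge>K. \<forall>n\<ge>K.
           form_shift M E 1 (\<lambda>x. u m x - u n x) (\<lambda>x. u m x - u n x) < e) \<longrightarrow>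
        (\<exists>f\<in>F. (\<lambda>n. form_shift M E 1 (\<lambda>x. u n x - f x) (\<lambda>x. u n x - f x)) \<longlonglongrightarrow> 0)) \<and>
     \<comment> \<open>Markov property\<close>
     (\<forall>f\<in>F. (\<lambda>x. max 0 (min 1 (f x))) \<in> F \<and>
        E (\<lambda>x. max 0 (min 1 (f x))) (\<lambda>x. max 0 (min 1 (f x))) \<le> E f f)"

definition strongly_local :: "('a::topological_space) form \<Rightarrow> ('a \<Rightarrow> real) set \<Rightarrow> bool" where
  "strongly_local E F \<longleftrightarrow>
     (\<forall>f\<in>F. \<forall>g\<in>F. (\<exists>U. open U \<and> closure {x. g x \<noteq> 0} \<subseteq> U \<and> f constant_on U) \<longrightarrow> E f g = 0)"


section \<open>Energy measures and the non-symmetric forms\<close>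

definition energy_measure ::
    "('a::topological_space) form \<Rightarrow> ('a \<Rightarrow> real) set \<Rightarrow> ('a \<Rightarrow> real) \<Rightarrow> 'a measure" where
  "energy_measure E F f =
     (THE \<nu>. sets \<nu> = sets borel \<and> finite_measure \<nu> \<and>
        (\<forall>g\<in>F. (LINT x|\<nu>. g x) = 2 * E (\<lambda>x. f x * g x) f - E g (\<lambda>x. (f x)\<^sup>2)))"

text \<open>
  The integral of \<open>\<phi>\<close> against the signed measure
  \<open>\<nu>\<^bsub>f,g\<^esub> = (\<nu>\<^bsub>f+g\<^esub> - \<nu>\<^bsub>f\<^esub> - \<nu>\<^bsub>g\<^esub>) / 2\<close>.
\<close>

definition mutual_energy_integral ::
    "('a::topological_space) form \<Rightarrow> ('a \<Rightarrow> real) set \<Rightarrow> ('a \<Rightarrow> real) \<Rightarrow> ('a \<Rightarrow> real) \<Rightarrow>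
     ('a \<Rightarrow> real) \<Rightarrow> real" where
  "mutual_energy_integral E F f g \<phi> =
     1/2 * ((LINT x|energy_measure E F (\<lambda>x. f x + g x). \<phi> x)
            - (LINT x|energy_measure E F f. \<phi> x) - (LINT x|energy_measure E F g. \<phi> x))"

definition Q_form ::
    "('a::topological_space) form \<Rightarrow> ('a \<Rightarrow> real) set \<Rightarrow> nat \<Rightarrow> (nat \<Rightarrow> 'a \<Rightarrow> real) \<Rightarrow>
     (nat \<Rightarrow> 'a \<Rightarrow> real) \<Rightarrow> 'a form" where
  "Q_form E F N b h f g =
     (\<Sum>i=1..N. 1/2 * mutual_energy_integral E F f (h i) (\<lambda>x. b i x * g x))"

definition A_form ::
    "('a::topological_space) form \<Rightarrow> ('a \<Rightarrow> real) set \<Rightarrow> nat \<Rightarrow> (nat \<Rightarrow> 'a \<Rightarrow> real) \<Rightarrow>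
     (nat \<Rightarrow> 'a \<Rightarrow> real) \<Rightarrow> 'a form" where
  "A_form E F N b h f g = E f g + Q_form E F N b h f g"

definition Q_form_fin ::
    "'a form \<Rightarrow> ('a \<Rightarrow> real) set \<Rightarrow> 'a set \<Rightarrow> nat \<Rightarrow> (nat \<Rightarrow> 'a \<Rightarrow> real) \<Rightarrow>
     (nat \<Rightarrow> 'a \<Rightarrow> real) \<Rightarrow> 'a form" where
  "Q_form_fin E F V N b h f g =
     (\<Sum>i=1..N. 1/2 * (\<Sum>x\<in>V. \<Sum>y\<in>V - {x}.
        conductance E F V x y * b i x * g x * (f x - f y) * (h i x - h i y)))"

definition A_form_fin ::
    "'a form \<Rightarrow> ('a \<Rightarrow> real) set \<Rightarrow> 'a set \<Rightarrow> nat \<Rightarrow> (nat \<Rightarrow> 'a \<Rightarrow> real) \<Rightarrow>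
     (nat \<Rightarrow> 'a \<Rightarrow> real) \<Rightarrow> 'a form" where
  "A_form_fin E F V N b h f g = trace_form E F V f g + Q_form_fin E F V N b h f g"


section \<open>The standing conditions\<close>

definition drift_energy ::
    "('a::topological_space) form \<Rightarrow> ('a \<Rightarrow> real) set \<Rightarrow> nat \<Rightarrow> (nat \<Rightarrow> 'a \<Rightarrow> real) \<Rightarrow>
     (nat \<Rightarrow> 'a \<Rightarrow> real) \<Rightarrow> real" where
  "drift_energy E F N b h =
     (\<Sum>i=1..N. \<Sum>j=1..N. mutual_energy_integral E F (h i) (h j) (\<lambda>x. b i x * b j x))"

text \<open>
  In the first two conditions the factor \<open>(diam X)\<^sup>-\<^sup>1\<close> is moved to the left-hand side, because
  \<open>inverse 0 = 0\<close> in HOL whereas a one-point space should satisfy both (\<open>0\<^sup>-\<^sup>1 = \<infinity>\<close>).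
\<close>

definition cond_I ::
    "('a::metric_space) form \<Rightarrow> ('a \<Rightarrow> real) set \<Rightarrow> nat \<Rightarrow> (nat \<Rightarrow> 'a \<Rightarrow> real) \<Rightarrow>
     (nat \<Rightarrow> 'a \<Rightarrow> real) \<Rightarrow> bool" where
  "cond_I E F N b h \<longleftrightarrow> drift_energy E F N b h * diameter (UNIV :: 'a set) < 2"

definition cond_II ::
    "('a::metric_space) form \<Rightarrow> nat \<Rightarrow> (nat \<Rightarrow> 'a \<Rightarrow> real) \<Rightarrow> (nat \<Rightarrow> 'a \<Rightarrow> real) \<Rightarrow> bool" where
  "cond_II E N b h \<longleftrightarrow>
     (\<forall>x. E (\<lambda>y. \<Sum>i=1..N. b i x * h i y) (\<lambda>y. \<Sum>i=1..N. b i x * h i y)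
            * diameter (UNIV :: 'a set) \<le> 1)"

definition cond_III :: "(nat \<Rightarrow> ('a::topological_space) set) \<Rightarrow> bool" where
  "cond_III V \<longleftrightarrow>
     (\<forall>n. finite (components (- V n))) \<and>
     (\<forall>x. let W = (\<lambda>n. \<Union>{closure U | U. U \<in> components (- V n) \<and> x \<in> closure U})
          in (\<forall>n. x \<in> interior (W n)) \<and> (\<forall>S. open S \<and> x \<in> S \<longrightarrow> (\<exists>n. W n \<subseteq> S)))"

definition assumption_A ::
    "('a::metric_space) form \<Rightarrow> ('a \<Rightarrow> real) set \<Rightarrow> nat \<Rightarrow> (nat \<Rightarrow> 'a \<Rightarrow> real) \<Rightarrow>
     (nat \<Rightarrow> 'a \<Rightarrow> real) \<Rightarrow> bool" where
  "assumption_A E F N b h \<longleftrightarrow> cond_I E F N b h \<and> cond_II E N b h"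

definition assumption_B ::
    "('a::metric_space) form \<Rightarrow> ('a \<Rightarrow> real) set \<Rightarrow> (nat \<Rightarrow> 'a set) \<Rightarrow> nat \<Rightarrow>
     (nat \<Rightarrow> 'a \<Rightarrow> real) \<Rightarrow> (nat \<Rightarrow> 'a \<Rightarrow> real) \<Rightarrow> bool" where
  "assumption_B E F V N b h \<longleftrightarrow> cond_I E F N b h \<and> cond_III V"


section \<open>Resolvents and convergence\<close>

definition resolvent_of ::
    "'a measure \<Rightarrow> 'a form \<Rightarrow> ('a \<Rightarrow> real) set \<Rightarrow> real \<Rightarrow>
     (real \<Rightarrow> ('a \<Rightarrow> real) \<Rightarrow> ('a \<Rightarrow> real)) \<Rightarrow> bool" where
  "resolvent_of M B D l G \<longleftrightarrow>
     (\<forall>\<alpha>>l. \<forall>u\<in>L2_space M. G \<alpha> u \<in> D \<and>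
        (\<forall>v\<in>D. form_shift M B \<alpha> (G \<alpha> u) v = L2_inner M u v))"

definition weakly_converges :: "(nat \<Rightarrow> 'a pmf) \<Rightarrow> ('a::topological_space) measure \<Rightarrow> bool" where
  "weakly_converges p M \<longleftrightarrow>
     (\<forall>\<phi>::'a \<Rightarrow> real. continuous_on UNIV \<phi> \<and> bounded (range \<phi>) \<longrightarrow>
        (\<lambda>n. LINT x|measure_pmf (p n). \<phi> x) \<longlonglongrightarrow> (LINT x|M. \<phi> x))"

definition strong_KS_converges ::
    "(nat \<Rightarrow> 'a pmf) \<Rightarrow> ('a::topological_space) measure \<Rightarrow> (nat \<Rightarrow> 'a \<Rightarrow> real) \<Rightarrow>
     ('a \<Rightarrow> real) \<Rightarrow> bool" where
  "strong_KS_converges p M u' u \<longleftrightarrow>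
     (\<exists>\<phi>::nat \<Rightarrow> 'a \<Rightarrow> real. (\<forall>m. continuous_on UNIV (\<phi> m)) \<and>
        (\<lambda>m. L2_norm M (\<lambda>x. \<phi> m x - u x)) \<longlonglongrightarrow> 0 \<and>
        (\<lambda>m. limsup (\<lambda>n. ereal (L2_norm (measure_pmf (p n)) (\<lambda>x. \<phi> m x - u' n x)))) \<longlonglongrightarrow> 0)"

end

theory Submission
  imports Defs
begin

text \<open>
  Write \<open>u = G \<alpha> w\<close> and \<open>u\<^sub>n = G\<^sub>n \<alpha> w\<^sub>n\<close>. The choice of \<open>\<delta>\<close>, \<open>s\<close> and \<open>\<lambda>\<close> makes the discrete forms
  coercive with constants not depending on \<open>n\<close>, so it suffices to bound \<open>A\<^sub>n(v\<^sub>n, v\<^sub>n)\<close> for the error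
  \<open>v\<^sub>n = u\<^sub>n - u\<close> on \<open>V n\<close>. By the two resolvent equations this is the consistency error of the discrete
  forms at \<open>(u, v\<^sub>n)\<close>, where \<open>v\<^sub>n\<close> is identified with its harmonic extension; the symmetric part
  contributes nothing. The other parts are differences of discrete measures and their weak limits, tested
  against functions bounded in energy and in the uniform norm, hence in a precompact set. For the drift this
  uses that the energy measure of \<open>f\<close> is the weak limit of the measures with masses
  \<open>\<Sum>y. c\<^sub>n x y * (f x - f y)\<^sup>2\<close>, which also yields its existence.
\<close>

section \<open>Resistance forms, traces and conductances\<close>

text \<open>The energy alone does not dominate the drift part of the form, because
  \<open>Q(v, v)\<close> contains \<open>v\<close> itself as a factor. The resistance metric
  supplies the missing uniform bound: with \<open>e\<close> the root of the energy, \<open>l\<close>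
  the \<open>L2\<close> norm and \<open>D\<close> the diameter, |v| \<le> sqrt D * e + l.
  Cauchy-Schwarz then gives |Q(v, v)| \<le> \<sigma> * e * (sqrt D * e + l), where \<sigma>^2 is
  half the drift energy. Splitting e * l by Young's inequality with weight \<delta> leaves s * (e^2
  + lam * l^2) as soon as \<sigma> * (sqrt D + \<delta>) < s, and \<open>lam\<close> is the number
  that makes this split work. The inequality being strict, it passes from the limit to all large n.
  The test functions change with n, while weak convergence speaks of fixed integrands. Hence an a
  priori bound on the error has to come before any limit; precompactness then does the rest.
  Harmonic extension turns the error, known on a finite set only, into an element of the domain, so
  that the limiting resolvent equation can be tested with it.\<close>

lemma quadratic_nonneg_discriminant:
  fixes a b c :: real
  assumes "\<And>t. 0 \<le> a + 2 * t * b + t\<^sup>2 * c" and "0 \<le> c"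
  shows "b\<^sup>2 \<le> a * c"
proof (cases "c = 0")
  case True
  have "b = 0"
  proof (rule ccontr)
    assume "b \<noteq> 0"
    \<comment> \<open>With \<open>c = 0\<close> the expression is affine in \<open>t\<close>; at
      this \<open>t\<close> its value is -1.\<close>
    then show False
      using assms(1)[of "- (a + 1) / (2 * b)"] True by (simp add: field_simps)
  qed
  then show ?thesis using True by simp
next
  case False
  with assms(2) have "c > 0" by simp
  then have "0 \<le> c * (a + 2 * (- b / c) * b + (- b / c)\<^sup>2 * c)"
    using assms(1)[of "- b / c"] by simp
  also have "\<dots> = a * c - b\<^sup>2"
    using \<open>c > 0\<close> by (simp add: field_simps power2_eq_square)
  finally show ?thesis by simp
qed

context resistance_form
begin

lemma uminus_mem: "f \<in> F \<Longrightarrow> (\<lambda>x. - f x) \<in> F"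
  using scale_mem[of f "-1"] by simp

lemma diff_mem: "f \<in> F \<Longrightarrow> g \<in> F \<Longrightarrow> (\<lambda>x. f x - g x) \<in> F"
  using add_mem[OF _ uminus_mem, of f g] by simp

lemma E_diff_left:
  "f \<in> F \<Longrightarrow> g \<in> F \<Longrightarrow> k \<in> F \<Longrightarrow> E (\<lambda>x. f x - g x) k = E f k - E g k"
  using add_left[of f "\<lambda>x. - 1 * g x" k] scale_left[of g k "-1"] scale_mem[of g "-1"] by simp

lemma add_right:
  "f \<in> F \<Longrightarrow> g \<in> F \<Longrightarrow> k \<in> F \<Longrightarrow> E k (\<lambda>x. f x + g x) = E k f + E k g"
  using add_left[of f g k] by (simp add: RF1_sym add_mem)

lemma scale_right: "f \<in> F \<Longrightarrow> g \<in> F \<Longrightarrow> E g (\<lambda>x. c * f x) = c * E g f"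
  using scale_left[of f g c] by (simp add: RF1_sym scale_mem)

lemma E_diff_right:
  "f \<in> F \<Longrightarrow> g \<in> F \<Longrightarrow> k \<in> F \<Longrightarrow> E k (\<lambda>x. f x - g x) = E k f - E k g"
  using E_diff_left[of f g k] by (simp add: RF1_sym diff_mem)

lemma E_line:
  assumes "f \<in> F" "g \<in> F"
  shows "E (\<lambda>x. f x + t * g x) (\<lambda>x. f x + t * g x) = E f f + 2 * t * E f g + t\<^sup>2 * E g g"
proof -
  have tg: "(\<lambda>x. t * g x) \<in> F" using assms scale_mem by blast
  then show ?thesis
    using assms
    by (simp add: add_left[OF _ tg] add_right[OF _ tg] scale_left scale_right add_mem tg
        RF1_sym[of g f] power2_eq_square algebra_simps)
qed

lemma E_diff_self:
  assumes "f \<in> F" "g \<in> F"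
  shows "E (\<lambda>x. f x - g x) (\<lambda>x. f x - g x) = E f f - 2 * E f g + E g g"
  using E_line[OF assms, of "-1"] by simp

lemma Cauchy_Schwarz_sq:
  assumes "f \<in> F" "g \<in> F"
  shows "(E f g)\<^sup>2 \<le> E f f * E g g"
proof (rule quadratic_nonneg_discriminant)
  show "0 \<le> E f f + 2 * t * E f g + t\<^sup>2 * E g g" for t
    using RF1_nonneg[OF add_mem[OF assms(1) scale_mem[OF assms(2)]], of t] E_line[OF assms, of t]
    by simp
qed (simp add: RF1_nonneg assms)

lemma Cauchy_Schwarz:
  assumes "f \<in> F" "g \<in> F"
  shows "\<bar>E f g\<bar> \<le> sqrt (E f f) * sqrt (E g g)"
  using real_sqrt_le_mono[OF Cauchy_Schwarz_sq[OF assms]] by (simp add: real_sqrt_mult)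

lemma E_const_right:
  assumes "f \<in> F"
  shows "E f (\<lambda>_. c) = 0"
proof -
  have "E (\<lambda>_. c) (\<lambda>_. c) = 0"
    using RF1_zero[OF const_mem[of c]] by (auto simp: constant_on_def)
  then show ?thesis using Cauchy_Schwarz_sq[OF assms const_mem[of c]] by simp
qed

lemma E_const_left: "f \<in> F \<Longrightarrow> E (\<lambda>_. c) f = 0"
  by (simp add: E_const_right RF1_sym const_mem)

text \<open>\<open>RF2\<close> determines a limit only up to a constant. This allows the limit to be
  corrected at one point without changing the energy distance to the approximants.\<close>

lemma E_diff_shift:
  assumes "f \<in> F" "g \<in> F"
  shows "E (\<lambda>x. f x - (g x + c)) (\<lambda>x. f x - (g x + c)) = E (\<lambda>x. f x - g x) (\<lambda>x. f x - g x)"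
  using E_diff_self[OF diff_mem[OF assms] const_mem, of c] diff_mem[OF assms]
  by (simp add: E_const_right const_mem diff_diff_eq)

text \<open>Written with the midpoint because the functions with prescribed values on a set are
  closed under midpoints, so that the last energy is bounded below by the infimum over that
  set.\<close>

lemma parallelogram:
  assumes "f \<in> F" "g \<in> F"
  shows "E (\<lambda>x. f x - g x) (\<lambda>x. f x - g x)
    = 2 * E f f + 2 * E g g - 4 * E (\<lambda>x. 1/2 * (f x + g x)) (\<lambda>x. 1/2 * (f x + g x))"
proof -
  have "E (\<lambda>x. 1/2 * (f x + g x)) (\<lambda>x. 1/2 * (f x + g x))
      = 1/4 * E (\<lambda>x. f x + g x) (\<lambda>x. f x + g x)"
    using scale_left[OF add_mem[OF assms] scale_mem[OF add_mem[OF assms], of "1/2"], of "1/2"]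
      scale_right[OF add_mem[OF assms] add_mem[OF assms], of "1/2"] by simp
  also have "E (\<lambda>x. f x + g x) (\<lambda>x. f x + g x) = E f f + 2 * E f g + E g g"
    using E_line[OF assms, of 1] by simp
  finally show ?thesis using E_diff_self[OF assms] by simp
qed

end

section \<open>Resistance metric and harmonic extensions\<close>

locale resistance_metric = resistance_form E F
  for E :: "('a::metric_space) form" and F +
  assumes dist_eq_resistance: "ennreal (dist x y) = resistance E F x y"
begin

lemma dist_energy_bound:
  assumes "f \<in> F"
  shows "(f x - f y)\<^sup>2 \<le> dist x y * E f f"
proof (cases "f constant_on UNIV")
  case True
  then have "f x = f y" by (auto simp: constant_on_def)
  then show ?thesis by (simp add: RF1_nonneg assms)
next
  case False
  then have pos: "E f f > 0"
    using RF1_zero[OF assms] RF1_nonneg[OF assms] by linarith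
  have "ennreal (\<bar>f x - f y\<bar>\<^sup>2 / E f f) \<le> ennreal (dist x y)"
    unfolding dist_eq_resistance resistance_def
    by (rule SUP_upper) (use assms False in auto)
  then have "\<bar>f x - f y\<bar>\<^sup>2 / E f f \<le> dist x y" by simp
  then show ?thesis using pos by (simp add: field_simps)
qed

lemma abs_diff_le:
  assumes "f \<in> F"
  shows "\<bar>f x - f y\<bar> \<le> sqrt (dist x y) * sqrt (E f f)"
  using real_sqrt_le_mono[OF dist_energy_bound[OF assms, of x y]] by (simp add: real_sqrt_mult)

lemma continuous_mem:
  assumes "f \<in> F"
  shows "continuous_on UNIV f"
proof -
  have "(f \<longlongrightarrow> f x) (at x)" for x
  proof (rule Lim_null_comparison[THEN LIM_zero_cancel])
    show "\<forall>\<^sub>F y in at x. norm (f y - f x) \<le> sqrt (dist y x) * sqrt (E f f)"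
      using abs_diff_le[OF assms] by simp
    have "((\<lambda>y. sqrt (dist y x) * sqrt (E f f)) \<longlongrightarrow> sqrt (dist x x) * sqrt (E f f)) (at x)"
      by (intro tendsto_intros)
    then show "((\<lambda>y. sqrt (dist y x) * sqrt (E f f)) \<longlongrightarrow> 0) (at x)" by simp
  qed
  then show ?thesis by (simp add: continuous_on_def)
qed

text \<open>Energy controls only oscillations, so convergence at one anchor point \<open>p\<close>
  is needed to exclude a drifting constant.\<close>

lemma pointwise_convergence:
  assumes "\<And>n. u n \<in> F" "g \<in> F"
    and "(\<lambda>n. E (\<lambda>x. u n x - g x) (\<lambda>x. u n x - g x)) \<longlonglongrightarrow> 0"
    and "(\<lambda>n. u n p) \<longlonglongrightarrow> g p"
  shows "(\<lambda>n. u n x) \<longlonglongrightarrow> g x"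
proof -
  have "(\<lambda>n. (u n x - g x) - (u n p - g p)) \<longlonglongrightarrow> 0"
  proof (rule Lim_null_comparison)
    show "\<forall>\<^sub>F n in sequentially. norm ((u n x - g x) - (u n p - g p))
        \<le> sqrt (dist x p) * sqrt (E (\<lambda>x. u n x - g x) (\<lambda>x. u n x - g x))"
      using abs_diff_le[OF diff_mem[OF assms(1,2)], where x = x and y = p] by simp
    show "(\<lambda>n. sqrt (dist x p) * sqrt (E (\<lambda>x. u n x - g x) (\<lambda>x. u n x - g x))) \<longlonglongrightarrow> 0"
      using tendsto_mult_left[OF tendsto_real_sqrt[OF assms(3)]] by simp
  qed
  from tendsto_add[OF tendsto_add[OF this assms(4)] tendsto_const[of "g x - g p"]]
  show ?thesis by simp
qed

text \<open>Projection onto a closed affine subspace of a Hilbert space, carried out with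
  representatives: the parallelogram law makes a minimizing sequence Cauchy, \<open>RF2\<close>
  gives a limit modulo constants, and one point of \<open>V\<close> fixes the constant.\<close>

lemma minimizer_exists:
  assumes "finite V" "V \<noteq> {}"
  shows "\<exists>u\<in>F. (\<forall>x\<in>V. u x = f x) \<and> (\<forall>v\<in>F. (\<forall>x\<in>V. v x = f x) \<longrightarrow> E u u \<le> E v v)"
proof -
  define A where "A = {v \<in> F. \<forall>x\<in>V. v x = f x}"
  define I where "I = (INF v\<in>A. E v v)"
  have ne: "A \<noteq> {}" using RF3[OF assms(1), of f] by (auto simp: A_def)
  have bdd: "bdd_below ((\<lambda>v. E v v) ` A)"
    by (rule bdd_belowI[of _ 0]) (auto simp: A_def RF1_nonneg)
  have lower: "I \<le> E v v" if "v \<in> A" for v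
    unfolding I_def by (rule cINF_lower[OF bdd that])
  have "\<exists>v\<in>A. E v v < I + 1 / real (Suc n)" for n
  proof -
    have "Inf ((\<lambda>v. E v v) ` A) < I + 1 / real (Suc n)" unfolding I_def by simp
    from cInf_lessD[OF _ this] ne show ?thesis by auto
  qed
  then obtain u where u: "\<And>n. u n \<in> A" "\<And>n. E (u n) (u n) < I + 1 / real (Suc n)" by metis
  have uF: "u n \<in> F" for n using u(1)[of n] by (simp add: A_def)
  have close: "E (\<lambda>x. v x - w x) (\<lambda>x. v x - w x) \<le> 2 * E v v + 2 * E w w - 4 * I"
    if "v \<in> A" "w \<in> A" for v w
  proof -
    have vw: "v \<in> F" "w \<in> F" using that by (auto simp: A_def)
    have "(\<lambda>x. 1/2 * (v x + w x)) \<in> A"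
      using that scale_mem[OF add_mem[OF vw], of "1/2"] by (auto simp: A_def)
    from lower[OF this] show ?thesis using parallelogram[OF vw] by simp
  qed
  have "\<exists>g\<in>F. (\<lambda>n. E (\<lambda>x. u n x - g x) (\<lambda>x. u n x - g x)) \<longlonglongrightarrow> 0"
  proof (rule RF2[OF uF])
    fix e :: real assume "e > 0"
    \<comment> \<open>The parallelogram bound leaves 2/(m+1) + 2/(n+1), at most 4/(M+1).\<close>
    then obtain M where M: "1 / real (Suc M) < e / 4"
      using reals_Archimedean[of "e / 4"] by (auto simp: inverse_eq_divide)
    have "E (\<lambda>x. u m x - u n x) (\<lambda>x. u m x - u n x) < e" if "m \<ge> M" "n \<ge> M" for m n
    proof -
      have "1 / real (Suc m) \<le> 1 / real (Suc M)" "1 / real (Suc n) \<le> 1 / real (Suc M)"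
        using that by (auto simp: field_simps)
      then show ?thesis
        using close[OF u(1) u(1), of m n] u(2)[of m] u(2)[of n] M by argo
    qed
    then show "\<exists>M. \<forall>m\<ge>M. \<forall>n\<ge>M. E (\<lambda>x. u m x - u n x) (\<lambda>x. u m x - u n x) < e" by blast
  qed
  then obtain g0 where g0: "g0 \<in> F" "(\<lambda>n. E (\<lambda>x. u n x - g0 x) (\<lambda>x. u n x - g0 x)) \<longlonglongrightarrow> 0"
    by blast
  obtain p where p: "p \<in> V" using assms(2) by blast
  define g where "g = (\<lambda>x. g0 x + (f p - g0 p))"
  have g: "g \<in> F" unfolding g_def by (intro add_mem const_mem g0)
  have "E (\<lambda>x. u n x - g x) (\<lambda>x. u n x - g x) = E (\<lambda>x. u n x - g0 x) (\<lambda>x. u n x - g0 x)" for n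
    unfolding g_def by (rule E_diff_shift[OF uF g0(1)])
  with g0(2) have lim: "(\<lambda>n. E (\<lambda>x. u n x - g x) (\<lambda>x. u n x - g x)) \<longlonglongrightarrow> 0" by simp
  have upx: "u n x = f x" if "x \<in> V" for n x using u(1)[of n] that by (simp add: A_def)
  have eq: "g x = f x" if "x \<in> V" for x
  proof (rule LIMSEQ_unique)
    show "(\<lambda>n. u n x) \<longlonglongrightarrow> g x"
      by (rule pointwise_convergence[OF uF g lim, of p]) (simp add: upx[OF p] g_def)
    show "(\<lambda>n. u n x) \<longlonglongrightarrow> f x" by (simp add: upx[OF that])
  qed
  have gA: "g \<in> A" using g eq by (simp add: A_def)
  \<comment> \<open>The triangle inequality for the seminorm \<open>sqrt (E v v)\<close>, applied to
    g = u n - (u n - g), transfers the infimum to the limit.\<close>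
  have "sqrt (E g g) \<le> sqrt I"
  proof (rule LIMSEQ_le[of "\<lambda>n. sqrt (E g g)"])
    let ?d = "\<lambda>n. sqrt (E (\<lambda>x. u n x - g x) (\<lambda>x. u n x - g x))"
    have "(\<lambda>n. ?d n + sqrt (I + 1 / real (Suc n))) \<longlonglongrightarrow> sqrt 0 + sqrt (I + 0)"
      by (intro tendsto_intros lim LIMSEQ_Suc[OF lim_1_over_n])
    then show "(\<lambda>n. ?d n + sqrt (I + 1 / real (Suc n))) \<longlonglongrightarrow> sqrt I" by simp
    have "sqrt (E g g) \<le> ?d n + sqrt (I + 1 / real (Suc n))" for n
    proof -
      have "E g g \<le> (?d n + sqrt (E (u n) (u n)))\<^sup>2"
      proof -
        have d: "(\<lambda>x. u n x - g x) \<in> F" by (rule diff_mem[OF uF g])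
        have "(\<lambda>x. u n x - (u n x - g x)) = g" by simp
        then have "E g g = E (u n) (u n) - 2 * E (u n) (\<lambda>x. u n x - g x)
            + E (\<lambda>x. u n x - g x) (\<lambda>x. u n x - g x)"
          using E_diff_self[OF uF d, of n] by simp
        then show ?thesis
          using Cauchy_Schwarz[OF uF d, of n] RF1_nonneg[OF uF, of n] RF1_nonneg[OF d]
          by (simp add: power2_sum abs_le_iff algebra_simps)
      qed
      then have "sqrt (E g g) \<le> ?d n + sqrt (E (u n) (u n))"
        using RF1_nonneg[OF uF, of n] RF1_nonneg[OF diff_mem[OF uF g], of n]
        by (simp add: real_le_lsqrt RF1_nonneg g)
      also have "\<dots> \<le> ?d n + sqrt (I + 1 / real (Suc n))" using u(2)[of n] by simp
      finally show ?thesis .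
    qed
    then show "\<exists>N. \<forall>n\<ge>N. sqrt (E g g) \<le> ?d n + sqrt (I + 1 / real (Suc n))" by blast
  qed simp
  then have "E g g \<le> I" by simp
  then show ?thesis using gA lower by (force simp: A_def)
qed

text \<open>Uniqueness is strict convexity modulo constants: comparison with the midpoint forces two
  minimizers to differ by a constant, which is 0 at a point of \<open>V\<close>.\<close>

lemma harmonic_extension_ex1:
  assumes "finite V" "V \<noteq> {}"
  shows "\<exists>!u. u \<in> F \<and> (\<forall>x\<in>V. u x = f x) \<and> (\<forall>v\<in>F. (\<forall>x\<in>V. v x = f x) \<longrightarrow> E u u \<le> E v v)"
proof (rule ex_ex1I)
  show "\<exists>u. u \<in> F \<and> (\<forall>x\<in>V. u x = f x) \<and> (\<forall>v\<in>F. (\<forall>x\<in>V. v x = f x) \<longrightarrow> E u u \<le> E v v)"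
    using minimizer_exists[OF assms] by blast
next
  fix u v
  assume u: "u \<in> F \<and> (\<forall>x\<in>V. u x = f x) \<and> (\<forall>v\<in>F. (\<forall>x\<in>V. v x = f x) \<longrightarrow> E u u \<le> E v v)"
    and v: "v \<in> F \<and> (\<forall>x\<in>V. v x = f x) \<and> (\<forall>u\<in>F. (\<forall>x\<in>V. u x = f x) \<longrightarrow> E v v \<le> E u u)"
  have F: "u \<in> F" "v \<in> F" using u v by auto
  have "E u u \<le> E (\<lambda>x. 1/2 * (u x + v x)) (\<lambda>x. 1/2 * (u x + v x))"
    using u v scale_mem[OF add_mem[OF F], of "1/2"] by auto
  moreover have "E u u = E v v" using u v by (meson order_antisym)
  ultimately have "E (\<lambda>x. u x - v x) (\<lambda>x. u x - v x) \<le> 0" using parallelogram[OF F] by simp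
  then have "(\<lambda>x. u x - v x) constant_on UNIV"
    using RF1_zero[OF diff_mem[OF F]] RF1_nonneg[OF diff_mem[OF F]] by simp
  then obtain c where c: "\<And>x. u x - v x = c" by (auto simp: constant_on_def)
  obtain p where "p \<in> V" using assms by blast
  with u v c[of p] have "c = 0" by auto
  with c show "u = v" by auto
qed

context
  fixes V :: "'a set"
  assumes V: "finite V" "V \<noteq> {}"
begin

lemma harmonic_extension_props:
  "harmonic_extension E F V f \<in> F"
  "x \<in> V \<Longrightarrow> harmonic_extension E F V f x = f x"
  "v \<in> F \<Longrightarrow> (\<And>x. x \<in> V \<Longrightarrow> v x = f x) \<Longrightarrow>
     E (harmonic_extension E F V f) (harmonic_extension E F V f) \<le> E v v"
  using theI'[OF harmonic_extension_ex1[OF V, of f]] unfolding harmonic_extension_def by blast+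

text \<open>First variation: adding \<open>t * v\<close> keeps the values on \<open>V\<close>, so
  minimality makes 2 t E(u, v) + t^2 E(v, v) nonnegative for every \<open>t\<close>; the
  discriminant bound with constant term 0 kills the linear coefficient.\<close>

lemma harmonic_extension_orthogonal:
  assumes "v \<in> F" "\<And>x. x \<in> V \<Longrightarrow> v x = 0"
  shows "E (harmonic_extension E F V f) v = 0"
proof -
  let ?u = "harmonic_extension E F V f"
  note u = harmonic_extension_props[where f = f]
  have "0 \<le> 0 + 2 * t * E ?u v + t\<^sup>2 * E v v" for t
    using u(3)[OF add_mem[OF u(1) scale_mem[OF assms(1), of t]]] E_line[OF u(1) assms(1), of t]
      assms(2) u(2)
    by simp
  from quadratic_nonneg_discriminant[OF this RF1_nonneg[OF assms(1)]] show ?thesis by simp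
qed

text \<open>Unlike minimality, orthogonality is a linear condition on \<open>u\<close>; through this
  criterion the extension is seen to be linear in its boundary values.\<close>

lemma harmonic_extension_unique:
  assumes "u \<in> F" "\<And>x. x \<in> V \<Longrightarrow> u x = f x"
    and orth: "\<And>v. v \<in> F \<Longrightarrow> (\<And>x. x \<in> V \<Longrightarrow> v x = 0) \<Longrightarrow> E u v = 0"
  shows "harmonic_extension E F V f = u"
  unfolding harmonic_extension_def
proof (rule the1_equality[OF harmonic_extension_ex1[OF V]], intro conjI ballI impI)
  fix v assume v: "v \<in> F" "\<forall>x\<in>V. v x = f x"
  have d: "(\<lambda>x. v x - u x) \<in> F" using diff_mem v assms by blast
  have "E v v = E (\<lambda>x. u x + 1 * (v x - u x)) (\<lambda>x. u x + 1 * (v x - u x))" by simp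
  also have "\<dots> = E u u + E (\<lambda>x. v x - u x) (\<lambda>x. v x - u x)"
    using orth[OF d] v assms by (subst E_line[OF assms(1) d]) auto
  finally show "E u u \<le> E v v" using RF1_nonneg[OF d] by simp
qed (use assms in auto)

lemma harmonic_extension_cong:
  "(\<And>x. x \<in> V \<Longrightarrow> f x = g x) \<Longrightarrow> harmonic_extension E F V f = harmonic_extension E F V g"
  by (rule harmonic_extension_unique)
    (auto simp: harmonic_extension_props harmonic_extension_orthogonal)

lemma harmonic_extension_add:
  "harmonic_extension E F V (\<lambda>x. f x + g x)
    = (\<lambda>x. harmonic_extension E F V f x + harmonic_extension E F V g x)"
  by (rule harmonic_extension_unique)
    (auto simp: harmonic_extension_props harmonic_extension_orthogonal add_mem add_left)

lemma harmonic_extension_scale: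
  "harmonic_extension E F V (\<lambda>x. c * f x) = (\<lambda>x. c * harmonic_extension E F V f x)"
  by (rule harmonic_extension_unique)
    (auto simp: harmonic_extension_props harmonic_extension_orthogonal scale_mem scale_left)

lemma harmonic_extension_const: "harmonic_extension E F V (\<lambda>_. c) = (\<lambda>_. c)"
  by (rule harmonic_extension_unique) (auto simp: const_mem E_const_left)

lemma harmonic_extension_sum:
  "harmonic_extension E F V (\<lambda>x. \<Sum>i\<in>I. f i x) = (\<lambda>x. \<Sum>i\<in>I. harmonic_extension E F V (f i) x)"
  by (induction I rule: infinite_finite_induct)
    (simp_all add: harmonic_extension_const harmonic_extension_add)

section \<open>Traces and their conductances\<close>

lemma trace_sym: "trace_form E F V f g = trace_form E F V g f"
  by (simp add: trace_form_def RF1_sym harmonic_extension_props)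

lemma trace_add_left:
  "trace_form E F V (\<lambda>x. f x + g x) k = trace_form E F V f k + trace_form E F V g k"
  by (simp add: trace_form_def harmonic_extension_add add_left harmonic_extension_props)

lemma trace_scale_left: "trace_form E F V (\<lambda>x. c * f x) g = c * trace_form E F V f g"
  by (simp add: trace_form_def harmonic_extension_scale scale_left harmonic_extension_props)

lemma trace_const_left: "trace_form E F V (\<lambda>_. c) g = 0"
  by (simp add: trace_form_def harmonic_extension_const E_const_left harmonic_extension_props)

lemma trace_sum_left:
  "trace_form E F V (\<lambda>x. \<Sum>i\<in>I. f i x) k = (\<Sum>i\<in>I. trace_form E F V (f i) k)"
  by (induction I rule: infinite_finite_induct)
    (simp_all add: trace_const_left trace_add_left)

lemma trace_cong:
  assumes "\<And>x. x \<in> V \<Longrightarrow> f x = f' x" "\<And>x. x \<in> V \<Longrightarrow> g x = g' x"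
  shows "trace_form E F V f g = trace_form E F V f' g'"
  using harmonic_extension_cong[OF assms(1)] harmonic_extension_cong[OF assms(2)]
  by (simp add: trace_form_def)

text \<open>Two functions with the same values on \<open>V\<close> differ by something orthogonal to
  harmonic extensions, so one of the two extensions may be dropped. This exactness is the reason why
  the symmetric part causes no consistency error later.\<close>

lemma trace_eq_energy:
  assumes "g \<in> F"
  shows "trace_form E F V f g = E (harmonic_extension E F V f) g"
proof -
  have "E (harmonic_extension E F V f) (\<lambda>x. harmonic_extension E F V g x - g x) = 0"
    by (rule harmonic_extension_orthogonal)
      (auto simp: harmonic_extension_props assms intro!: diff_mem)
  then show ?thesis
    by (simp add: trace_form_def E_diff_right harmonic_extension_props assms)
qed

lemma trace_le:
  "v \<in> F \<Longrightarrow> (\<And>x. x \<in> V \<Longrightarrow> v x = f x) \<Longrightarrow> trace_form E F V f f \<le> E v v"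
  by (simp add: trace_form_def harmonic_extension_props(3))

lemma trace_nonneg: "0 \<le> trace_form E F V f f"
  by (simp add: trace_form_def harmonic_extension_props(1) RF1_nonneg)

text \<open>The clipped harmonic extension is a competitor for the clipped boundary values, and
  \<open>RF5\<close> bounds its energy.\<close>

lemma trace_Markov:
  "trace_form E F V (\<lambda>x. max 0 (min 1 (f x))) (\<lambda>x. max 0 (min 1 (f x))) \<le> trace_form E F V f f"
proof -
  let ?u = "harmonic_extension E F V f"
  note u = harmonic_extension_props[where f = f]
  have "trace_form E F V (\<lambda>x. max 0 (min 1 (f x))) (\<lambda>x. max 0 (min 1 (f x)))
      \<le> E (\<lambda>x. max 0 (min 1 (?u x))) (\<lambda>x. max 0 (min 1 (?u x)))"
    by (rule trace_le[OF RF5_mem[OF u(1)]]) (simp add: u(2))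
  also have "\<dots> \<le> trace_form E F V f f" unfolding trace_form_def by (rule RF5_le[OF u(1)])
  finally show ?thesis .
qed

text \<open>Clipping turns 1_x - t 1_y back into 1_x, so by the Markov property the perturbation
  cannot lower the energy. Dividing by \<open>t\<close> and letting \<open>t\<close> tend to 0
  leaves the sign of the mixed term.\<close>

lemma trace_indicator_nonpos:
  assumes "x \<noteq> y"
  shows "trace_form E F V (indicator {x}) (indicator {y}) \<le> 0"
proof -
  let ?a = "indicator {x} :: 'a \<Rightarrow> real" and ?b = "indicator {y} :: 'a \<Rightarrow> real"
  let ?T = "trace_form E F V"
  have key: "2 * t * ?T ?a ?b \<le> t\<^sup>2 * ?T ?b ?b" if "t > 0" for t
  proof -
    let ?f = "\<lambda>z. ?a z + (- t) * ?b z"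
    have "(\<lambda>z. max 0 (min 1 (?f z))) = ?a"
      using assms that by (auto simp: indicator_def fun_eq_iff)
    then have "?T ?a ?a \<le> ?T ?f ?f" using trace_Markov[of ?f] by simp
    also have "?T ?f ?f = ?T ?a ?a + 2 * (- t) * ?T ?a ?b + (- t)\<^sup>2 * ?T ?b ?b"
      unfolding trace_form_def harmonic_extension_add harmonic_extension_scale
      by (rule E_line) (rule harmonic_extension_props(1))+
    finally show ?thesis by simp
  qed
  have "?T ?a ?b \<le> e" if "e > 0" for e
  proof -
    define t where "t = e / (1 + ?T ?b ?b)"
    have t: "t > 0" "t * ?T ?b ?b \<le> e"
      using that trace_nonneg[of ?b] by (auto simp: t_def field_simps)
    have "2 * ?T ?a ?b \<le> t * ?T ?b ?b" using key[OF t(1)] t(1) by (simp add: power2_eq_square)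
    then show ?thesis using t that by simp
  qed
  then show ?thesis using field_le_epsilon[of "?T ?a ?b" 0] by simp
qed

lemma trace_expansion:
  "trace_form E F V f g
    = (\<Sum>x\<in>V. \<Sum>y\<in>V. f x * g y * trace_form E F V (indicator {x}) (indicator {y}))"
proof -
  have dec: "(\<Sum>y\<in>V. k y * indicator {y} x) = k x" if "x \<in> V" for k :: "'a \<Rightarrow> real" and x
    using that V by (simp add: indicator_def if_distrib sum.delta cong: if_cong)
  have exp: "trace_form E F V k k' = (\<Sum>x\<in>V. k x * trace_form E F V (indicator {x}) k')" for k k'
  proof -
    have "trace_form E F V k k' = trace_form E F V (\<lambda>x. \<Sum>y\<in>V. k y * indicator {y} x) k'"
      by (rule trace_cong) (simp_all add: dec)
    then show ?thesis by (simp add: trace_sum_left trace_scale_left)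
  qed
  show ?thesis
    unfolding exp[of f g]
  proof (intro sum.cong refl)
    fix x
    have "trace_form E F V (indicator {x}) g
        = (\<Sum>y\<in>V. g y * trace_form E F V (indicator {x}) (indicator {y}))"
      by (subst trace_sym, subst exp, intro sum.cong refl) (simp add: trace_sym[of "indicator {x}"])
    then show "f x * trace_form E F V (indicator {x}) g
        = (\<Sum>y\<in>V. f x * g y * trace_form E F V (indicator {x}) (indicator {y}))"
      by (simp add: sum_distrib_left mult.assoc)
  qed
qed

text \<open>Constants have energy 0, so the matrix of the trace in the basis of indicators has
  vanishing row sums. Such a symmetric form depends on differences only; the diagonal terms of the
  double sum are 0 by themselves.\<close>

lemma trace_eq_sum:
  "trace_form E F V f g = 1/2 * (\<Sum>x\<in>V. \<Sum>y\<in>V.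
     - trace_form E F V (indicator {x}) (indicator {y}) * (f x - f y) * (g x - g y))"
proof -
  let ?T = "\<lambda>x y. trace_form E F V (indicator {x}) (indicator {y})"
  have row: "(\<Sum>y\<in>V. ?T x y) = 0" for x
  proof -
    have "(\<Sum>y\<in>V. ?T x y) = trace_form E F V (\<lambda>z. \<Sum>y\<in>V. indicator {y} z) (indicator {x})"
      by (simp add: trace_sum_left trace_sym[of "indicator {x}"])
    also have "\<dots> = trace_form E F V (\<lambda>_. 1) (indicator {x})"
      using V by (intro trace_cong) (simp_all add: indicator_def sum.delta)
    finally show ?thesis by (simp add: trace_const_left)
  qed
  have "(\<Sum>x\<in>V. \<Sum>y\<in>V. - ?T x y * (f x - f y) * (g x - g y))
      = (\<Sum>x\<in>V. \<Sum>y\<in>V. f x * g y * ?T x y) + (\<Sum>x\<in>V. \<Sum>y\<in>V. f y * g x * ?T x y)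
      - (\<Sum>x\<in>V. f x * g x * (\<Sum>y\<in>V. ?T x y)) - (\<Sum>x\<in>V. \<Sum>y\<in>V. f y * g y * ?T x y)"
    by (simp add: sum_distrib_left sum.distrib[symmetric] sum_subtractf[symmetric] algebra_simps)
  also have "(\<Sum>x\<in>V. \<Sum>y\<in>V. f y * g y * ?T x y) = (\<Sum>y\<in>V. f y * g y * (\<Sum>x\<in>V. ?T y x))"
    by (subst sum.swap) (simp add: sum_distrib_left trace_sym)
  also have "(\<Sum>x\<in>V. \<Sum>y\<in>V. f y * g x * ?T x y) = trace_form E F V g f"
    unfolding trace_expansion[of g f] by (simp add: mult.commute)
  also have "\<dots> = trace_form E F V f g" by (rule trace_sym)
  finally show ?thesis by (simp add: row trace_expansion[of f g])
qed

text \<open>Existence combines the expansion in differences with the sign of the off-diagonal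
  entries. For uniqueness, the indicators of two distinct points \<open>a\<close>, \<open>b\<close>
  single out the pairs (a, b) and (b, a), so the trace at them is - c a b.\<close>

lemma conductance_eq:
  "conductance E F V = (\<lambda>x y. if x \<in> V \<and> y \<in> V \<and> x \<noteq> y
     then - trace_form E F V (indicator {x}) (indicator {y}) else 0)" (is "_ = ?c")
  unfolding conductance_def
proof (rule the_equality)
  let ?T = "\<lambda>x y. trace_form E F V (indicator {x}) (indicator {y})"
  have main: "trace_form E F V f g =
      1/2 * (\<Sum>x\<in>V. \<Sum>y\<in>V - {x}. ?c x y * (f x - f y) * (g x - g y))" for f g
  proof -
    have "(\<Sum>y\<in>V - {x}. ?c x y * (f x - f y) * (g x - g y))
        = (\<Sum>y\<in>V. - ?T x y * (f x - f y) * (g x - g y))" if "x \<in> V" for x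
      using V that by (subst sum.remove[of V x]) (auto intro!: sum.cong)
    then show ?thesis by (simp add: trace_eq_sum[of f g])
  qed
  then show "(\<forall>x y. ?c x y = ?c y x) \<and> (\<forall>x y. 0 \<le> ?c x y) \<and>
      (\<forall>x y. x \<notin> V \<or> y \<notin> V \<or> x = y \<longrightarrow> ?c x y = 0) \<and>
      (\<forall>f g. trace_form E F V f g =
         1/2 * (\<Sum>x\<in>V. \<Sum>y\<in>V - {x}. ?c x y * (f x - f y) * (g x - g y)))"
    by (auto simp: trace_sym trace_indicator_nonpos)
  fix c
  assume c: "(\<forall>x y. c x y = c y x) \<and> (\<forall>x y. 0 \<le> c x y) \<and>
      (\<forall>x y. x \<notin> V \<or> y \<notin> V \<or> x = y \<longrightarrow> c x y = 0) \<and>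
      (\<forall>f g. trace_form E F V f g =
         1/2 * (\<Sum>x\<in>V. \<Sum>y\<in>V - {x}. c x y * (f x - f y) * (g x - g y)))"
  have "c a b = ?c a b" for a b
  proof (cases "a \<in> V \<and> b \<in> V \<and> a \<noteq> b")
    case True
    let ?g = "\<lambda>x y. c x y * (indicator {a} x - indicator {a} y) * (indicator {b} x - indicator {b} y)"
    have "(\<Sum>x\<in>V. \<Sum>y\<in>V - {x}. ?g x y) = (\<Sum>x\<in>V. \<Sum>y\<in>V. ?g x y)"
      using V by (intro sum.cong[OF refl], subst (2) sum.remove) auto
    also have "\<dots> = (\<Sum>x\<in>V. \<Sum>y\<in>V. - (if x = a then (if y = b then c a b else 0) else 0)
             - (if x = b then (if y = a then c b a else 0) else 0))"
      using True by (intro sum.cong refl) (auto simp: indicator_def)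
    also have "\<dots> = - 2 * c a b"
    proof -
      have "(\<Sum>x\<in>V. \<Sum>y\<in>V. if x = p then (if y = q then k else 0) else 0) = k"
        if "p \<in> V" "q \<in> V" for p q and k :: real
      proof -
        have "(\<Sum>y\<in>V. if x = p then (if y = q then k else 0) else 0) = (if x = p then k else 0)" for x
          using that V by simp
        then show ?thesis using that V by simp
      qed
      then show ?thesis using True c by (simp add: sum_subtractf sum_negf)
    qed
    moreover have "trace_form E F V (indicator {a}) (indicator {b})
        = 1/2 * (\<Sum>x\<in>V. \<Sum>y\<in>V - {x}. ?g x y)"
      using c by blast
    ultimately show ?thesis using True by simp
  next
    case False
    then show ?thesis using c by auto
  qed
  then show "c = ?c" by (intro ext)
qed

lemma trace_eq_conductance:
  "trace_form E F V f g = 1/2 * (\<Sum>x\<in>V. \<Sum>y\<in>V. conductance E F V x y * ((f x - f y) * (g x - g y)))"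
  unfolding trace_eq_sum[of f g] conductance_eq
  by (intro arg_cong[of _ _ "times (1/2)"] sum.cong refl) auto

lemma conductance_props:
  "conductance E F V x y = conductance E F V y x"
  "0 \<le> conductance E F V x y"
  unfolding conductance_eq by (auto simp: trace_sym trace_indicator_nonpos)

end

end

section \<open>Measures on compact metric spaces\<close>

text \<open>Closed sets form an intersection-stable generator of the Borel sets, and the indicator
  of a nonempty closed set is the bounded pointwise limit of the cut-offs max 0 (1 - n * infdist x
  C).\<close>

lemma finite_measure_eqI_continuous:
  fixes M N :: "'a::metric_space measure"
  assumes sets: "sets M = sets borel" "sets N = sets borel"
    and fin: "finite_measure M" "finite_measure N"
    and eq: "\<And>\<phi>::'a \<Rightarrow> real. continuous_on UNIV \<phi> \<Longrightarrow> bounded (range \<phi>) \<Longrightarrow> (LINT x|M. \<phi> x) = (LINT x|N. \<phi> x)"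
  shows "M = N"
proof (rule measure_eqI_generator_eq[where E = "Collect closed" and \<Omega> = UNIV and A = "\<lambda>_. UNIV"])
  show "Int_stable (Collect (closed :: 'a set \<Rightarrow> bool))" by (auto simp: Int_stable_def)
  have "sets borel = sigma_sets UNIV (Collect (closed :: 'a set \<Rightarrow> bool))"
    by (subst borel_eq_closed) simp
  then show "sets M = sigma_sets UNIV (Collect closed)" "sets N = sigma_sets UNIV (Collect closed)"
    by (simp_all add: sets)
  show "emeasure M UNIV \<noteq> \<infinity>" using finite_measure.emeasure_finite[OF fin(1)] by simp
  fix C :: "'a set" assume "C \<in> Collect closed"
  then have C: "closed C" by simp
  show "emeasure M C = emeasure N C"
  proof (cases "C = {}")
    case False
    define \<phi> where "\<phi> n x = max 0 (1 - real n * infdist x C)" for n x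
    have cont: "continuous_on UNIV (\<phi> n)" for n
      unfolding \<phi>_def by (intro continuous_intros)
    have bd: "\<bar>\<phi> n x\<bar> \<le> 1" for n x
      using infdist_nonneg[of x C] by (auto simp: \<phi>_def)
    have ind: "(\<lambda>n. \<phi> n x) \<longlonglongrightarrow> indicator C x" for x
    proof (cases "x \<in> C")
      case False
      then have "infdist x C > 0"
        using C \<open>C \<noteq> {}\<close> in_closed_iff_infdist_zero[of C x] infdist_nonneg[of x C] by force
      then obtain n0 where n0: "1 < real n0 * infdist x C"
        using reals_Archimedean3[of "infdist x C"] by blast
      have "\<phi> n x = 0" if "n \<ge> n0" for n
      proof -
        have "real n0 * infdist x C \<le> real n * infdist x C"
          using that by (intro mult_right_mono) (auto simp: infdist_nonneg)
        with n0 show ?thesis by (simp add: \<phi>_def)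
      qed
      then have "\<forall>\<^sub>F n in sequentially. \<phi> n x = indicator C x"
        using False by (auto simp: eventually_sequentially)
      then show ?thesis by (rule tendsto_eventually)
    qed (simp add: \<phi>_def)
    have lim: "(\<lambda>n. LINT x|L. \<phi> n x) \<longlonglongrightarrow> measure L C"
      if L: "sets L = sets borel" "finite_measure L" for L :: "'a measure"
    proof -
      interpret finite_measure L by fact
      have "(\<lambda>n. LINT x|L. \<phi> n x) \<longlonglongrightarrow> (LINT x|L. indicator C x)"
      proof (rule integral_dominated_convergence[where w = "\<lambda>_. 1"])
        show "indicator C \<in> borel_measurable L"
          using C L by (intro borel_measurable_indicator) simp
        show "\<phi> n \<in> borel_measurable L" for n
          using borel_measurable_continuous_onI[OF cont] L(1) by (simp cong: measurable_cong_sets)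
      qed (use bd ind in auto)
      moreover have "C \<inter> space L = C" using sets_eq_imp_space_eq[OF L(1)] by simp
      ultimately show ?thesis by simp
    qed
    have "(LINT x|M. \<phi> n x) = (LINT x|N. \<phi> n x)" for n
      using bd by (intro eq cont) (auto simp: bounded_iff)
    then have "measure M C = measure N C"
      using lim[OF sets(1) fin(1)] lim[OF sets(2) fin(2)] LIMSEQ_unique by force
    then show ?thesis
      using fin by (simp add: finite_measure.emeasure_eq_measure)
  qed simp
qed auto

section \<open>Coding a compact metric space by ternary digits\<close>

lemma ternary_geometric_sums: "(\<lambda>k. 2 / 3 ^ Suc (k + m) :: real) sums (1 / 3 ^ m)"
proof -
  have "(\<lambda>k. (2 / 3 ^ Suc m) * (1/3) ^ k :: real) sums ((2 / 3 ^ Suc m) * (1 / (1 - 1/3)))"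
    by (intro sums_mult geometric_sums) simp
  moreover have "(\<lambda>k. (2 / 3 ^ Suc m) * (1/3) ^ k :: real) = (\<lambda>k. 2 / 3 ^ Suc (k + m))"
    by (simp add: fun_eq_iff power_add power_one_over)
  moreover have "(2 / 3 ^ Suc m) * (1 / (1 - 1/3)) = (1 / 3 ^ m :: real)" by simp
  ultimately show ?thesis by metis
qed

lemma ternary_expansion_summable: "summable (\<lambda>k. 2 * of_bool (c k) / 3 ^ Suc k :: real)"
  by (intro summable_comparison_test'[OF sums_summable[OF ternary_geometric_sums[of 0]]]) auto

text \<open>Only the digits 0 and 2 occur. At the first differing place \<open>i\<close> the terms
  differ by 2/3^(i+1), while all later places together contribute at most 1/3^(i+1), so no
  cancellation can bring two codes close.\<close>

lemma ternary_expansion_separation: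
  fixes a b :: "nat \<Rightarrow> bool"
  assumes "j < K" "a j \<noteq> b j"
  shows "1 / 3 ^ K \<le> \<bar>(\<Sum>k. 2 * of_bool (a k) / 3 ^ Suc k) - (\<Sum>k. 2 * of_bool (b k) / 3 ^ Suc k :: real)\<bar>"
proof -
  define i where "i = (LEAST k. a k \<noteq> b k)"
  have i1: "a i \<noteq> b i" unfolding i_def by (rule LeastI[of "\<lambda>k. a k \<noteq> b k" j]) (rule assms)
  have i2: "a k = b k" if "k < i" for k using not_less_Least[of k "\<lambda>k. a k \<noteq> b k"] that by (auto simp: i_def)
  have i3: "i < K" using Least_le[of "\<lambda>k. a k \<noteq> b k" j, OF assms(2)] assms(1) unfolding i_def by linarith
  define d :: "nat \<Rightarrow> real" where
    "d k = 2 * of_bool (a k) / 3 ^ Suc k - 2 * of_bool (b k) / 3 ^ Suc k" for k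
  have "(\<Sum>k. 2 * of_bool (a k) / 3 ^ Suc k) - (\<Sum>k. 2 * of_bool (b k) / 3 ^ Suc k :: real) = suminf d"
    unfolding d_def by (rule suminf_diff[OF ternary_expansion_summable ternary_expansion_summable])
  also have "suminf d = (\<Sum>k. d (k + Suc i)) + (\<Sum>k<Suc i. d k)"
    unfolding d_def by (rule suminf_split_initial_segment[OF summable_diff[OF ternary_expansion_summable ternary_expansion_summable]])
  also have "(\<Sum>k<Suc i. d k) = d i" using i2 by (simp add: d_def)
  finally have eq: "(\<Sum>k. 2 * of_bool (a k) / 3 ^ Suc k) - (\<Sum>k. 2 * of_bool (b k) / 3 ^ Suc k)
    = (\<Sum>k. d (k + Suc i)) + d i" .
  have "norm (\<Sum>k. d (k + Suc i)) \<le> (\<Sum>k. 2 / 3 ^ Suc (k + Suc i))"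
    by (rule norm_suminf_le[OF _ sums_summable[OF ternary_geometric_sums]]) (simp add: d_def diff_divide_distrib[symmetric] abs_divide)
  also have "\<dots> = 1 / 3 ^ Suc i" using sums_unique[OF ternary_geometric_sums[of "Suc i"]] by simp
  finally have "\<bar>\<Sum>k. d (k + Suc i)\<bar> \<le> 1 / 3 ^ Suc i" by simp
  moreover have "\<bar>d i\<bar> = 2 * (1 / 3 ^ Suc i)" using i1 by (cases "a i") (simp_all add: d_def)
  moreover have "(1::real) / 3 ^ K \<le> 1 / 3 ^ Suc i"
    using i3 by (intro divide_left_mono power_increasing) simp_all
  moreover have "\<bar>d i\<bar> \<le> \<bar>(\<Sum>k. d (k + Suc i)) + d i\<bar> + \<bar>\<Sum>k. d (k + Suc i)\<bar>"
    by arith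
  ultimately show ?thesis unfolding eq by linarith
qed

text \<open>Digit \<open>k\<close> of the code records membership in the \<open>k\<close>-th ball of
  a countable family containing finite covers of every radius 1/(n+1). The code \<open>s\<close>
  need not be continuous; what counts is that nearby codes share their first digits and hence come
  from nearby points.\<close>

lemma compact_metric_code:
  assumes "compact (UNIV :: 'a::metric_space set)"
  obtains s :: "'a::metric_space \<Rightarrow> real" where "range s \<subseteq> {0..1}"
    and "\<And>e. e > 0 \<Longrightarrow> \<exists>\<eta>>0. \<forall>x y. \<bar>s x - s y\<bar> < \<eta> \<longrightarrow> dist x y < e"
proof -
  have "\<exists>T. finite T \<and> (UNIV :: 'a set) = (\<Union>x\<in>T. ball x (1 / real (Suc n)))" for n
  proof -
    have "(UNIV :: 'a set) \<subseteq> (\<Union>x\<in>UNIV. ball x (1 / real (Suc n)))" by auto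
    from compactE_image[OF assms _ this]
    obtain T where "finite T" "(UNIV :: 'a set) \<subseteq> (\<Union>x\<in>T. ball x (1 / real (Suc n)))" by auto
    then show ?thesis by blast
  qed
  then obtain T where T: "\<And>n. finite (T n)"
      "\<And>n. (UNIV :: 'a set) = (\<Union>x\<in>T n. ball x (1 / real (Suc n)))" by metis
  define \<U> where "\<U> = (\<Union>n. (\<lambda>x. ball x (1 / real (Suc n))) ` T n)"
  have cU: "countable \<U>" unfolding \<U>_def by (rule countable_UN) (simp_all add: countable_finite T(1))
  define U where "U = from_nat_into \<U>"
  \<comment> \<open>A ball of radius below e/2 has all mutual distances below e, and the finitely
    many balls of one cover occur among the first \<open>K\<close> members of the family.\<close>
  have cov: "\<exists>K. \<forall>x. \<exists>k<K. x \<in> U k \<and> (\<forall>y\<in>U k. dist x y < e)" if "e > 0" for e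
  proof -
    obtain n where n: "1 / real (Suc n) < e / 2"
      using reals_Archimedean[of "e / 2"] \<open>e > 0\<close> by (auto simp: inverse_eq_divide)
    have "\<exists>k. U k = ball x (1 / real (Suc n))" if "x \<in> T n" for x
      unfolding U_def by (rule from_nat_into_surj[OF cU]) (use that in \<open>auto simp: \<U>_def\<close>)
    then obtain k where k: "\<And>x. x \<in> T n \<Longrightarrow> U (k x) = ball x (1 / real (Suc n))" by metis
    have "\<exists>j<Suc (Max (k ` T n)). x \<in> U j \<and> (\<forall>y\<in>U j. dist x y < e)" for x
    proof -
      obtain z where z: "z \<in> T n" "x \<in> ball z (1 / real (Suc n))" using T(2)[of n] by blast
      have "dist x y < e" if "y \<in> ball z (1 / real (Suc n))" for y
        using z(2) that n dist_triangle[of x y z] by (simp add: dist_commute)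
      moreover have "k z < Suc (Max (k ` T n))" using z T(1) by (simp add: less_Suc_eq_le)
      ultimately show ?thesis using z k by force
    qed
    then show ?thesis by blast
  qed
  define s :: "'a \<Rightarrow> real" where "s x = (\<Sum>k. 2 * of_bool (x \<in> U k) / 3 ^ Suc k)" for x
  have geo: "(\<lambda>k. 2 / 3 ^ Suc k :: real) sums 1" using ternary_geometric_sums[of 0] by simp
  show ?thesis
  proof
    show "range s \<subseteq> {0..1}"
    proof safe
      fix x
      have "s x \<le> (\<Sum>k. 2 / 3 ^ Suc k)"
        unfolding s_def by (rule suminf_le[OF _ ternary_expansion_summable sums_summable[OF geo]]) auto
      moreover have "0 \<le> s x" unfolding s_def by (rule suminf_nonneg[OF ternary_expansion_summable]) auto
      ultimately show "s x \<in> {0..1}" using sums_unique[OF geo] by simp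
    qed
    fix e :: real assume "e > 0"
    then obtain K where K: "\<And>x. \<exists>k<K. x \<in> U k \<and> (\<forall>y\<in>U k. dist x y < e)" using cov by blast
    have "dist x y < e" if "\<bar>s x - s y\<bar> < 1 / 3 ^ K" for x y
    proof -
      obtain k where "k < K" "x \<in> U k" "\<forall>y\<in>U k. dist x y < e" using K by blast
      moreover have "y \<in> U k"
        using ternary_expansion_separation[of k K "\<lambda>k. x \<in> U k" "\<lambda>k. y \<in> U k"] that calculation
        by (force simp: s_def)
      ultimately show ?thesis by blast
    qed
    then show "\<exists>\<eta>>0. \<forall>x y. \<bar>s x - s y\<bar> < \<eta> \<longrightarrow> dist x y < e"
      by (intro exI[of _ "1 / 3 ^ K"]) auto
  qed
qed

text \<open>The inverse of the code is uniformly continuous on the range of \<open>s\<close> and so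
  extends to the closure \<open>K\<close>, with compactness of the space supplying the values at
  limit points. The closure is included because limits of measures carried by the range may charge
  it.\<close>

lemma compact_metric_continuous_image_real:
  assumes "compact (UNIV :: 'a::metric_space set)"
  obtains s :: "'a::metric_space \<Rightarrow> real" and \<pi> :: "real \<Rightarrow> 'a::metric_space" and K
  where "range s \<subseteq> {0..1}" "closed K" "range s \<subseteq> K" "continuous_on K \<pi>" "\<And>x. \<pi> (s x) = x"
proof -
  obtain s :: "'a \<Rightarrow> real" where s: "range s \<subseteq> {0..1}"
    and inv: "\<And>e. e > 0 \<Longrightarrow> \<exists>\<eta>>0. \<forall>x y. \<bar>s x - s y\<bar> < \<eta> \<longrightarrow> dist x y < e"
    using compact_metric_code[OF assms] by blast
  define K where "K = closure (range s)"
  have "\<exists>p. \<forall>e>0. \<exists>\<eta>>0. \<forall>x. \<bar>s x - t\<bar> < \<eta> \<longrightarrow> dist x p < e" if t: "t \<in> K" for t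
  proof -
    obtain x where x: "(\<lambda>n. s (x n)) \<longlonglongrightarrow> t"
    proof -
      obtain y where y: "\<And>n. y n \<in> range s" "y \<longlonglongrightarrow> t"
        using t unfolding K_def closure_sequential by blast
      then have "\<exists>x. y n = s x" for n by blast
      then obtain x where "\<And>n. y n = s (x n)" by metis
      then have "y = (\<lambda>n. s (x n))" by blast
      then show thesis using y(2) that[of x] by simp
    qed
    obtain p and r :: "nat \<Rightarrow> nat" where r: "strict_mono r" "(x \<circ> r) \<longlonglongrightarrow> p"
      using compact_imp_seq_compact[OF assms] unfolding seq_compact_def by blast
    show ?thesis
    proof (intro exI[of _ p] allI impI)
      fix e :: real assume e: "e > 0"
      then obtain \<eta> where \<eta>: "\<eta> > 0" "\<And>x y. \<bar>s x - s y\<bar> < \<eta> \<Longrightarrow> dist x y < e / 2"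
        using inv[of "e / 2"] by auto
      have "\<forall>\<^sub>F n in sequentially. dist (s (x (r n))) t < \<eta> / 2"
        using LIMSEQ_subseq_LIMSEQ[OF x r(1)] \<eta>(1) by (auto simp: o_def dest!: tendstoD[of _ _ _ "\<eta>/2"])
      moreover have "\<forall>\<^sub>F n in sequentially. dist (x (r n)) p < e / 2"
        using tendstoD[OF r(2), of "e / 2"] e by simp
      ultimately have "\<forall>\<^sub>F n in sequentially. dist (s (x (r n))) t < \<eta> / 2 \<and> dist (x (r n)) p < e / 2"
        by (rule eventually_conj)
      then obtain n where n: "\<bar>s (x (r n)) - t\<bar> < \<eta> / 2" "dist (x (r n)) p < e / 2"
        by (auto simp: eventually_sequentially dist_real_def)
      have "dist y p < e" if "\<bar>s y - t\<bar> < \<eta> / 2" for y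
      proof -
        have "dist y (x (r n)) < e / 2" by (rule \<eta>(2)) (use n that in linarith)
        then show ?thesis using n(2) dist_triangle[of y p "x (r n)"] by linarith
      qed
      then show "\<exists>\<eta>>0. \<forall>x. \<bar>s x - t\<bar> < \<eta> \<longrightarrow> dist x p < e"
        using \<eta>(1) by (intro exI[of _ "\<eta> / 2"]) auto
    qed
  qed
  then obtain \<pi> where \<pi>: "\<And>t e. t \<in> K \<Longrightarrow> e > 0 \<Longrightarrow> \<exists>\<eta>>0. \<forall>x. \<bar>s x - t\<bar> < \<eta> \<longrightarrow> dist x (\<pi> t) < e"
    by metis
  have sK: "range s \<subseteq> K" unfolding K_def by (rule closure_subset)
  show ?thesis
  proof
    show "continuous_on K \<pi>"
      unfolding continuous_on_iff
    proof (intro ballI allI impI)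
      fix t and e :: real assume t: "t \<in> K" and e: "e > 0"
      obtain \<eta> where \<eta>: "\<eta> > 0" "\<And>x. \<bar>s x - t\<bar> < \<eta> \<Longrightarrow> dist x (\<pi> t) < e / 2"
        using \<pi>[OF t, of "e / 2"] e by auto
      have "dist (\<pi> t') (\<pi> t) < e" if t': "t' \<in> K" "dist t' t < \<eta> / 2" for t'
      proof -
        obtain \<eta>' where \<eta>': "\<eta>' > 0" "\<And>x. \<bar>s x - t'\<bar> < \<eta>' \<Longrightarrow> dist x (\<pi> t') < e / 2"
          using \<pi>[OF t'(1), of "e / 2"] e by auto
        obtain x where x: "\<bar>s x - t'\<bar> < min \<eta>' (\<eta> / 2)"
        proof -
          have "0 < min \<eta>' (\<eta> / 2)" using \<eta>(1) \<eta>'(1) by simp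
          with t'(1) obtain y where "y \<in> range s" "dist y t' < min \<eta>' (\<eta> / 2)"
            unfolding K_def closure_approachable by blast
          then show thesis using that by (auto simp: dist_real_def)
        qed
        have "dist x (\<pi> t') < e / 2" by (rule \<eta>'(2)) (use x in simp)
        moreover have "dist x (\<pi> t) < e / 2"
          by (rule \<eta>(2)) (use x t'(2) in \<open>unfold dist_real_def, linarith\<close>)
        ultimately show ?thesis using dist_triangle3[of "\<pi> t'" "\<pi> t" x] by simp
      qed
      then show "\<exists>d>0. \<forall>t'\<in>K. dist t' t < d \<longrightarrow> dist (\<pi> t') (\<pi> t) < e"
        using \<eta>(1) by (intro exI[of _ "\<eta> / 2"]) auto
    qed
    show "\<pi> (s x) = x" for x
    proof (rule ccontr)
      assume "\<pi> (s x) \<noteq> x"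
      then have "dist x (\<pi> (s x)) > 0" by (metis zero_less_dist_iff)
      moreover have "s x \<in> K" using sK by blast
      ultimately obtain \<eta> where "\<eta> > 0" "\<And>y. \<bar>s y - s x\<bar> < \<eta> \<Longrightarrow> dist y (\<pi> (s x)) < dist x (\<pi> (s x))"
        using \<pi> by blast
      from this(1) this(2)[of x] show False by simp
    qed
  qed (use s sK in \<open>auto simp: K_def\<close>)
qed

text \<open>
  A substitute for the Riesz representation theorem: the measures are transported to the real
  line, where Helly's theorem applies, and the limit is pushed back.
\<close>

lemma discrete_measures_limit:
  fixes V :: "nat \<Rightarrow> ('a::metric_space) set" and w :: "nat \<Rightarrow> 'a \<Rightarrow> real"
  assumes comp: "compact (UNIV :: 'a set)"
    and fin: "\<And>n. finite (V n)" and w: "\<And>n x. 0 \<le> w n x"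
    and lim: "\<And>\<phi>::'a \<Rightarrow> real. continuous_on UNIV \<phi> \<Longrightarrow> (\<lambda>n. \<Sum>x\<in>V n. w n x * \<phi> x) \<longlonglongrightarrow> \<Lambda> \<phi>"
  shows "\<exists>\<nu>. sets \<nu> = sets borel \<and> finite_measure \<nu> \<and>
    (\<forall>\<phi>. continuous_on UNIV \<phi> \<longrightarrow> (LINT x|\<nu>. \<phi> x) = \<Lambda> \<phi>)"
proof -
  define m where "m n = (\<Sum>x\<in>V n. w n x)" for n
  define m0 where "m0 = \<Lambda> (\<lambda>_. 1)"
  have m: "m \<longlonglongrightarrow> m0" using lim[of "\<lambda>_. 1"] by (simp add: m_def[abs_def] m0_def)
  have m_nonneg: "m n \<ge> 0" for n unfolding m_def by (intro sum_nonneg w)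
  have m0: "m0 \<ge> 0" by (rule LIMSEQ_le_const[OF m]) (use m_nonneg in auto)
  have bdd: "\<exists>B. \<forall>x. \<bar>\<phi> x\<bar> \<le> B" if "continuous_on UNIV \<phi>" for \<phi> :: "'a \<Rightarrow> real"
    using compact_imp_bounded[OF compact_continuous_image[OF that comp]] by (auto simp: bounded_iff)
  show ?thesis
  proof (cases "m0 = 0")
    \<comment> \<open>The total mass tends to 0, so normalization is impossible; the functional then
      vanishes and the null measure represents it.\<close>
    case True
    have "\<Lambda> \<phi> = 0" if c: "continuous_on UNIV \<phi>" for \<phi>
    proof -
      obtain B where B: "\<And>x. \<bar>\<phi> x\<bar> \<le> B" using bdd[OF c] by blast
      have "(\<lambda>n. \<Sum>x\<in>V n. w n x * \<phi> x) \<longlonglongrightarrow> 0"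
      proof (rule Lim_null_comparison)
        have "\<bar>\<Sum>x\<in>V n. w n x * \<phi> x\<bar> \<le> m n * B" for n
          unfolding m_def sum_distrib_right
          by (rule order_trans[OF sum_abs]) (auto intro!: sum_mono mult_left_mono simp: abs_mult B w)
        then show "\<forall>\<^sub>F n in sequentially. norm (\<Sum>x\<in>V n. w n x * \<phi> x) \<le> m n * B" by simp
        show "(\<lambda>n. m n * B) \<longlonglongrightarrow> 0" using tendsto_mult_right[OF m, of B] True by simp
      qed
      then show ?thesis using LIMSEQ_unique[OF lim[OF c]] by blast
    qed
    then show ?thesis
      by (intro exI[of _ "null_measure borel"]) (auto intro!: finite_measureI)
  next
    case False
    with m0 have m0: "m0 > 0" by simp
    obtain n0 where n0: "\<And>n. n \<ge> n0 \<Longrightarrow> m n > 0"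
      using order_tendstoD(1)[OF m m0] by (auto simp: eventually_sequentially)
    obtain s :: "'a \<Rightarrow> real" and \<pi> K where s: "range s \<subseteq> {0..1}" "range s \<subseteq> K" and K: "closed K"
      and \<pi>: "continuous_on K \<pi>" "\<And>x. \<pi> (s x) = x"
      using compact_metric_continuous_image_real[OF comp] by metis
    \<comment> \<open>Shifting the index by \<open>n0\<close> makes every total mass positive, so
      that each \<open>q k\<close> is a genuine probability mass function.\<close>
    define q where "q k x = (if x \<in> V (k + n0) then w (k + n0) x / m (k + n0) else 0)" for k x
    have mk: "m (k + n0) > 0" for k using n0 by simp
    have q: "0 \<le> q k x" for k x using w mk[of k] by (simp add: q_def)
    have q1: "(\<integral>\<^sup>+x. ennreal (q k x) \<partial>count_space UNIV) = 1" for k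
    proof -
      have "(\<integral>\<^sup>+x. ennreal (q k x) \<partial>count_space UNIV) = (\<Sum>x\<in>V (k + n0). ennreal (q k x))"
        by (rule nn_integral_count_space'[OF fin]) (auto simp: q_def)
      also have "\<dots> = ennreal (\<Sum>x\<in>V (k + n0). w (k + n0) x / m (k + n0))"
        using w less_imp_le[OF mk] by (subst sum_ennreal) (auto simp: q_def intro!: sum.cong)
      also have "(\<Sum>x\<in>V (k + n0). w (k + n0) x / m (k + n0)) = 1"
        using mk[of k] by (simp add: sum_divide_distrib[symmetric] m_def)
      finally show ?thesis by simp
    qed
    define p where "p k = embed_pmf (q k)" for k
    have pmf_p: "pmf (p k) x = q k x" for k x unfolding p_def by (rule pmf_embed_pmf[OF q q1])
    \<comment> \<open>Every function is measurable on \<open>measure_pmf\<close>, so the possibly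
      discontinuous \<open>s\<close> is a legitimate map for the push-forward.\<close>
    define D where "D k = distr (measure_pmf (p k)) borel s" for k
    have D_int: "(LINT t|D k. \<psi> t) = (\<Sum>x\<in>V (k + n0). w (k + n0) x * \<psi> (s x)) / m (k + n0)"
      if "\<psi> \<in> borel_measurable borel" for k and \<psi> :: "real \<Rightarrow> real"
    proof -
      have "(LINT t|D k. \<psi> t) = (LINT x|measure_pmf (p k). \<psi> (s x))"
        unfolding D_def by (rule integral_distr[OF _ that]) simp
      also have "\<dots> = (\<Sum>x\<in>V (k + n0). pmf (p k) x *\<^sub>R \<psi> (s x))"
        by (rule integral_measure_pmf[OF fin]) (auto simp: set_pmf_iff pmf_p q_def split: if_splits)
      finally show ?thesis by (simp add: pmf_p q_def sum_divide_distrib)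
    qed
    have rd: "real_distribution (D k)" for k
      unfolding D_def by (rule prob_space.real_distribution_distr[OF prob_space_measure_pmf]) simp
    have "tight D"
      unfolding tight_def
    proof (intro conjI allI impI rd exI)
      show "(-1::real) < 2" by simp
      fix e :: real and k assume "e > 0"
      have "-1 < s x \<and> s x \<le> 2" for x
        using subsetD[OF s(1) rangeI, of x] unfolding atLeastAtMost_iff by linarith
      then have "s -` {-1<..2} = UNIV" by auto
      then have "measure (D k) {-1<..2} = 1"
        unfolding D_def by (subst measure_distr) auto
      then show "measure (D k) {-1<..2} > 1 - e" using \<open>e > 0\<close> by simp
    qed
    from tight_imp_convergent_subsubsequence[OF this strict_mono_id]
    obtain r M where r: "strict_mono (r :: nat \<Rightarrow> nat)" and M: "real_distribution M"
      and wc: "weak_conv_m (D \<circ> id \<circ> r) M" by blast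
    interpret M: real_distribution M by fact
    have conv: "(\<lambda>k. LINT t|D (r k). \<psi> t) \<longlonglongrightarrow> (LINT t|M. \<psi> t)"
      if "continuous_on UNIV \<psi>" "\<And>t. \<bar>\<psi> t\<bar> \<le> B" for \<psi> :: "real \<Rightarrow> real" and B
      using weak_conv_imp_integral_bdd_continuous_conv[of "D \<circ> id \<circ> r" M \<psi> B] rd M wc that
      by (simp add: continuous_on_eq_continuous_at)
    have rk: "filterlim (\<lambda>k. r k + n0) at_top sequentially"
      using filterlim_compose[OF filterlim_add_const_nat_at_top filterlim_subseq[OF r]] .
    \<comment> \<open>The functional \<Lambda> is a limit along the whole sequence, so the
      subsequence selected by tightness suffices to identify the integrals.\<close>
    have int_M: "(LINT t|M. \<psi> t) = \<Lambda> \<phi> / m0"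
      if "continuous_on UNIV \<psi>" "\<And>t. \<bar>\<psi> t\<bar> \<le> B" "\<And>x. \<psi> (s x) = \<phi> x" "continuous_on UNIV \<phi>"
      for \<psi> B \<phi>
    proof (rule LIMSEQ_unique[OF conv[OF that(1,2)]])
      have "(\<lambda>n. (\<Sum>x\<in>V n. w n x * \<phi> x) / m n) \<longlonglongrightarrow> \<Lambda> \<phi> / m0"
        by (intro tendsto_intros lim that m) (use m0 in simp)
      from filterlim_compose[OF this rk]
      show "(\<lambda>k. LINT t|D (r k). \<psi> t) \<longlonglongrightarrow> \<Lambda> \<phi> / m0"
        by (simp add: D_int[OF borel_measurable_continuous_onI[OF that(1)]] that(3))
    qed
    have "K \<noteq> {}" using s(2) by auto
    \<comment> \<open>The truncated distance to \<open>K\<close> is bounded, continuous and 0 on the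
      range of \<open>s\<close>. Its limit integral is therefore 0, which puts all mass of
      \<open>M\<close> on \<open>K\<close>.\<close>
    have AE_K: "AE t in M. t \<in> K"
    proof -
      have \<Lambda>0: "\<Lambda> (\<lambda>_. 0) = 0" using LIMSEQ_unique[OF lim[of "\<lambda>_. 0"]] by simp
      have inf0: "min 1 (infdist (s x) K) = 0" for x using s(2) by (simp add: image_subset_iff)
      have c: "continuous_on UNIV (\<lambda>t. min 1 (infdist t K))" by (intro continuous_intros)
      have "(LINT t|M. min 1 (infdist t K)) = 0"
      proof -
        have "\<bar>min 1 (infdist t K)\<bar> \<le> 1" for t using infdist_nonneg[of t K] by simp
        from int_M[OF c this inf0] show ?thesis by (simp add: \<Lambda>0)
      qed
      moreover have "integrable M (\<lambda>t. min 1 (infdist t K))"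
        using infdist_nonneg[of _ K] borel_measurable_continuous_onI[OF c]
        by (intro M.integrable_const_bound[of _ 1]) auto
      ultimately have "AE t in M. min 1 (infdist t K) = 0"
        using infdist_nonneg[of _ K] by (subst (asm) integral_nonneg_eq_0_iff_AE) auto
      then show ?thesis
        by eventually_elim
          (use in_closed_iff_infdist_zero[OF K \<open>K \<noteq> {}\<close>] in \<open>auto simp: min_def split: if_splits\<close>)
    qed
    \<comment> \<open>The value off \<open>K\<close> is irrelevant because that set has measure 0; a
      constant keeps the map measurable.\<close>
    define \<pi>' where "\<pi>' t = (if t \<in> K then \<pi> t else \<pi> 0)" for t
    have \<pi>': "\<pi>' \<in> borel_measurable borel"
      unfolding \<pi>'_def using K \<pi>(1) by (intro borel_measurable_continuous_on_if) auto
    then have \<pi>'M: "\<pi>' \<in> measurable M borel" by simp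
    define \<nu>1 where "\<nu>1 = distr M borel \<pi>'"
    interpret \<nu>1: prob_space \<nu>1 unfolding \<nu>1_def by (rule M.prob_space_distr[OF \<pi>'M])
    define \<nu> where "\<nu> = density \<nu>1 (\<lambda>_. ennreal m0)"
    have "(LINT x|\<nu>. \<phi> x) = \<Lambda> \<phi>" if c: "continuous_on UNIV \<phi>" for \<phi>
    proof -
      obtain B where B: "\<And>x. \<bar>\<phi> x\<bar> \<le> B" using bdd[OF c] by blast
      have "0 \<le> B" using B[of undefined] by linarith
      \<comment> \<open>Weak convergence on the line needs a bounded continuous integrand defined
        everywhere, so \<phi> composed with \<pi> is extended from \<open>K\<close> by Tietze's
        theorem with the same bound.\<close>
      have "continuous_on K (\<lambda>t. \<phi> (\<pi> t))"
        using continuous_on_compose2[OF c \<pi>(1)] by simp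
      from Tietze[OF this, of UNIV B] K \<open>0 \<le> B\<close> B
      obtain \<psi> where \<psi>: "continuous_on UNIV \<psi>" "\<And>t. t \<in> K \<Longrightarrow> \<psi> t = \<phi> (\<pi> t)" "\<And>t. \<bar>\<psi> t\<bar> \<le> B"
        by auto
      have \<phi>m: "\<phi> \<in> borel_measurable borel" by (rule borel_measurable_continuous_onI[OF c])
      have "(LINT x|\<nu>. \<phi> x) = m0 * (LINT x|\<nu>1. \<phi> x)"
        unfolding \<nu>_def using m0 \<phi>m by (subst integral_density) (auto simp: \<nu>1_def)
      also have "(LINT x|\<nu>1. \<phi> x) = (LINT t|M. \<phi> (\<pi>' t))"
        unfolding \<nu>1_def by (rule integral_distr[OF \<pi>'M \<phi>m])
      also have "\<dots> = (LINT t|M. \<psi> t)"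
      proof (rule integral_cong_AE)
        show "(\<lambda>t. \<phi> (\<pi>' t)) \<in> borel_measurable M" using measurable_compose[OF \<pi>'M \<phi>m] .
        show "\<psi> \<in> borel_measurable M" using borel_measurable_continuous_onI[OF \<psi>(1)] by simp
        show "AE t in M. \<phi> (\<pi>' t) = \<psi> t" using AE_K by eventually_elim (simp add: \<pi>'_def \<psi>(2))
      qed
      also have "\<dots> = \<Lambda> \<phi> / m0"
        using s(2) by (intro int_M[OF \<psi>(1,3) _ c]) (auto simp: \<psi>(2) \<pi>(2) image_subset_iff)
      finally show ?thesis using m0 by simp
    qed
    moreover have "finite_measure \<nu>"
      unfolding \<nu>_def
      by (rule finite_measureI) (auto simp: emeasure_density \<nu>1.emeasure_space_1 nn_integral_cmult)
    ultimately show ?thesis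
      by (intro exI[of _ \<nu>]) (auto simp: \<nu>_def \<nu>1_def)
  qed
qed

section \<open>Energy measures as limits of discrete energies\<close>

locale approximated_resistance_form = resistance_metric E F
  for E :: "('a::metric_space) form" and F +
  fixes V :: "nat \<Rightarrow> 'a set"
  assumes compact_space: "compact (UNIV :: 'a set)"
    and mono_V: "mono V" and finite_V: "finite (V n)" and nonempty_V: "V n \<noteq> {}"
    and dense_V: "closure (\<Union>n. V n) = UNIV"
begin

abbreviation H :: "nat \<Rightarrow> ('a \<Rightarrow> real) \<Rightarrow> 'a \<Rightarrow> real" where "H n \<equiv> harmonic_extension E F (V n)"
abbreviation tr :: "nat \<Rightarrow> 'a form" where "tr n \<equiv> trace_form E F (V n)"

lemmas H_mem = harmonic_extension_props(1)[OF finite_V nonempty_V]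
  and H_eq = harmonic_extension_props(2)[OF finite_V nonempty_V]
  and H_orthogonal = harmonic_extension_orthogonal[OF finite_V nonempty_V]
  and tr_eq_energy = trace_eq_energy[OF finite_V nonempty_V]

lemma V_mono: "m \<le> n \<Longrightarrow> x \<in> V m \<Longrightarrow> x \<in> V n"
  using mono_V by (auto simp: mono_def)

lemma bounded_continuous:
  fixes \<phi> :: "'a \<Rightarrow> real"
  assumes "continuous_on UNIV \<phi>"
  shows "\<exists>B>0. \<forall>x. \<bar>\<phi> x\<bar> \<le> B"
proof -
  have "bounded (range \<phi>)"
    using compact_imp_bounded[OF compact_continuous_image[OF assms compact_space]] .
  then show ?thesis by (auto simp: bounded_pos)
qed

lemma eq_on_dense:
  fixes f g :: "'a \<Rightarrow> real"
  assumes "continuous_on UNIV f" "continuous_on UNIV g" "\<And>n x. x \<in> V n \<Longrightarrow> f x = g x"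
  shows "f = g"
proof -
  have "closed {x. f x - g x = 0}"
    by (rule closed_Collect_eq) (intro continuous_intros assms)+
  moreover have "(\<Union>n. V n) \<subseteq> {x. f x - g x = 0}" using assms(3) by auto
  ultimately have "closure (\<Union>n. V n) \<subseteq> {x. f x - g x = 0}" by (rule closure_minimal[rotated])
  then show ?thesis using dense_V by (auto simp: fun_eq_iff)
qed

text \<open>Pythagoras: the difference vanishes on \<open>V m\<close> and is therefore orthogonal to
  \<open>H m f\<close>.\<close>

lemma energy_H_diff:
  assumes "m \<le> n"
  shows "E (\<lambda>x. H n f x - H m f x) (\<lambda>x. H n f x - H m f x) = tr n f f - tr m f f"
proof -
  have "E (H m f) (\<lambda>x. H n f x - H m f x) = 0"
    by (rule H_orthogonal) (auto simp: H_mem H_eq V_mono[OF assms] intro!: diff_mem)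
  then have "E (H m f) (H n f) = E (H m f) (H m f)" by (simp add: E_diff_right H_mem)
  then show ?thesis
    using E_diff_self[OF H_mem H_mem, of n f m f] by (simp add: trace_form_def RF1_sym H_mem)
qed

lemma tr_mono: "m \<le> n \<Longrightarrow> tr m f f \<le> tr n f f"
  using energy_H_diff[of m n f] RF1_nonneg[OF diff_mem[OF H_mem H_mem], of n f m f] by simp

text \<open>Besides giving convergence of the extensions, this is a criterion for membership in
  \<open>F\<close>. Bounded increasing traces converge, so by Pythagoras the extensions are Cauchy;
  their limit, normalized at a point \<open>p\<close>, agrees with \<open>f\<close> on a dense
  set.\<close>

lemma energy_limit:
  assumes f: "continuous_on UNIV f" and bound: "\<And>n. tr n f f \<le> B"
  shows "f \<in> F" and "(\<lambda>n. E (\<lambda>x. H n f x - f x) (\<lambda>x. H n f x - f x)) \<longlonglongrightarrow> 0"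
proof -
  obtain l where "(\<lambda>n. tr n f f) \<longlonglongrightarrow> l"
    by (rule incseq_convergent[of "\<lambda>n. tr n f f" B]) (auto simp: incseq_def tr_mono bound)
  then have "Cauchy (\<lambda>n. tr n f f)" by (rule LIMSEQ_imp_Cauchy)
  then have ca: "\<exists>M. \<forall>m\<ge>M. \<forall>n\<ge>M. E (\<lambda>x. H m f x - H n f x) (\<lambda>x. H m f x - H n f x) < e" if "e > 0" for e
  proof -
    obtain M where M: "\<And>m n. m \<ge> M \<Longrightarrow> n \<ge> M \<Longrightarrow> \<bar>tr m f f - tr n f f\<bar> < e"
      using \<open>Cauchy _\<close> \<open>e > 0\<close> unfolding Cauchy_def dist_real_def by blast
    have "E (\<lambda>x. H m f x - H n f x) (\<lambda>x. H m f x - H n f x) < e" if "m \<ge> M" "n \<ge> M" for m n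
    proof (cases "n \<le> m")
      case True
      then show ?thesis using M[OF that] by (simp add: energy_H_diff)
    next
      case False
      have "E (\<lambda>x. H m f x - H n f x) (\<lambda>x. H m f x - H n f x)
          = E (\<lambda>x. H n f x - H m f x) (\<lambda>x. H n f x - H m f x)"
        by (simp add: E_diff_self H_mem RF1_sym[OF H_mem H_mem, of m f n f])
      then show ?thesis using False M[OF that] by (simp add: energy_H_diff)
    qed
    then show ?thesis by blast
  qed
  obtain g where g: "g \<in> F" "(\<lambda>n. E (\<lambda>x. H n f x - g x) (\<lambda>x. H n f x - g x)) \<longlonglongrightarrow> 0"
    using RF2[OF H_mem ca] by blast
  obtain p where p: "p \<in> V 0" using nonempty_V by blast
  define k where "k = (\<lambda>x. g x + (f p - g p))"
  have k: "k \<in> F" unfolding k_def by (intro add_mem const_mem g)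
  have "E (\<lambda>x. H n f x - k x) (\<lambda>x. H n f x - k x) = E (\<lambda>x. H n f x - g x) (\<lambda>x. H n f x - g x)" for n
    unfolding k_def by (rule E_diff_shift[OF H_mem g(1)])
  with g(2) have lim: "(\<lambda>n. E (\<lambda>x. H n f x - k x) (\<lambda>x. H n f x - k x)) \<longlonglongrightarrow> 0" by simp
  have "k = f"
  proof (rule eq_on_dense[OF continuous_mem[OF k] f])
    fix m x assume x: "x \<in> V m"
    have "\<forall>\<^sub>F n in sequentially. H n f x = f x"
      unfolding eventually_sequentially by (intro exI[of _ m] allI impI H_eq V_mono[OF _ x])
    then have "(\<lambda>n. H n f x) \<longlonglongrightarrow> f x" by (rule tendsto_eventually)
    moreover have "(\<lambda>n. H n f x) \<longlonglongrightarrow> k x"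
      by (rule pointwise_convergence[OF H_mem k lim, of p])
        (simp add: H_eq V_mono[OF _ p] k_def)
    ultimately show "k x = f x" by (rule LIMSEQ_unique[rotated])
  qed
  then show "f \<in> F" "(\<lambda>n. E (\<lambda>x. H n f x - f x) (\<lambda>x. H n f x - f x)) \<longlonglongrightarrow> 0"
    using k lim by auto
qed

lemma tr_le_energy: "f \<in> F \<Longrightarrow> tr n f f \<le> E f f"
  by (rule trace_le[OF finite_V nonempty_V]) auto

lemma H_tendsto:
  assumes "f \<in> F"
  shows "(\<lambda>n. E (\<lambda>x. H n f x - f x) (\<lambda>x. H n f x - f x)) \<longlonglongrightarrow> 0"
  by (rule energy_limit(2)[OF continuous_mem[OF assms] tr_le_energy[OF assms]])

lemma tr_tendsto:
  assumes "f \<in> F" "g \<in> F"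
  shows "(\<lambda>n. tr n f g) \<longlonglongrightarrow> E f g"
proof (rule LIM_zero_cancel, rule Lim_null_comparison)
  show "\<forall>\<^sub>F n in sequentially. norm (tr n f g - E f g)
      \<le> sqrt (E (\<lambda>x. H n f x - f x) (\<lambda>x. H n f x - f x)) * sqrt (E g g)"
    using Cauchy_Schwarz[OF diff_mem[OF H_mem assms(1)] assms(2)]
    by (simp add: tr_eq_energy[OF assms(2)] E_diff_left H_mem assms)
  show "(\<lambda>n. sqrt (E (\<lambda>x. H n f x - f x) (\<lambda>x. H n f x - f x)) * sqrt (E g g)) \<longlonglongrightarrow> 0"
    using tendsto_mult_right[OF tendsto_real_sqrt[OF H_tendsto[OF assms(1)]]] by simp
qed

section \<open>Sums over pairs of points weighted by conductances\<close>

definition wsum :: "nat \<Rightarrow> ('a \<Rightarrow> 'a \<Rightarrow> real) \<Rightarrow> real" where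
  "wsum n k = (\<Sum>x\<in>V n. \<Sum>y\<in>V n. conductance E F (V n) x y * k x y)"

lemmas conductance_sym = conductance_props(1)[OF finite_V nonempty_V]
  and conductance_nonneg = conductance_props(2)[OF finite_V nonempty_V]

lemma tr_eq_wsum: "tr n f g = 1/2 * wsum n (\<lambda>x y. (f x - f y) * (g x - g y))"
  unfolding wsum_def by (rule trace_eq_conductance[OF finite_V nonempty_V])

lemma wsum_add: "wsum n (\<lambda>x y. k x y + l x y) = wsum n k + wsum n l"
  by (simp add: wsum_def sum.distrib algebra_simps)

lemma wsum_scale: "wsum n (\<lambda>x y. c * k x y) = c * wsum n k"
  by (simp add: wsum_def sum_distrib_left algebra_simps)

lemma wsum_diff: "wsum n (\<lambda>x y. k x y - l x y) = wsum n k - wsum n l"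
  by (simp add: wsum_def sum_subtractf algebra_simps)

lemma wsum_sum: "wsum n (\<lambda>x y. \<Sum>i\<in>I. k i x y) = (\<Sum>i\<in>I. wsum n (k i))"
proof (induction I rule: infinite_finite_induct)
  case (insert i I)
  then show ?case using wsum_add[of n "k i"] by simp
qed (simp_all add: wsum_def)

lemma wsum_mono: "(\<And>x y. x \<in> V n \<Longrightarrow> y \<in> V n \<Longrightarrow> k x y \<le> l x y) \<Longrightarrow> wsum n k \<le> wsum n l"
  unfolding wsum_def by (intro sum_mono mult_left_mono conductance_nonneg)

lemma wsum_swap: "wsum n (\<lambda>x y. k y x) = wsum n k"
  unfolding wsum_def by (subst sum.swap) (simp add: conductance_sym)

lemma wsum_nonneg: "(\<And>x y. x \<in> V n \<Longrightarrow> y \<in> V n \<Longrightarrow> 0 \<le> k x y) \<Longrightarrow> 0 \<le> wsum n k"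
  unfolding wsum_def by (intro sum_nonneg mult_nonneg_nonneg conductance_nonneg)

lemma wsum_abs_le: "\<bar>wsum n k\<bar> \<le> wsum n (\<lambda>x y. \<bar>k x y\<bar>)"
proof -
  have "wsum n k \<le> wsum n (\<lambda>x y. \<bar>k x y\<bar>)" "wsum n (\<lambda>x y. (-1) * k x y) \<le> wsum n (\<lambda>x y. \<bar>k x y\<bar>)"
    by (rule wsum_mono; simp)+
  then show ?thesis unfolding wsum_scale by linarith
qed

lemma wsum_Cauchy_Schwarz:
  "\<bar>wsum n (\<lambda>x y. k x y * l x y)\<bar> \<le> sqrt (wsum n (\<lambda>x y. (k x y)\<^sup>2)) * sqrt (wsum n (\<lambda>x y. (l x y)\<^sup>2))"
proof -
  have "(wsum n (\<lambda>x y. k x y * l x y))\<^sup>2 \<le> wsum n (\<lambda>x y. (k x y)\<^sup>2) * wsum n (\<lambda>x y. (l x y)\<^sup>2)"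
  proof (rule quadratic_nonneg_discriminant)
    fix t
    have "0 \<le> wsum n (\<lambda>x y. (k x y + t * l x y)\<^sup>2)" by (rule wsum_nonneg) simp
    also have "(\<lambda>x y. (k x y + t * l x y)\<^sup>2)
        = (\<lambda>x y. (k x y)\<^sup>2 + (2 * t) * (k x y * l x y) + t\<^sup>2 * (l x y)\<^sup>2)"
      by (simp add: power2_eq_square algebra_simps)
    finally show "0 \<le> wsum n (\<lambda>x y. (k x y)\<^sup>2) + 2 * t * wsum n (\<lambda>x y. k x y * l x y)
        + t\<^sup>2 * wsum n (\<lambda>x y. (l x y)\<^sup>2)"
      unfolding wsum_add wsum_scale .
  qed (rule wsum_nonneg, simp)
  from real_sqrt_le_mono[OF this] show ?thesis by (simp add: real_sqrt_mult)
qed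

text \<open>By the criterion of bounded traces only an estimate on the finite sets is needed, and
  there the Leibniz rule for differences together with (p + q)^2 \<le> 2 p^2 + 2 q^2
  suffices.\<close>

lemma mult_mem:
  assumes "f \<in> F" "g \<in> F"
  shows "(\<lambda>x. f x * g x) \<in> F"
proof -
  obtain Bf where Bf: "\<And>x. \<bar>f x\<bar> \<le> Bf" using bounded_continuous[OF continuous_mem[OF assms(1)]] by blast
  obtain Bg where Bg: "\<And>x. \<bar>g x\<bar> \<le> Bg" using bounded_continuous[OF continuous_mem[OF assms(2)]] by blast
  show ?thesis
  proof (rule energy_limit(1)[where B = "2 * Bf\<^sup>2 * E g g + 2 * Bg\<^sup>2 * E f f"])
    show "continuous_on UNIV (\<lambda>x. f x * g x)"
      using assms by (intro continuous_intros continuous_mem)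
    fix n
    have "wsum n (\<lambda>x y. (f x * g x - f y * g y) * (f x * g x - f y * g y))
       \<le> wsum n (\<lambda>x y. (2 * Bf\<^sup>2) * ((g x - g y) * (g x - g y)) + (2 * Bg\<^sup>2) * ((f x - f y) * (f x - f y)))"
    proof (rule wsum_mono)
      fix x y
      have "(f x * g x - f y * g y)\<^sup>2 = (f x * (g x - g y) + g y * (f x - f y))\<^sup>2"
        by (simp add: algebra_simps)
      also have "\<dots> \<le> 2 * (f x * (g x - g y))\<^sup>2 + 2 * (g y * (f x - f y))\<^sup>2"
        using sum_squares_bound[of "f x * (g x - g y)" "g y * (f x - f y)"] by (simp add: power2_sum)
      also have "\<dots> \<le> 2 * (Bf\<^sup>2 * (g x - g y)\<^sup>2) + 2 * (Bg\<^sup>2 * (f x - f y)\<^sup>2)"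
        unfolding power_mult_distrib
        using power_mono[OF Bf[of x], of 2] power_mono[OF Bg[of y], of 2]
        by (intro add_mono mult_left_mono mult_right_mono) auto
      finally show "(f x * g x - f y * g y) * (f x * g x - f y * g y)
          \<le> (2 * Bf\<^sup>2) * ((g x - g y) * (g x - g y)) + (2 * Bg\<^sup>2) * ((f x - f y) * (f x - f y))"
        by (simp add: power2_eq_square)
    qed
    then have "tr n (\<lambda>x. f x * g x) (\<lambda>x. f x * g x) \<le> 2 * Bf\<^sup>2 * tr n g g + 2 * Bg\<^sup>2 * tr n f f"
      by (simp add: tr_eq_wsum wsum_add wsum_scale)
    also have "\<dots> \<le> 2 * Bf\<^sup>2 * E g g + 2 * Bg\<^sup>2 * E f f"
      by (intro add_mono mult_left_mono tr_le_energy assms) auto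
    finally show "tr n (\<lambda>x. f x * g x) (\<lambda>x. f x * g x) \<le> 2 * Bf\<^sup>2 * E g g + 2 * Bg\<^sup>2 * E f f" .
  qed
qed

lemma square_mem: "f \<in> F \<Longrightarrow> (\<lambda>x. (f x)\<^sup>2) \<in> F"
  using mult_mem[of f f] by (simp add: power2_eq_square)

text \<open>Stone-Weierstrass: \<open>F\<close> is an algebra of continuous functions with
  constants, and \<open>RF3\<close> on two-point sets shows that it separates points.\<close>

lemma uniformly_dense:
  assumes "continuous_on UNIV \<phi>" "0 < e"
  shows "\<exists>g\<in>F. \<forall>x. \<bar>\<phi> x - g x\<bar> < e"
proof -
  interpret R: function_ring_on F UNIV
  proof
    fix x y :: 'a assume "x \<noteq> y"
    obtain f where "f \<in> F" "\<forall>z\<in>{x, y}. f z = indicator {x} z"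
      using RF3[of "{x, y}" "indicator {x}"] by auto
    with \<open>x \<noteq> y\<close> have "f \<in> F" "f x \<noteq> f y" by auto
    then show "\<exists>f\<in>F. f x \<noteq> f y" by blast
  qed (auto simp: compact_space continuous_mem add_mem mult_mem const_mem)
  from R.Stone_Weierstrass_basic[OF assms] show ?thesis by simp
qed

text \<open>The discrete counterpart of \<open>mutual_energy_integral\<close>: \<phi> is integrated
  against the signed measure whose mass at \<open>x\<close> is the sum over \<open>y\<close> of c x
  y * (f x - f y) * (h x - h y), with total mass \<open>2 * tr n f h\<close>. Evaluating \<phi> at
  the first point only agrees with the drift term \<open>Q_form_fin\<close>.\<close>

definition carre :: "nat \<Rightarrow> ('a \<Rightarrow> real) \<Rightarrow> ('a \<Rightarrow> real) \<Rightarrow> ('a \<Rightarrow> real) \<Rightarrow> real" where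
  "carre n f h \<phi> = wsum n (\<lambda>x y. \<phi> x * ((f x - f y) * (h x - h y)))"

text \<open>The identity that defines the energy measure, with the trace in place of
  \<open>E\<close>. It is pure algebra after symmetrizing the sum in \<open>x\<close> and
  \<open>y\<close>, and it reduces the limit for \<phi> in \<open>F\<close> to convergence of
  traces.\<close>

lemma carre_self_eq: "carre n f f \<phi> = 2 * tr n (\<lambda>x. f x * \<phi> x) f - tr n \<phi> (\<lambda>x. (f x)\<^sup>2)"
proof -
  have "2 * tr n (\<lambda>x. f x * \<phi> x) f - tr n \<phi> (\<lambda>x. (f x)\<^sup>2)
      = wsum n (\<lambda>x y. (f x * \<phi> x - f y * \<phi> y) * (f x - f y) - 1/2 * ((\<phi> x - \<phi> y) * ((f x)\<^sup>2 - (f y)\<^sup>2)))"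
    unfolding tr_eq_wsum wsum_diff wsum_scale by simp
  also have "(\<lambda>x y. (f x * \<phi> x - f y * \<phi> y) * (f x - f y) - 1/2 * ((\<phi> x - \<phi> y) * ((f x)\<^sup>2 - (f y)\<^sup>2)))
      = (\<lambda>x y. 1/2 * (\<phi> x * ((f x - f y) * (f x - f y))) + 1/2 * (\<phi> y * ((f y - f x) * (f y - f x))))"
    by (intro ext) (simp add: power2_eq_square algebra_simps add_divide_distrib diff_divide_distrib)
  also have "wsum n \<dots> = 1/2 * carre n f f \<phi>
      + 1/2 * wsum n (\<lambda>x y. \<phi> y * ((f y - f x) * (f y - f x)))"
    unfolding carre_def wsum_add wsum_scale ..
  also have "wsum n (\<lambda>x y. \<phi> y * ((f y - f x) * (f y - f x))) = carre n f f \<phi>"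
    unfolding carre_def by (rule wsum_swap)
  finally show ?thesis by simp
qed

lemma carre_polarization:
  "carre n f h \<phi> = 1/2 * (carre n (\<lambda>x. f x + h x) (\<lambda>x. f x + h x) \<phi> - carre n f f \<phi> - carre n h h \<phi>)"
proof -
  have "carre n (\<lambda>x. f x + h x) (\<lambda>x. f x + h x) \<phi>
     = wsum n (\<lambda>x y. \<phi> x * ((f x - f y) * (f x - f y)) + \<phi> x * ((h x - h y) * (h x - h y))
          + 2 * (\<phi> x * ((f x - f y) * (h x - h y))))"
    unfolding carre_def by (rule arg_cong[of _ _ "wsum n"]) (simp add: fun_eq_iff algebra_simps)
  then show ?thesis by (simp add: carre_def wsum_add wsum_scale)
qed

lemma carre_diff: "carre n f h (\<lambda>x. \<phi> x - \<psi> x) = carre n f h \<phi> - carre n f h \<psi>"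
  by (simp add: carre_def wsum_diff left_diff_distrib)

lemma carre_bound:
  assumes "\<And>x. x \<in> V n \<Longrightarrow> \<bar>\<phi> x\<bar> \<le> B"
  shows "\<bar>carre n f h \<phi>\<bar> \<le> 2 * B * (sqrt (tr n f f) * sqrt (tr n h h))"
proof -
  obtain p where "p \<in> V n" using nonempty_V by blast
  then have B: "0 \<le> B" using assms[of p] by linarith
  have "\<bar>carre n f h \<phi>\<bar> \<le> wsum n (\<lambda>x y. \<bar>\<phi> x * ((f x - f y) * (h x - h y))\<bar>)"
    unfolding carre_def by (rule wsum_abs_le)
  also have "\<dots> \<le> wsum n (\<lambda>x y. B * (\<bar>f x - f y\<bar> * \<bar>h x - h y\<bar>))"
    by (rule wsum_mono) (auto simp: abs_mult intro!: mult_right_mono assms)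
  also have "\<dots> = B * wsum n (\<lambda>x y. \<bar>f x - f y\<bar> * \<bar>h x - h y\<bar>)" by (rule wsum_scale)
  also have "\<dots> \<le> B * (sqrt (2 * tr n f f) * sqrt (2 * tr n h h))"
    using wsum_Cauchy_Schwarz[of n "\<lambda>x y. \<bar>f x - f y\<bar>" "\<lambda>x y. \<bar>h x - h y\<bar>"] B
    by (intro mult_left_mono) (auto simp: tr_eq_wsum power2_eq_square)
  also have "\<dots> = 2 * B * (sqrt (tr n f f) * sqrt (tr n h h))"
    by (simp add: real_sqrt_mult)
  finally show ?thesis .
qed

lemma carre_energy_bound:
  assumes "f \<in> F" "h \<in> F" "\<And>x. x \<in> V n \<Longrightarrow> \<bar>\<phi> x\<bar> \<le> B"
  shows "\<bar>carre n f h \<phi>\<bar> \<le> 2 * B * (sqrt (E f f) * sqrt (E h h))"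
proof -
  obtain p where "p \<in> V n" using nonempty_V by blast
  then have B: "0 \<le> B" using assms(3)[of p] by linarith
  have "\<bar>carre n f h \<phi>\<bar> \<le> 2 * B * (sqrt (tr n f f) * sqrt (tr n h h))"
    by (rule carre_bound[OF assms(3)])
  also have "2 * B * (sqrt (tr n f f) * sqrt (tr n h h)) \<le> 2 * B * (sqrt (E f f) * sqrt (E h h))"
    using B trace_nonneg[OF finite_V nonempty_V]
    by (intro mult_left_mono mult_mono) (auto simp: tr_le_energy assms RF1_nonneg)
  finally show ?thesis by simp
qed

lemma carre_self_tendsto:
  assumes "f \<in> F" "g \<in> F"
  shows "(\<lambda>n. carre n f f g) \<longlonglongrightarrow> 2 * E (\<lambda>x. f x * g x) f - E g (\<lambda>x. (f x)\<^sup>2)"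
  unfolding carre_self_eq by (intro tendsto_intros tr_tendsto mult_mem square_mem assms)

text \<open>For integrands in \<open>F\<close> the limit is known; the bound of \<open>carre\<close>
  by the uniform norm, with a constant independent of \<open>n\<close>, extends convergence to their
  uniform closure.\<close>

lemma carre_self_convergent:
  assumes "f \<in> F" "continuous_on UNIV \<phi>"
  shows "convergent (\<lambda>n. carre n f f \<phi>)"
proof (rule Cauchy_convergent, rule metric_CauchyI)
  fix e :: real assume e: "e > 0"
  \<comment> \<open>The replacement error is then at most e * E f f / (4 * (E f f + 1)), below e/3
    even when \<open>E f f\<close> is 0.\<close>
  define d where "d = e / (8 * (E f f + 1))"
  have Ef: "0 \<le> E f f" by (rule RF1_nonneg[OF assms(1)])
  then have d: "d > 0" using e by (simp add: d_def)
  obtain g where g: "g \<in> F" "\<And>x. \<bar>\<phi> x - g x\<bar> < d" using uniformly_dense[OF assms(2) d] by blast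
  have close: "\<bar>carre n f f \<phi> - carre n f f g\<bar> < e / 3" for n
  proof -
    have "\<bar>carre n f f (\<lambda>x. \<phi> x - g x)\<bar> \<le> 2 * d * (sqrt (E f f) * sqrt (E f f))"
      by (rule carre_energy_bound[OF assms(1,1)]) (use g(2) less_imp_le in blast)
    also have "\<dots> = e * (E f f / (4 * (E f f + 1)))" using Ef by (simp add: d_def field_simps)
    also have "\<dots> < e * (1/3)" using Ef e by (intro mult_strict_left_mono) (auto simp: field_simps)
    finally show ?thesis by (simp add: carre_diff)
  qed
  from LIMSEQ_imp_Cauchy[OF carre_self_tendsto[OF assms(1) g(1)]] e
  obtain M where M: "\<And>m n. m \<ge> M \<Longrightarrow> n \<ge> M \<Longrightarrow> \<bar>carre m f f g - carre n f f g\<bar> < e / 3"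
    unfolding Cauchy_def dist_real_def by (meson divide_pos_pos zero_less_numeral)
  have "dist (carre m f f \<phi>) (carre n f f \<phi>) < e" if "m \<ge> M" "n \<ge> M" for m n
    using M[OF that] close[of m] close[of n] unfolding dist_real_def by linarith
  then show "\<exists>M. \<forall>m\<ge>M. \<forall>n\<ge>M. dist (carre m f f \<phi>) (carre n f f \<phi>) < e" by blast
qed

text \<open>The uniqueness half of the definition of energy measures: finite measures integrate
  uniform limits correctly, so testing on the dense set \<open>F\<close> is enough.\<close>

lemma finite_measure_eqI_domain:
  assumes sets: "sets M = sets borel" "sets N = sets borel"
    and fin: "finite_measure M" "finite_measure N"
    and eq: "\<And>g. g \<in> F \<Longrightarrow> (LINT x|M. g x) = (LINT x|N. g x)"
  shows "M = N"
proof (rule finite_measure_eqI_continuous[OF sets fin])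
  fix \<phi> :: "'a \<Rightarrow> real" assume c: "continuous_on UNIV \<phi>"
  have int: "integrable L \<psi>" if L: "sets L = sets borel" "finite_measure L" "continuous_on UNIV \<psi>"
    for L and \<psi> :: "'a \<Rightarrow> real"
  proof -
    interpret finite_measure L by fact
    obtain B where "\<And>x. \<bar>\<psi> x\<bar> \<le> B" using bounded_continuous[OF L(3)] by blast
    then show ?thesis
      using borel_measurable_continuous_onI[OF L(3)] L(1)
      by (intro integrable_const_bound[of _ B]) (auto cong: measurable_cong_sets)
  qed
  have close: "\<bar>(LINT x|L. \<phi> x) - (LINT x|L. g x)\<bar> \<le> d * measure L (space L)"
    if "sets L = sets borel" "finite_measure L" "g \<in> F" "\<And>x. \<bar>\<phi> x - g x\<bar> < d" for L g d
  proof -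
    interpret finite_measure L by fact
    note i = int[OF that(1,2) c] int[OF that(1,2) continuous_mem[OF that(3)]]
    have "\<bar>(LINT x|L. \<phi> x) - (LINT x|L. g x)\<bar> = \<bar>LINT x|L. \<phi> x - g x\<bar>" using i by simp
    also have "\<dots> \<le> (LINT x|L. \<bar>\<phi> x - g x\<bar>)" by (rule integral_abs_bound)
    also have "\<dots> \<le> (LINT x|L. d)"
      using i that(4) by (intro integral_mono) (auto intro: less_imp_le)
    finally show ?thesis by (simp add: mult.commute)
  qed
  have "\<bar>(LINT x|M. \<phi> x) - (LINT x|N. \<phi> x)\<bar> \<le> e" if "e > 0" for e
  proof -
    define t where "t = measure M (space M) + measure N (space N)"
    have t: "t \<ge> 0" by (simp add: t_def)
    define d where "d = e / (t + 1)"
    have "d > 0" using that t by (simp add: d_def)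
    then obtain g where g: "g \<in> F" "\<And>x. \<bar>\<phi> x - g x\<bar> < d" using uniformly_dense[OF c] by blast
    have "\<bar>(LINT x|M. \<phi> x) - (LINT x|N. \<phi> x)\<bar> \<le> d * t"
      using close[OF sets(1) fin(1) g] close[OF sets(2) fin(2) g] eq[OF g(1)]
      by (simp add: t_def distrib_left)
    also have "\<dots> \<le> e" using that t by (simp add: d_def field_simps)
    finally show ?thesis .
  qed
  then show "(LINT x|M. \<phi> x) = (LINT x|N. \<phi> x)"
    using field_le_epsilon[of "\<bar>(LINT x|M. \<phi> x) - (LINT x|N. \<phi> x)\<bar>" 0] by simp
qed

text \<open>This gives the \<open>THE\<close> in \<open>energy_measure\<close> its meaning. The
  limits of \<open>carre\<close> form a functional represented by a measure \<nu>; on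
  \<open>F\<close> it satisfies the defining identity, and by uniqueness \<nu> is the energy
  measure.\<close>

lemma energy_measure_limit:
  assumes f: "f \<in> F" and \<phi>: "continuous_on UNIV \<phi>"
  shows "(\<lambda>n. carre n f f \<phi>) \<longlonglongrightarrow> (LINT x|energy_measure E F f. \<phi> x)"
proof -
  define \<Lambda> where "\<Lambda> \<phi> = lim (\<lambda>n. carre n f f \<phi>)" for \<phi>
  have \<Lambda>: "(\<lambda>n. carre n f f \<phi>) \<longlonglongrightarrow> \<Lambda> \<phi>" if "continuous_on UNIV \<phi>" for \<phi>
    unfolding \<Lambda>_def using carre_self_convergent[OF f that] by (simp add: convergent_LIMSEQ_iff)
  define w where "w n x = (\<Sum>y\<in>V n. conductance E F (V n) x y * (f x - f y)\<^sup>2)" for n x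
  have "\<exists>\<nu>. sets \<nu> = sets borel \<and> finite_measure \<nu> \<and>
      (\<forall>\<phi>. continuous_on UNIV \<phi> \<longrightarrow> (LINT x|\<nu>. \<phi> x) = \<Lambda> \<phi>)"
  proof (rule discrete_measures_limit[OF compact_space finite_V])
    show "0 \<le> w n x" for n x
      unfolding w_def by (intro sum_nonneg mult_nonneg_nonneg conductance_nonneg) auto
    fix \<phi> :: "'a \<Rightarrow> real" assume "continuous_on UNIV \<phi>"
    moreover have "(\<Sum>x\<in>V n. w n x * \<phi> x) = carre n f f \<phi>" for n
      unfolding carre_def wsum_def w_def sum_distrib_right
      by (intro sum.cong refl) (simp add: power2_eq_square)
    ultimately show "(\<lambda>n. \<Sum>x\<in>V n. w n x * \<phi> x) \<longlonglongrightarrow> \<Lambda> \<phi>"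
      using \<Lambda> by simp
  qed
  then obtain \<nu> where \<nu>: "sets \<nu> = sets borel" "finite_measure \<nu>"
    "\<And>\<phi>. continuous_on UNIV \<phi> \<Longrightarrow> (LINT x|\<nu>. \<phi> x) = \<Lambda> \<phi>" by blast
  have \<nu>F: "(LINT x|\<nu>. g x) = 2 * E (\<lambda>x. f x * g x) f - E g (\<lambda>x. (f x)\<^sup>2)" if "g \<in> F" for g
    using \<nu>(3)[OF continuous_mem[OF that]]
      LIMSEQ_unique[OF \<Lambda>[OF continuous_mem[OF that]] carre_self_tendsto[OF f that]] by simp
  have "energy_measure E F f = \<nu>"
    unfolding energy_measure_def
  proof (rule the_equality)
    show "sets \<nu> = sets borel \<and> finite_measure \<nu> \<and>
        (\<forall>g\<in>F. (LINT x|\<nu>. g x) = 2 * E (\<lambda>x. f x * g x) f - E g (\<lambda>x. (f x)\<^sup>2))"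
      using \<nu> \<nu>F by blast
    fix \<nu>' :: "'a measure"
    assume "sets \<nu>' = sets borel \<and> finite_measure \<nu>' \<and>
        (\<forall>g\<in>F. (LINT x|\<nu>'. g x) = 2 * E (\<lambda>x. f x * g x) f - E g (\<lambda>x. (f x)\<^sup>2))"
    then show "\<nu>' = \<nu>" using \<nu> \<nu>F by (intro finite_measure_eqI_domain) auto
  qed
  then show ?thesis using \<nu>(3)[OF \<phi>] \<Lambda>[OF \<phi>] by simp
qed

lemma mutual_energy_limit:
  assumes "f \<in> F" "h \<in> F" "continuous_on UNIV \<phi>"
  shows "(\<lambda>n. carre n f h \<phi>) \<longlonglongrightarrow> mutual_energy_integral E F f h \<phi>"
  unfolding mutual_energy_integral_def carre_polarization[of _ f h]
  by (intro tendsto_intros energy_measure_limit add_mem assms)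

end

section \<open>Uniform coercivity and convergence of the resolvents\<close>

lemma L2_mult_integrable:
  assumes "f \<in> L2_space M" "g \<in> L2_space M"
  shows "integrable M (\<lambda>x. f x * g x)"
proof -
  have [measurable]: "f \<in> borel_measurable M" "g \<in> borel_measurable M"
    and i: "integrable M (\<lambda>x. (f x)\<^sup>2)" "integrable M (\<lambda>x. (g x)\<^sup>2)"
    using assms by (auto simp: L2_space_def)
  show ?thesis
  proof (rule Bochner_Integration.integrable_bound[OF Bochner_Integration.integrable_add[OF i]])
    show "AE x in M. norm (f x * g x) \<le> norm ((f x)\<^sup>2 + (g x)\<^sup>2)"
    proof (rule AE_I2)
      fix x
      have "2 * (\<bar>f x\<bar> * \<bar>g x\<bar>) \<le> (f x)\<^sup>2 + (g x)\<^sup>2"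
        using sum_squares_bound[of "\<bar>f x\<bar>" "\<bar>g x\<bar>"] by (simp add: mult.assoc)
      moreover have "0 \<le> \<bar>f x\<bar> * \<bar>g x\<bar>" by simp
      moreover have "norm (f x * g x) = \<bar>f x\<bar> * \<bar>g x\<bar>" "norm ((f x)\<^sup>2 + (g x)\<^sup>2) = (f x)\<^sup>2 + (g x)\<^sup>2"
        by (simp_all add: abs_mult)
      ultimately show "norm (f x * g x) \<le> norm ((f x)\<^sup>2 + (g x)\<^sup>2)" by linarith
    qed
  qed simp
qed

lemma L2_Cauchy_Schwarz:
  assumes "f \<in> L2_space M" "g \<in> L2_space M"
  shows "\<bar>L2_inner M f g\<bar> \<le> L2_norm M f * L2_norm M g"
proof -
  have f2: "integrable M (\<lambda>x. (f x)\<^sup>2)" and g2: "integrable M (\<lambda>x. (g x)\<^sup>2)"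
    using assms by (auto simp: L2_space_def)
  note fg = L2_mult_integrable[OF assms]
  have "(L2_inner M f g)\<^sup>2 \<le> L2_inner M f f * L2_inner M g g"
  proof (rule quadratic_nonneg_discriminant)
    fix t
    have "0 \<le> (LINT x|M. (f x + t * g x)\<^sup>2)" by (rule Bochner_Integration.integral_nonneg) simp
    also have "(\<lambda>x. (f x + t * g x)\<^sup>2) = (\<lambda>x. (f x)\<^sup>2 + 2 * t * (f x * g x) + t\<^sup>2 * (g x)\<^sup>2)"
      by (simp add: fun_eq_iff power2_eq_square algebra_simps)
    also have "(LINT x|M. \<dots> x) = L2_inner M f f + 2 * t * L2_inner M f g + t\<^sup>2 * L2_inner M g g"
      using f2 g2 fg by (simp add: L2_inner_def power2_eq_square)
    finally show "0 \<le> L2_inner M f f + 2 * t * L2_inner M f g + t\<^sup>2 * L2_inner M g g" .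
  qed (simp add: L2_inner_def)
  from real_sqrt_le_mono[OF this] show ?thesis by (simp add: L2_norm_def real_sqrt_mult)
qed

section \<open>Uniform convergence of functionals on sets bounded in energy\<close>

context approximated_resistance_form
begin

text \<open>Density allows a cover by balls centred in the union of the \<open>V n\<close>; the
  centres of a finite subcover all lie in one \<open>V m\<close> by monotonicity.\<close>

lemma net_exists:
  assumes "\<epsilon> > 0"
  shows "\<exists>m. \<forall>x. \<exists>z\<in>V m. dist x z < \<epsilon>"
proof -
  have "(UNIV :: 'a set) \<subseteq> (\<Union>z\<in>(\<Union>n. V n). ball z \<epsilon>)"
  proof
    fix x :: 'a
    have "x \<in> closure (\<Union>n. V n)" using dense_V by simp
    then obtain z where "z \<in> (\<Union>n. V n)" "dist z x < \<epsilon>"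
      using assms unfolding closure_approachable by blast
    then show "x \<in> (\<Union>z\<in>(\<Union>n. V n). ball z \<epsilon>)" by auto
  qed
  from compactE_image[OF compact_space _ this]
  obtain T where T: "T \<subseteq> (\<Union>n. V n)" "finite T" "(UNIV :: 'a set) \<subseteq> (\<Union>z\<in>T. ball z \<epsilon>)" by auto
  have "\<exists>m. T \<subseteq> V m"
    using T(2,1)
  proof (induction T rule: finite_induct)
    case (insert z T)
    then obtain m n where "T \<subseteq> V m" "z \<in> V n" by auto
    then have "insert z T \<subseteq> V (max m n)" using V_mono[of m "max m n"] V_mono[of n "max m n"] by auto
    then show ?case by blast
  qed simp
  then obtain m where m: "T \<subseteq> V m" by blast
  have "\<exists>z\<in>V m. dist x z < \<epsilon>" for x
  proof -
    obtain z where "z \<in> T" "x \<in> ball z \<epsilon>" using T(3) by blast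
    with m show ?thesis by (auto simp: dist_commute)
  qed
  then show ?thesis by blast
qed

lemma H_expansion: "H m v = (\<lambda>x. \<Sum>z\<in>V m. v z * H m (indicator {z}) x)"
proof -
  have "H m v = H m (\<lambda>x. \<Sum>z\<in>V m. v z * indicator {z} x)"
  proof (rule harmonic_extension_cong[OF finite_V nonempty_V])
    fix x assume x: "x \<in> V m"
    have "(\<Sum>z\<in>V m. v z * indicator {z} x) = (\<Sum>z\<in>V m. if z = x then v x else 0)"
      by (intro sum.cong refl) (auto simp: indicator_def)
    then show "v x = (\<Sum>z\<in>V m. v z * indicator {z} x)" using x finite_V by simp
  qed
  then show ?thesis
    by (simp add: harmonic_extension_sum[OF finite_V nonempty_V]
        harmonic_extension_scale[OF finite_V nonempty_V])
qed

text \<open>The remainder vanishes at \<open>z\<close>, and by orthogonality its energy does not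
  exceed that of \<open>v\<close>; the square-root modulus of continuity then gives a rate depending
  only on the distance to \<open>V m\<close>.\<close>

lemma H_approximation:
  assumes "v \<in> F" "z \<in> V m"
  shows "\<bar>v x - H m v x\<bar> \<le> sqrt (dist x z) * sqrt (E v v)"
proof -
  let ?d = "\<lambda>x. v x - H m v x"
  have d: "?d \<in> F" by (rule diff_mem[OF assms(1) H_mem])
  have "E v (H m v) = tr m v v" by (simp add: tr_eq_energy assms(1) RF1_sym H_mem)
  then have "E ?d ?d = E v v - tr m v v"
    using E_diff_self[OF assms(1) H_mem, of m v] by (simp add: trace_form_def)
  then have "E ?d ?d \<le> E v v" using trace_nonneg[OF finite_V nonempty_V, of m v] by simp
  moreover have "\<bar>?d x\<bar> \<le> sqrt (dist x z) * sqrt (E ?d ?d)"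
    using abs_diff_le[OF d, of x z] by (simp add: H_eq assms(2))
  ultimately show ?thesis
    by (meson mult_left_mono order_trans real_sqrt_ge_zero real_sqrt_le_mono zero_le_dist)
qed

text \<open>
  Sets bounded in energy and in the uniform norm are uniformly approximated by the finite-rank
  operators \<open>H m\<close>, so pointwise null functionals are uniformly null on them.
\<close>

lemma uniformly_null_functionals:
  fixes L :: "nat \<Rightarrow> ('a \<Rightarrow> real) \<Rightarrow> real"
  assumes add: "\<And>n \<phi> \<psi>. continuous_on UNIV \<phi> \<Longrightarrow> continuous_on UNIV \<psi> \<Longrightarrow> L n (\<lambda>x. \<phi> x + \<psi> x) = L n \<phi> + L n \<psi>"
    and scale: "\<And>n c \<phi>. continuous_on UNIV \<phi> \<Longrightarrow> L n (\<lambda>x. c * \<phi> x) = c * L n \<phi>"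
    and bound: "\<And>n \<phi> B. continuous_on UNIV \<phi> \<Longrightarrow> (\<And>x. \<bar>\<phi> x\<bar> \<le> B) \<Longrightarrow> \<bar>L n \<phi>\<bar> \<le> C * B"
    and null: "\<And>\<phi>. continuous_on UNIV \<phi> \<Longrightarrow> (\<lambda>n. L n \<phi>) \<longlonglongrightarrow> 0"
    and v: "\<And>n. v n \<in> F" "\<And>n. E (v n) (v n) \<le> K" "\<And>n x. \<bar>v n x\<bar> \<le> K"
  shows "(\<lambda>n. L n (v n)) \<longlonglongrightarrow> 0"
proof -
  have K: "K \<ge> 0" using v(3)[of 0 undefined] by linarith
  have C: "C \<ge> 0" using bound[of "\<lambda>_. 0" 1 0] by (simp add: continuous_on_const)
  have L0: "L n (\<lambda>_. 0) = 0" for n using scale[of "\<lambda>_. 0" n 0] by (simp add: continuous_on_const)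
  have L_sum: "L n (\<lambda>x. \<Sum>i\<in>I. a i * \<psi> i x) = (\<Sum>i\<in>I. a i * L n (\<psi> i))"
    if "\<And>i. i \<in> I \<Longrightarrow> continuous_on UNIV (\<psi> i)" for n a and \<psi> :: "'a \<Rightarrow> 'a \<Rightarrow> real" and I
    using that
  proof (induction I rule: infinite_finite_induct)
    case (insert i I)
    then show ?case by (simp add: add scale continuous_on_sum continuous_on_mult_left)
  qed (simp_all add: L0)
  show ?thesis
  proof (rule LIMSEQ_I)
    fix e :: real assume e: "e > 0"
    \<comment> \<open>Chosen so that C * sqrt \<epsilon> * sqrt K \<le> e/2. The square undoes the
      square root in the modulus of continuity, and the summand 1 covers the case C * sqrt K =
      0.\<close>
    define \<epsilon> where "\<epsilon> = (e / (2 * (C * sqrt K + 1)))\<^sup>2"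
    have pos: "C * sqrt K + 1 > 0" using C K by (simp add: add_nonneg_pos)
    then have "\<epsilon> > 0" using e by (simp add: \<epsilon>_def)
    then obtain m where m: "\<And>x. \<exists>z\<in>V m. dist x z < \<epsilon>" using net_exists by blast
    have cH: "continuous_on UNIV (H m f)" for f by (rule continuous_mem[OF H_mem])
    have near: "\<bar>v n x - H m (v n) x\<bar> \<le> sqrt \<epsilon> * sqrt K" for n x
    proof -
      obtain z where z: "z \<in> V m" "dist x z < \<epsilon>" using m by blast
      have "\<bar>v n x - H m (v n) x\<bar> \<le> sqrt (dist x z) * sqrt (E (v n) (v n))"
        by (rule H_approximation[OF v(1) z(1)])
      also have "\<dots> \<le> sqrt \<epsilon> * sqrt K"
        using z(2) v(2) by (intro mult_mono) (auto simp: RF1_nonneg v(1) less_imp_le[OF \<open>\<epsilon> > 0\<close>])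
      finally show ?thesis .
    qed
    \<comment> \<open>With \<open>m\<close> fixed, only finitely many fixed functions remain, so
      pointwise convergence applies to each; \<open>K\<close> bounds the coefficients
      \<open>v n z\<close> for all \<open>n\<close>.\<close>
    have "(\<lambda>n. \<Sum>z\<in>V m. K * \<bar>L n (H m (indicator {z}))\<bar>) \<longlonglongrightarrow> (\<Sum>z\<in>V m. K * \<bar>0\<bar>)"
      by (intro tendsto_intros null cH)
    then have "(\<lambda>n. \<Sum>z\<in>V m. K * \<bar>L n (H m (indicator {z}))\<bar>) \<longlonglongrightarrow> 0" by simp
    from LIMSEQ_D[OF this, of "e / 2"] e
    obtain n0 where n0: "\<And>n. n \<ge> n0 \<Longrightarrow> (\<Sum>z\<in>V m. K * \<bar>L n (H m (indicator {z}))\<bar>) < e / 2"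
      by fastforce
    have "norm (L n (v n) - 0) < e" if "n \<ge> n0" for n
    proof -
      have "L n (v n) = L n (\<lambda>x. H m (v n) x + (v n x - H m (v n) x))" by simp
      also have "\<dots> = L n (H m (v n)) + L n (\<lambda>x. v n x - H m (v n) x)"
        by (rule add) (intro continuous_intros cH continuous_mem[OF v(1)])+
      finally have split: "L n (v n) = L n (H m (v n)) + L n (\<lambda>x. v n x - H m (v n) x)" .
      have "\<bar>L n (\<lambda>x. v n x - H m (v n) x)\<bar> \<le> C * (sqrt \<epsilon> * sqrt K)"
        by (intro bound near continuous_intros cH continuous_mem[OF v(1)])
      also have "\<dots> = (C * sqrt K) * (e / (2 * (C * sqrt K + 1)))"
        using e pos by (simp add: \<epsilon>_def)
      also have "\<dots> \<le> e / 2"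
        using e pos by (simp add: field_simps)
      finally have 1: "\<bar>L n (\<lambda>x. v n x - H m (v n) x)\<bar> \<le> e / 2" .
      have "\<bar>L n (H m (v n))\<bar> = \<bar>\<Sum>z\<in>V m. v n z * L n (H m (indicator {z}))\<bar>"
        by (subst H_expansion, subst L_sum) (auto intro: cH)
      also have "\<dots> \<le> (\<Sum>z\<in>V m. K * \<bar>L n (H m (indicator {z}))\<bar>)"
        by (rule order_trans[OF sum_abs]) (auto simp: abs_mult intro!: sum_mono mult_right_mono v(3))
      also have "\<dots> < e / 2" by (rule n0[OF that])
      finally have 2: "\<bar>L n (H m (v n))\<bar> < e / 2" .
      show ?thesis unfolding split using 1 2 by simp
    qed
    then show "\<exists>n0. \<forall>n\<ge>n0. norm (L n (v n) - 0) < e" by blast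
  qed
qed

lemma carre_add: "carre n f h (\<lambda>x. \<phi> x + \<psi> x) = carre n f h \<phi> + carre n f h \<psi>"
  by (simp add: carre_def wsum_add distrib_right)

lemma carre_scale: "carre n f h (\<lambda>x. c * \<phi> x) = c * carre n f h \<phi>"
  using wsum_scale[of n c "\<lambda>x y. \<phi> x * ((f x - f y) * (h x - h y))"]
  by (simp add: carre_def mult.assoc)

lemma carre_diff_left: "carre n (\<lambda>x. f x - g x) h \<phi> = carre n f h \<phi> - carre n g h \<phi>"
  unfolding carre_def wsum_diff[symmetric]
  by (rule arg_cong[of _ _ "wsum n"]) (simp add: fun_eq_iff algebra_simps)

lemma carre_cong: "(\<And>x. x \<in> V n \<Longrightarrow> \<phi> x = \<psi> x) \<Longrightarrow> carre n f h \<phi> = carre n f h \<psi>"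
  by (simp add: carre_def wsum_def)

lemma mutual_energy_integral_bound:
  assumes "f \<in> F" "h \<in> F" "continuous_on UNIV \<phi>" "\<And>x. \<bar>\<phi> x\<bar> \<le> B"
  shows "\<bar>mutual_energy_integral E F f h \<phi>\<bar> \<le> 2 * B * (sqrt (E f f) * sqrt (E h h))"
  by (rule LIMSEQ_le_const2[OF tendsto_rabs[OF mutual_energy_limit[OF assms(1-3)]]])
    (auto intro!: carre_energy_bound assms)

lemma mutual_energy_integral_add:
  assumes "f \<in> F" "h \<in> F" "continuous_on UNIV \<phi>" "continuous_on UNIV \<psi>"
  shows "mutual_energy_integral E F f h (\<lambda>x. \<phi> x + \<psi> x)
    = mutual_energy_integral E F f h \<phi> + mutual_energy_integral E F f h \<psi>"
  using LIMSEQ_unique[OF mutual_energy_limit[OF assms(1,2) continuous_on_add[OF assms(3,4)]]]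
    tendsto_add[OF mutual_energy_limit[OF assms(1-3)] mutual_energy_limit[OF assms(1,2,4)]]
  by (simp add: carre_add)

lemma mutual_energy_integral_scale:
  assumes "f \<in> F" "h \<in> F" "continuous_on UNIV \<phi>"
  shows "mutual_energy_integral E F f h (\<lambda>x. c * \<phi> x) = c * mutual_energy_integral E F f h \<phi>"
  using LIMSEQ_unique[OF mutual_energy_limit[OF assms(1,2) continuous_on_mult_left[OF assms(3)]]]
    tendsto_mult_left[OF mutual_energy_limit[OF assms(1-3)]]
  by (simp add: carre_scale)

text \<open>The difference of discrete and limiting integral, with \<open>b\<close> absorbed into
  the functional, is linear, bounded in the uniform norm independently of \<open>n\<close>, and null
  at each fixed integrand. This is what permits an integrand moving with \<open>n\<close>.\<close>

lemma carre_uniform_limit: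
  assumes f: "f \<in> F" and h: "h \<in> F" and b: "continuous_on UNIV b"
    and v: "\<And>n. v n \<in> F" "\<And>n. E (v n) (v n) \<le> K" "\<And>n x. \<bar>v n x\<bar> \<le> K"
  shows "(\<lambda>n. carre n f h (\<lambda>x. b x * v n x) - mutual_energy_integral E F f h (\<lambda>x. b x * v n x)) \<longlonglongrightarrow> 0"
proof -
  obtain Bb where Bb: "Bb > 0" "\<And>x. \<bar>b x\<bar> \<le> Bb" using bounded_continuous[OF b] by blast
  define L where "L n \<phi> = carre n f h (\<lambda>x. b x * \<phi> x) - mutual_energy_integral E F f h (\<lambda>x. b x * \<phi> x)"
    for n \<phi>
  have cb: "continuous_on UNIV (\<lambda>x. b x * \<phi> x)" if "continuous_on UNIV \<phi>" for \<phi> :: "'a \<Rightarrow> real"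
    using b that by (intro continuous_intros)
  have "(\<lambda>n. L n (v n)) \<longlonglongrightarrow> 0"
  proof (rule uniformly_null_functionals[where v = v and K = K
        and C = "4 * Bb * (sqrt (E f f) * sqrt (E h h))"])
    fix n and \<phi> \<psi> :: "'a \<Rightarrow> real" assume c: "continuous_on UNIV \<phi>" "continuous_on UNIV \<psi>"
    show "L n (\<lambda>x. \<phi> x + \<psi> x) = L n \<phi> + L n \<psi>"
      unfolding L_def distrib_left carre_add mutual_energy_integral_add[OF f h cb[OF c(1)] cb[OF c(2)]]
      by simp
  next
    fix n a and \<phi> :: "'a \<Rightarrow> real" assume c: "continuous_on UNIV \<phi>"
    have "(\<lambda>x. b x * (a * \<phi> x)) = (\<lambda>x. a * (b x * \<phi> x))" by (simp add: fun_eq_iff)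
    then show "L n (\<lambda>x. a * \<phi> x) = a * L n \<phi>"
      unfolding L_def by (simp add: carre_scale mutual_energy_integral_scale[OF f h cb[OF c]] right_diff_distrib)
  next
    fix n B and \<phi> :: "'a \<Rightarrow> real" assume c: "continuous_on UNIV \<phi>" and B: "\<And>x. \<bar>\<phi> x\<bar> \<le> B"
    have bB: "\<bar>b x * \<phi> x\<bar> \<le> Bb * B" for x
      unfolding abs_mult using Bb B by (intro mult_mono) (auto intro: less_imp_le)
    have "\<bar>carre n f h (\<lambda>x. b x * \<phi> x)\<bar> \<le> 2 * (Bb * B) * (sqrt (E f f) * sqrt (E h h))"
      by (rule carre_energy_bound[OF f h bB])
    with mutual_energy_integral_bound[OF f h cb[OF c] bB]
    have "\<bar>L n \<phi>\<bar> \<le> 2 * (2 * (Bb * B) * (sqrt (E f f) * sqrt (E h h)))"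
      unfolding L_def by linarith
    then show "\<bar>L n \<phi>\<bar> \<le> 4 * Bb * (sqrt (E f f) * sqrt (E h h)) * B"
      by (simp add: mult_ac)
  next
    fix \<phi> :: "'a \<Rightarrow> real" assume c: "continuous_on UNIV \<phi>"
    show "(\<lambda>n. L n \<phi>) \<longlonglongrightarrow> 0"
      unfolding L_def by (rule LIM_zero[OF mutual_energy_limit[OF f h cb[OF c]]])
  qed (use v in auto)
  then show ?thesis by (simp add: L_def)
qed

end

section \<open>Finite forms with drift and their coercivity\<close>

locale drift_approximation = approximated_resistance_form E F V
  for E :: "('a::metric_space) form" and F V +
  fixes \<mu> :: "'a measure" and p :: "nat \<Rightarrow> 'a pmf" and N :: nat and b h :: "nat \<Rightarrow> 'a \<Rightarrow> real"
    and D :: real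
  assumes D_eq: "D = diameter (UNIV :: 'a set)"
    and sets_mu: "sets \<mu> = sets borel" and prob_mu: "prob_space \<mu>"
    and set_p: "set_pmf (p n) = V n" and weak: "weakly_converges p \<mu>"
    and b_cont: "i \<in> {1..N} \<Longrightarrow> continuous_on UNIV (b i)"
    and h_mem: "i \<in> {1..N} \<Longrightarrow> h i \<in> F"
begin

abbreviation ip :: "nat \<Rightarrow> ('a \<Rightarrow> real) \<Rightarrow> ('a \<Rightarrow> real) \<Rightarrow> real" where
  "ip n \<equiv> L2_inner (measure_pmf (p n))"
abbreviation nrm :: "nat \<Rightarrow> ('a \<Rightarrow> real) \<Rightarrow> real" where
  "nrm n \<equiv> L2_norm (measure_pmf (p n))"

lemma ip_eq_sum: "ip n f g = (\<Sum>x\<in>V n. pmf (p n) x * (f x * g x))"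
  unfolding L2_inner_def
  using integral_measure_pmf[OF finite_V, where M = "p n" and f = "\<lambda>x. f x * g x"] set_p by simp

lemma sum_pmf: "(\<Sum>x\<in>V n. pmf (p n) x) = 1"
  using sum_pmf_eq_1[OF finite_V, of "p n"] set_p by simp

lemma L2_pmf: "f \<in> L2_space (measure_pmf (p n))"
  unfolding L2_space_def using finite_V[of n] set_p[of n]
  by (auto intro!: integrable_measure_pmf_finite)

lemma ip_cong: "(\<And>x. x \<in> V n \<Longrightarrow> f x = f' x) \<Longrightarrow> (\<And>x. x \<in> V n \<Longrightarrow> g x = g' x) \<Longrightarrow> ip n f g = ip n f' g'"
  by (simp add: ip_eq_sum)

lemma ip_Cauchy_Schwarz: "\<bar>ip n f g\<bar> \<le> nrm n f * nrm n g"
  by (rule L2_Cauchy_Schwarz[OF L2_pmf L2_pmf])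

lemma ip_nonneg: "0 \<le> ip n f f"
  by (simp add: L2_inner_def)

lemma nrm_square: "(nrm n f)\<^sup>2 = ip n f f"
  by (simp add: L2_norm_def ip_nonneg)

lemma nrm_nonneg: "0 \<le> nrm n f"
  by (simp add: L2_norm_def ip_nonneg)

lemma nrm_le:
  assumes "\<And>x. \<bar>f x\<bar> \<le> B"
  shows "nrm n f \<le> B"
proof -
  have B: "0 \<le> B" using assms[of undefined] by linarith
  have "f x * f x \<le> B\<^sup>2" for x
    using power_mono[OF assms[of x], of 2] by (simp add: power2_eq_square)
  then have "ip n f f \<le> (\<Sum>x\<in>V n. pmf (p n) x * B\<^sup>2)"
    unfolding ip_eq_sum by (intro sum_mono mult_left_mono) simp_all
  also have "\<dots> = B\<^sup>2" by (simp add: sum_distrib_right[symmetric] sum_pmf)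
  finally show ?thesis unfolding L2_norm_def using B by (simp add: real_le_lsqrt ip_nonneg)
qed

lemma nrm_triangle_sq: "(nrm n f)\<^sup>2 \<le> 2 * (nrm n g)\<^sup>2 + 2 * (nrm n (\<lambda>x. g x - f x))\<^sup>2"
proof -
  have "ip n f f \<le> (\<Sum>x\<in>V n. 2 * (pmf (p n) x * (g x * g x)) + 2 * (pmf (p n) x * ((g x - f x) * (g x - f x))))"
    unfolding ip_eq_sum
  proof (rule sum_mono)
    fix x
    have "f x * f x \<le> 2 * (g x * g x) + 2 * ((g x - f x) * (g x - f x))"
      using zero_le_power2[of "f x - 2 * g x"] by (simp add: power2_eq_square algebra_simps)
    from mult_left_mono[OF this pmf_nonneg[of "p n" x]]
    show "pmf (p n) x * (f x * f x) \<le> 2 * (pmf (p n) x * (g x * g x)) + 2 * (pmf (p n) x * ((g x - f x) * (g x - f x)))"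
      by (simp add: algebra_simps)
  qed
  then show ?thesis
    unfolding nrm_square ip_eq_sum[of n g g] ip_eq_sum[of n "\<lambda>x. g x - f x"]
    by (simp add: sum.distrib sum_distrib_left)
qed

lemma dist_le_D: "dist x y \<le> D" for x y :: 'a
  unfolding D_eq by (rule diameter_bounded_bound[OF compact_imp_bounded[OF compact_space]]) auto

lemma D_nonneg: "0 \<le> D"
  using dist_le_D[of undefined undefined] by simp

text \<open>At a point \<open>y\<close> of \<open>V n\<close> where |v| is minimal, |v y| is at most
  the \<open>L2\<close> norm, the measure being a probability. The oscillation away from
  \<open>y\<close> is controlled by energy and diameter.\<close>

lemma H_sup_bound: "\<bar>H n v x\<bar> \<le> sqrt D * sqrt (tr n v v) + nrm n v"
proof -
  obtain y where y: "y \<in> V n" "\<And>z. z \<in> V n \<Longrightarrow> \<bar>v y\<bar> \<le> \<bar>v z\<bar>"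
    using ex_is_arg_min_if_finite[OF finite_V nonempty_V, where f = "\<lambda>z. \<bar>v z\<bar>"]
    unfolding is_arg_min_linorder by blast
  have "\<bar>v y\<bar>\<^sup>2 = (\<Sum>z\<in>V n. pmf (p n) z * \<bar>v y\<bar>\<^sup>2)"
    by (simp add: sum_distrib_right[symmetric] sum_pmf)
  also have "\<dots> \<le> ip n v v"
    unfolding ip_eq_sum
  proof (intro sum_mono mult_left_mono)
    fix z assume "z \<in> V n"
    from power_mono[OF y(2)[OF this], of 2] show "\<bar>v y\<bar>\<^sup>2 \<le> v z * v z"
      by (simp add: power2_eq_square)
  qed simp
  finally have vy: "\<bar>v y\<bar> \<le> nrm n v" unfolding L2_norm_def by (rule real_le_rsqrt)
  have "\<bar>H n v x - H n v y\<bar> \<le> sqrt (dist x y) * sqrt (E (H n v) (H n v))"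
    by (rule abs_diff_le[OF H_mem])
  also have "\<dots> \<le> sqrt D * sqrt (tr n v v)"
    using dist_le_D[of x y] trace_nonneg[OF finite_V nonempty_V, of n v]
    by (intro mult_mono) (auto simp: trace_form_def D_nonneg)
  finally show ?thesis using vy H_eq[OF y(1), of v] by linarith
qed

abbreviation Qn :: "nat \<Rightarrow> 'a form" where "Qn n \<equiv> Q_form_fin E F (V n) N b h"

lemma Qn_eq_carre: "Qn n f g = (\<Sum>i=1..N. 1/2 * carre n f (h i) (\<lambda>x. b i x * g x))"
  unfolding Q_form_fin_def
proof (intro sum.cong refl arg_cong[of _ _ "times (1/2)"])
  fix i
  have "(\<Sum>y\<in>V n - {x}. conductance E F (V n) x y * b i x * g x * (f x - f y) * (h i x - h i y))
      = (\<Sum>y\<in>V n. conductance E F (V n) x y * (b i x * g x * ((f x - f y) * (h i x - h i y))))"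
    if "x \<in> V n" for x
    using that finite_V by (subst (2) sum.remove[of _ x]) (auto simp: mult.assoc)
  then show "(\<Sum>x\<in>V n. \<Sum>y\<in>V n - {x}. conductance E F (V n) x y * b i x * g x * (f x - f y) * (h i x - h i y))
      = carre n f (h i) (\<lambda>x. b i x * g x)"
    by (simp add: carre_def wsum_def)
qed

text \<open>The discrete analogue of \<open>drift_energy\<close>, kept as a sum of squares so that
  it is visibly nonnegative and appears directly as a factor in Cauchy-Schwarz over pairs.\<close>

definition drift_n :: "nat \<Rightarrow> real" where
  "drift_n n = wsum n (\<lambda>x y. (\<Sum>i=1..N. b i x * (h i x - h i y))\<^sup>2)"

lemma drift_n_tendsto: "drift_n \<longlonglongrightarrow> drift_energy E F N b h"
proof -
  have "drift_n n = (\<Sum>i=1..N. \<Sum>j=1..N. carre n (h i) (h j) (\<lambda>x. b i x * b j x))" for n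
  proof -
    have "(\<lambda>x y. (\<Sum>i=1..N. b i x * (h i x - h i y))\<^sup>2)
        = (\<lambda>x y. \<Sum>i=1..N. \<Sum>j=1..N. b i x * b j x * ((h i x - h i y) * (h j x - h j y)))"
      by (simp add: power2_eq_square sum_product algebra_simps)
    then show ?thesis by (simp add: drift_n_def carre_def wsum_sum)
  qed
  then have "drift_n = (\<lambda>n. \<Sum>i=1..N. \<Sum>j=1..N. carre n (h i) (h j) (\<lambda>x. b i x * b j x))" by blast
  then show ?thesis
    unfolding drift_energy_def
    by (simp only:) (intro tendsto_sum mutual_energy_limit h_mem continuous_on_mult b_cont; assumption)
qed

text \<open>The undifferentiated factor \<open>v\<close> is estimated by its supremum, the two
  differences by Cauchy-Schwarz. The factor 1/2 in the drift term and the 2 in \<open>wsum\<close> =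
  2 * \<open>tr\<close> combine to sqrt (1/2 * drift_n n).\<close>

lemma Qn_self_bound:
  "\<bar>Qn n v v\<bar> \<le> sqrt (1/2 * drift_n n) * (sqrt (tr n v v) * (sqrt D * sqrt (tr n v v) + nrm n v))"
proof -
  define M where "M = sqrt D * sqrt (tr n v v) + nrm n v"
  define S where "S x y = (\<Sum>i=1..N. b i x * (h i x - h i y))" for x y
  have M: "\<bar>v x\<bar> \<le> M" if "x \<in> V n" for x
    using H_sup_bound[of n v x] H_eq[OF that] by (simp add: M_def)
  have M0: "0 \<le> M"
    using D_nonneg trace_nonneg[OF finite_V nonempty_V, of n v] nrm_nonneg by (simp add: M_def)
  have Q: "Qn n v v = 1/2 * wsum n (\<lambda>x y. v x * ((v x - v y) * S x y))"
  proof -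
    have "Qn n v v = 1/2 * wsum n (\<lambda>x y. \<Sum>i=1..N. b i x * v x * ((v x - v y) * (h i x - h i y)))"
      unfolding Qn_eq_carre wsum_sum carre_def sum_distrib_left ..
    moreover have "(\<Sum>i=1..N. b i x * v x * ((v x - v y) * (h i x - h i y)))
        = v x * ((v x - v y) * S x y)" for x y
      unfolding S_def sum_distrib_left by (intro sum.cong refl) (simp add: mult_ac)
    ultimately show ?thesis by (simp only:)
  qed
  have "\<bar>wsum n (\<lambda>x y. v x * ((v x - v y) * S x y))\<bar> \<le> wsum n (\<lambda>x y. \<bar>v x * ((v x - v y) * S x y)\<bar>)"
    by (rule wsum_abs_le)
  also have "\<dots> \<le> wsum n (\<lambda>x y. M * (\<bar>v x - v y\<bar> * \<bar>S x y\<bar>))"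
  proof (rule wsum_mono)
    fix x y assume "x \<in> V n"
    from mult_right_mono[OF M[OF this], of "\<bar>v x - v y\<bar> * \<bar>S x y\<bar>"]
    show "\<bar>v x * ((v x - v y) * S x y)\<bar> \<le> M * (\<bar>v x - v y\<bar> * \<bar>S x y\<bar>)" by (simp add: abs_mult)
  qed
  also have "\<dots> = M * wsum n (\<lambda>x y. \<bar>v x - v y\<bar> * \<bar>S x y\<bar>)" by (rule wsum_scale)
  also have "\<dots> \<le> M * (sqrt (2 * tr n v v) * sqrt (drift_n n))"
  proof (rule mult_left_mono[OF _ M0])
    have "wsum n (\<lambda>x y. \<bar>v x - v y\<bar> * \<bar>S x y\<bar>)
        \<le> sqrt (wsum n (\<lambda>x y. \<bar>v x - v y\<bar>\<^sup>2)) * sqrt (wsum n (\<lambda>x y. \<bar>S x y\<bar>\<^sup>2))"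
      using wsum_Cauchy_Schwarz[of n "\<lambda>x y. \<bar>v x - v y\<bar>" "\<lambda>x y. \<bar>S x y\<bar>"] by linarith
    also have "wsum n (\<lambda>x y. \<bar>v x - v y\<bar>\<^sup>2) = 2 * tr n v v"
      unfolding tr_eq_wsum power2_abs by (simp add: power2_eq_square)
    also have "wsum n (\<lambda>x y. \<bar>S x y\<bar>\<^sup>2) = drift_n n"
      unfolding drift_n_def power2_abs S_def ..
    finally show "wsum n (\<lambda>x y. \<bar>v x - v y\<bar> * \<bar>S x y\<bar>) \<le> sqrt (2 * tr n v v) * sqrt (drift_n n)" .
  qed
  also have "sqrt (2 * tr n v v) * sqrt (drift_n n) = sqrt (2\<^sup>2 * ((1/2 * drift_n n) * tr n v v))"
    by (simp add: real_sqrt_mult[symmetric] mult_ac)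
  also have "\<dots> = 2 * (sqrt (1/2 * drift_n n) * sqrt (tr n v v))"
    unfolding real_sqrt_mult by simp
  finally have "\<bar>Qn n v v\<bar> \<le> M * (sqrt (1/2 * drift_n n) * sqrt (tr n v v))"
    unfolding Q by (simp add: abs_mult)
  then show ?thesis by (simp add: M_def mult_ac)
qed

lemma tr_Cauchy_Schwarz: "\<bar>tr n f g\<bar> \<le> sqrt (tr n f f) * sqrt (tr n g g)"
  unfolding trace_form_def by (rule Cauchy_Schwarz[OF H_mem H_mem])

abbreviation An :: "nat \<Rightarrow> real \<Rightarrow> 'a form" where
  "An n \<alpha> \<equiv> form_shift (measure_pmf (p n)) (A_form_fin E F (V n) N b h) \<alpha>"

lemma An_eq: "An n \<alpha> f g = tr n f g + Qn n f g + \<alpha> * ip n f g"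
  by (simp add: form_shift_def A_form_fin_def)

lemma An_diff_left: "An n \<alpha> (\<lambda>x. f x - g x) v = An n \<alpha> f v - An n \<alpha> g v"
proof -
  have "tr n (\<lambda>x. f x - g x) v = tr n f v - tr n g v"
    using trace_add_left[OF finite_V nonempty_V, of n f "\<lambda>x. -1 * g x" v]
      trace_scale_left[OF finite_V nonempty_V, of n "-1" g v] by simp
  moreover have "Qn n (\<lambda>x. f x - g x) v = Qn n f v - Qn n g v"
    by (simp add: Qn_eq_carre carre_diff_left sum_subtractf diff_divide_distrib)
  moreover have "ip n (\<lambda>x. f x - g x) v = ip n f v - ip n g v"
    by (simp add: ip_eq_sum sum_subtractf algebra_simps)
  ultimately show ?thesis unfolding An_eq by (simp only:) (simp add: algebra_simps)
qed

text \<open>Only the drift coefficient depends on the stage; as \<open>drift_n\<close> converges,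
  the strict bound holds for all large \<open>n\<close>, and from then on simultaneously for every
  \<open>v\<close> and \<alpha>.\<close>

lemma eventually_coercive:
  assumes \<delta>: "0 < \<delta>" and s: "0 < s"
    and drift: "sqrt (1/2 * drift_energy E F N b h) * (sqrt D + \<delta>) < s"
    and lam: "lam = inverse (4 * \<delta>) * inverse (sqrt D + \<delta>)"
  shows "\<forall>\<^sub>F n in sequentially. \<forall>v \<alpha>. (1 - s) * tr n v v + (\<alpha> - s * lam) * (nrm n v)\<^sup>2 \<le> An n \<alpha> v v"
proof -
  have "(\<lambda>n. sqrt (1/2 * drift_n n) * (sqrt D + \<delta>)) \<longlonglongrightarrow> sqrt (1/2 * drift_energy E F N b h) * (sqrt D + \<delta>)"
    by (intro tendsto_intros drift_n_tendsto)
  from order_tendstoD(2)[OF this drift] show ?thesis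
  proof eventually_elim
    fix n assume n: "sqrt (1/2 * drift_n n) * (sqrt D + \<delta>) < s"
    define \<sigma> where "\<sigma> = sqrt (1/2 * drift_n n)"
    have \<sigma>: "0 \<le> \<sigma>"
      unfolding \<sigma>_def drift_n_def by (intro real_sqrt_ge_zero mult_nonneg_nonneg wsum_nonneg) auto
    have k: "0 < sqrt D + \<delta>" using \<delta> D_nonneg by (simp add: add_nonneg_pos)
    have "0 < lam" unfolding lam using \<delta> k by simp
    have lam4: "4 * \<delta> * (sqrt D + \<delta>) * lam = 1"
      unfolding lam using \<delta> k by (simp add: divide_inverse[symmetric] inverse_eq_divide)
    show "\<forall>v \<alpha>. (1 - s) * tr n v v + (\<alpha> - s * lam) * (nrm n v)\<^sup>2 \<le> An n \<alpha> v v"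
    proof (intro allI)
      fix v \<alpha>
      define e where "e = sqrt (tr n v v)"
      define l where "l = nrm n v"
      have e2: "e\<^sup>2 = tr n v v" using trace_nonneg[OF finite_V nonempty_V, of n v] by (simp add: e_def)
      \<comment> \<open>Since (sqrt D + \<delta>) * lam = 1/(4 \<delta>), this is e l \<le> \<delta>
        e^2 + l^2/(4 \<delta>), obtained from one completed square.\<close>
      have young: "e * l \<le> \<delta> * e\<^sup>2 + (sqrt D + \<delta>) * lam * l\<^sup>2"
      proof -
        have "0 \<le> \<delta> * (e - 2 * (sqrt D + \<delta>) * lam * l)\<^sup>2" using \<delta> by simp
        also have "\<dots> = \<delta> * e\<^sup>2 - (4 * \<delta> * (sqrt D + \<delta>) * lam) * (e * l)
            + (4 * \<delta> * (sqrt D + \<delta>) * lam) * ((sqrt D + \<delta>) * lam * l\<^sup>2)"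
          by (simp add: power2_eq_square algebra_simps)
        finally show ?thesis unfolding lam4 by simp
      qed
      have "\<bar>Qn n v v\<bar> \<le> \<sigma> * (e * (sqrt D * e + l))"
        using Qn_self_bound[of n v] by (simp add: \<sigma>_def e_def l_def)
      also have "\<dots> = \<sigma> * (sqrt D * e\<^sup>2 + e * l)" by (simp add: power2_eq_square algebra_simps)
      also have "\<dots> \<le> \<sigma> * (sqrt D * e\<^sup>2 + (\<delta> * e\<^sup>2 + (sqrt D + \<delta>) * lam * l\<^sup>2))"
        using \<sigma> young by (intro mult_left_mono) auto
      also have "\<dots> = (\<sigma> * (sqrt D + \<delta>)) * (e\<^sup>2 + lam * l\<^sup>2)" by (simp add: algebra_simps)
      also have "\<dots> \<le> s * (e\<^sup>2 + lam * l\<^sup>2)"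
        using n \<open>0 < lam\<close> by (intro mult_right_mono) (auto simp: \<sigma>_def)
      finally have "- (s * (e\<^sup>2 + lam * l\<^sup>2)) \<le> Qn n v v" by linarith
      then show "(1 - s) * tr n v v + (\<alpha> - s * lam) * (nrm n v)\<^sup>2 \<le> An n \<alpha> v v"
        by (simp add: An_eq e2[symmetric] l_def nrm_square algebra_simps)
    qed
  qed
qed

section \<open>Strong K-S convergence and moving test functions\<close>

lemma integrable_mu:
  fixes \<phi> :: "'a \<Rightarrow> real"
  assumes "continuous_on UNIV \<phi>"
  shows "integrable \<mu> \<phi>"
proof -
  interpret prob_space \<mu> by (rule prob_mu)
  obtain B where "\<And>x. \<bar>\<phi> x\<bar> \<le> B" using bounded_continuous[OF assms] by blast
  then show ?thesis
    using borel_measurable_continuous_onI[OF assms] sets_mu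
    by (intro integrable_const_bound[of _ B]) (auto cong: measurable_cong_sets)
qed

lemma integral_mu_bound:
  fixes \<phi> :: "'a \<Rightarrow> real"
  assumes "continuous_on UNIV \<phi>" "\<And>x. \<bar>\<phi> x\<bar> \<le> B"
  shows "\<bar>LINT x|\<mu>. \<phi> x\<bar> \<le> B"
proof -
  interpret prob_space \<mu> by (rule prob_mu)
  have "\<bar>LINT x|\<mu>. \<phi> x\<bar> \<le> (LINT x|\<mu>. \<bar>\<phi> x\<bar>)" by (rule integral_abs_bound)
  also have "\<dots> \<le> (LINT x|\<mu>. B)"
    using integrable_mu[OF assms(1)] assms(2) by (intro integral_mono) auto
  finally show ?thesis by (simp add: prob_space)
qed

lemma continuous_L2:
  assumes "continuous_on UNIV \<phi>"
  shows "\<phi> \<in> L2_space \<mu>"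
  using borel_measurable_continuous_onI[OF assms] sets_mu integrable_mu[OF continuous_on_power[OF assms]]
  by (auto simp: L2_space_def cong: measurable_cong_sets)

lemma diff_L2:
  assumes "f \<in> L2_space \<mu>" "g \<in> L2_space \<mu>"
  shows "(\<lambda>x. f x - g x) \<in> L2_space \<mu>"
proof -
  have [measurable]: "f \<in> borel_measurable \<mu>" "g \<in> borel_measurable \<mu>"
    and i: "integrable \<mu> (\<lambda>x. (f x)\<^sup>2)" "integrable \<mu> (\<lambda>x. (g x)\<^sup>2)"
    using assms by (auto simp: L2_space_def)
  have "integrable \<mu> (\<lambda>x. (f x - g x)\<^sup>2)"
  proof (rule Bochner_Integration.integrable_bound[OF Bochner_Integration.integrable_add
        [OF integrable_mult_right[OF i(1), of 2] integrable_mult_right[OF i(2), of 2]]])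
    show "AE x in \<mu>. norm ((f x - g x)\<^sup>2) \<le> norm (2 * (f x)\<^sup>2 + 2 * (g x)\<^sup>2)"
    proof (rule AE_I2)
      fix x
      have "(f x - g x)\<^sup>2 \<le> 2 * (f x)\<^sup>2 + 2 * (g x)\<^sup>2"
        using zero_le_power2[of "f x + g x"] by (simp add: power2_eq_square algebra_simps)
      then show "norm ((f x - g x)\<^sup>2) \<le> norm (2 * (f x)\<^sup>2 + 2 * (g x)\<^sup>2)" by simp
    qed
  qed simp
  then show ?thesis by (simp add: L2_space_def)
qed

lemma L2_norm_mu_le:
  assumes "continuous_on UNIV \<phi>" "\<And>x. \<bar>\<phi> x\<bar> \<le> B"
  shows "L2_norm \<mu> \<phi> \<le> B"
proof -
  have B: "0 \<le> B" using assms(2)[of undefined] by linarith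
  have "\<bar>\<phi> x * \<phi> x\<bar> \<le> B * B" for x
    unfolding abs_mult by (intro mult_mono assms B) simp
  then have "\<bar>LINT x|\<mu>. \<phi> x * \<phi> x\<bar> \<le> B * B"
    by (intro integral_mu_bound continuous_on_mult assms)
  then show ?thesis
    unfolding L2_norm_def L2_inner_def using B by (intro real_le_lsqrt) (auto simp: power2_eq_square)
qed

lemma ip_uniform_limit_continuous:
  assumes \<phi>: "continuous_on UNIV \<phi>"
    and v: "\<And>n. v n \<in> F" "\<And>n. E (v n) (v n) \<le> K" "\<And>n x. \<bar>v n x\<bar> \<le> K"
  shows "(\<lambda>n. ip n \<phi> (v n) - L2_inner \<mu> \<phi> (v n)) \<longlonglongrightarrow> 0"
proof -
  obtain B where B: "B > 0" "\<And>x. \<bar>\<phi> x\<bar> \<le> B" using bounded_continuous[OF \<phi>] by blast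
  show ?thesis
  proof (rule uniformly_null_functionals[where v = v and K = K and C = "2 * B"
        and L = "\<lambda>n \<psi>. ip n \<phi> \<psi> - L2_inner \<mu> \<phi> \<psi>"])
    fix n and \<psi> \<eta> :: "'a \<Rightarrow> real" assume c: "continuous_on UNIV \<psi>" "continuous_on UNIV \<eta>"
    have "L2_inner \<mu> \<phi> (\<lambda>x. \<psi> x + \<eta> x) = L2_inner \<mu> \<phi> \<psi> + L2_inner \<mu> \<phi> \<eta>"
      using integrable_mu[OF continuous_on_mult[OF \<phi> c(1)]] integrable_mu[OF continuous_on_mult[OF \<phi> c(2)]]
      by (simp add: L2_inner_def distrib_left)
    moreover have "ip n \<phi> (\<lambda>x. \<psi> x + \<eta> x) = ip n \<phi> \<psi> + ip n \<phi> \<eta>"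
      by (simp add: ip_eq_sum distrib_left sum.distrib)
    ultimately show "ip n \<phi> (\<lambda>x. \<psi> x + \<eta> x) - L2_inner \<mu> \<phi> (\<lambda>x. \<psi> x + \<eta> x)
        = (ip n \<phi> \<psi> - L2_inner \<mu> \<phi> \<psi>) + (ip n \<phi> \<eta> - L2_inner \<mu> \<phi> \<eta>)" by simp
  next
    fix n c and \<psi> :: "'a \<Rightarrow> real"
    have "L2_inner M \<phi> (\<lambda>x. c * \<psi> x) = c * L2_inner M \<phi> \<psi>" for M
      by (simp add: L2_inner_def mult.left_commute)
    then show "ip n \<phi> (\<lambda>x. c * \<psi> x) - L2_inner \<mu> \<phi> (\<lambda>x. c * \<psi> x) = c * (ip n \<phi> \<psi> - L2_inner \<mu> \<phi> \<psi>)"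
      by (simp add: right_diff_distrib)
  next
    fix n B' and \<psi> :: "'a \<Rightarrow> real" assume c: "continuous_on UNIV \<psi>" and B': "\<And>x. \<bar>\<psi> x\<bar> \<le> B'"
    have B'0: "0 \<le> B'" using B'[of undefined] by linarith
    have "\<bar>\<phi> x * \<psi> x\<bar> \<le> B * B'" for x
      unfolding abs_mult using B B' by (intro mult_mono) (auto intro: less_imp_le)
    then have "\<bar>L2_inner \<mu> \<phi> \<psi>\<bar> \<le> B * B'"
      unfolding L2_inner_def by (intro integral_mu_bound continuous_on_mult \<phi> c)
    moreover have "\<bar>ip n \<phi> \<psi>\<bar> \<le> B * B'"
    proof (rule order_trans[OF ip_Cauchy_Schwarz])
      show "nrm n \<phi> * nrm n \<psi> \<le> B * B'"
        using less_imp_le[OF B(1)] by (intro mult_mono nrm_le B(2) B' nrm_nonneg)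
    qed
    ultimately show "\<bar>ip n \<phi> \<psi> - L2_inner \<mu> \<phi> \<psi>\<bar> \<le> 2 * B * B'" by linarith
  next
    fix \<psi> :: "'a \<Rightarrow> real" assume c: "continuous_on UNIV \<psi>"
    have c2: "continuous_on UNIV (\<lambda>x. \<phi> x * \<psi> x)" by (intro continuous_on_mult \<phi> c)
    moreover have "bounded (range (\<lambda>x. \<phi> x * \<psi> x))"
      using bounded_continuous[OF c2] by (auto simp: bounded_iff)
    ultimately have "(\<lambda>n. ip n \<phi> \<psi>) \<longlonglongrightarrow> L2_inner \<mu> \<phi> \<psi>"
      using weak unfolding weakly_converges_def L2_inner_def by blast
    then show "(\<lambda>n. ip n \<phi> \<psi> - L2_inner \<mu> \<phi> \<psi>) \<longlonglongrightarrow> 0" by (rule LIM_zero)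
  qed (use v in auto)
qed

text \<open>Fixing one member of the approximating sequence gives a single continuous function that
  stands in for \<open>u\<close> and for almost all \<open>un n\<close> at once; K-S convergence of
  the data enters the estimates through it.\<close>

lemma KS_approximation:
  assumes "strong_KS_converges p \<mu> un u" "e > 0"
  shows "\<exists>\<phi>. continuous_on UNIV \<phi> \<and> L2_norm \<mu> (\<lambda>x. \<phi> x - u x) < e \<and>
    (\<forall>\<^sub>F n in sequentially. nrm n (\<lambda>x. \<phi> x - un n x) < e)"
proof -
  obtain \<phi> :: "nat \<Rightarrow> 'a \<Rightarrow> real" where \<phi>: "\<And>m. continuous_on UNIV (\<phi> m)"
    "(\<lambda>m. L2_norm \<mu> (\<lambda>x. \<phi> m x - u x)) \<longlonglongrightarrow> 0"
    "(\<lambda>m. limsup (\<lambda>n. ereal (nrm n (\<lambda>x. \<phi> m x - un n x)))) \<longlonglongrightarrow> 0"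
    using assms(1) unfolding strong_KS_converges_def by blast
  have "\<forall>\<^sub>F m in sequentially. L2_norm \<mu> (\<lambda>x. \<phi> m x - u x) < e \<and>
      limsup (\<lambda>n. ereal (nrm n (\<lambda>x. \<phi> m x - un n x))) < ereal e"
    using order_tendstoD(2)[OF \<phi>(2) assms(2)] order_tendstoD(2)[OF \<phi>(3), of "ereal e"] assms(2)
    by (intro eventually_conj) auto
  then obtain m where m: "L2_norm \<mu> (\<lambda>x. \<phi> m x - u x) < e"
    "limsup (\<lambda>n. ereal (nrm n (\<lambda>x. \<phi> m x - un n x))) < ereal e"
    by (auto simp: eventually_sequentially)
  from Limsup_lessD[OF m(2)] have "\<forall>\<^sub>F n in sequentially. nrm n (\<lambda>x. \<phi> m x - un n x) < e" by simp
  with m(1) \<phi>(1) show ?thesis by blast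
qed

lemma KS_bounded:
  assumes "strong_KS_converges p \<mu> un u"
  shows "\<exists>U\<ge>0. \<forall>\<^sub>F n in sequentially. nrm n (un n) \<le> U"
proof -
  obtain \<phi> where \<phi>: "continuous_on UNIV \<phi>" "\<forall>\<^sub>F n in sequentially. nrm n (\<lambda>x. \<phi> x - un n x) < 1"
    using KS_approximation[OF assms, of 1] by auto
  obtain B where B: "\<And>x. \<bar>\<phi> x\<bar> \<le> B" using bounded_continuous[OF \<phi>(1)] by blast
  have "\<forall>\<^sub>F n in sequentially. nrm n (un n) \<le> sqrt (2 * B\<^sup>2 + 2)"
    using \<phi>(2)
  proof eventually_elim
    fix n assume n: "nrm n (\<lambda>x. \<phi> x - un n x) < 1"
    have "(nrm n \<phi>)\<^sup>2 \<le> B\<^sup>2" by (rule power_mono[OF nrm_le[OF B] nrm_nonneg])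
    moreover have "(nrm n (\<lambda>x. \<phi> x - un n x))\<^sup>2 \<le> 1"
      using power_mono[OF less_imp_le[OF n] nrm_nonneg, of 2] by simp
    ultimately have "(nrm n (un n))\<^sup>2 \<le> 2 * B\<^sup>2 + 2"
      using nrm_triangle_sq[where n = n and f = "un n" and g = \<phi>] by linarith
    then show "nrm n (un n) \<le> sqrt (2 * B\<^sup>2 + 2)" by (rule real_le_rsqrt)
  qed
  then show ?thesis by (intro exI[of _ "sqrt (2 * B\<^sup>2 + 2)"]) simp
qed

text \<open>Replacing \<open>un n\<close> and \<open>u\<close> by a common continuous \<phi> costs
  at most \<open>d * K\<close> on either side by Cauchy-Schwarz, which reduces the claim to a
  continuous first factor.\<close>

lemma ip_uniform_limit:
  assumes KS: "strong_KS_converges p \<mu> un u" and u: "u \<in> L2_space \<mu>"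
    and v: "\<And>n. v n \<in> F" "\<And>n. E (v n) (v n) \<le> K" "\<And>n x. \<bar>v n x\<bar> \<le> K"
  shows "(\<lambda>n. ip n (un n) (v n) - L2_inner \<mu> u (v n)) \<longlonglongrightarrow> 0"
proof (rule LIMSEQ_I)
  fix e :: real assume e: "e > 0"
  have K: "K \<ge> 0" using v(3)[of 0 undefined] by linarith
  define d where "d = e / (3 * (K + 1))"
  have d: "d > 0" "d * K < e / 3" using e K by (auto simp: d_def field_simps)
  obtain \<phi> where \<phi>: "continuous_on UNIV \<phi>" "L2_norm \<mu> (\<lambda>x. \<phi> x - u x) < d"
    "\<forall>\<^sub>F n in sequentially. nrm n (\<lambda>x. \<phi> x - un n x) < d"
    using KS_approximation[OF KS d(1)] by blast
  have "\<forall>\<^sub>F n in sequentially. \<bar>ip n \<phi> (v n) - L2_inner \<mu> \<phi> (v n)\<bar> < e / 3"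
    using tendstoD[OF ip_uniform_limit_continuous[OF \<phi>(1) v], of "e / 3"] e by (simp add: dist_real_def)
  with \<phi>(3) have "\<forall>\<^sub>F n in sequentially. norm (ip n (un n) (v n) - L2_inner \<mu> u (v n) - 0) < e"
  proof eventually_elim
    fix n assume n: "nrm n (\<lambda>x. \<phi> x - un n x) < d"
      and n': "\<bar>ip n \<phi> (v n) - L2_inner \<mu> \<phi> (v n)\<bar> < e / 3"
    have cv: "continuous_on UNIV (v n)" by (rule continuous_mem[OF v(1)])
    have "\<bar>ip n (\<lambda>x. \<phi> x - un n x) (v n)\<bar> \<le> d * K"
    proof (rule order_trans[OF ip_Cauchy_Schwarz])
      show "nrm n (\<lambda>x. \<phi> x - un n x) * nrm n (v n) \<le> d * K"
        using n d(1) by (intro mult_mono nrm_le[OF v(3)] nrm_nonneg) simp_all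
    qed
    moreover have "ip n (\<lambda>x. \<phi> x - un n x) (v n) = ip n \<phi> (v n) - ip n (un n) (v n)"
      by (simp add: ip_eq_sum sum_subtractf algebra_simps)
    moreover have "\<bar>L2_inner \<mu> (\<lambda>x. \<phi> x - u x) (v n)\<bar> \<le> d * K"
    proof -
      have "\<bar>L2_inner \<mu> (\<lambda>x. \<phi> x - u x) (v n)\<bar> \<le> L2_norm \<mu> (\<lambda>x. \<phi> x - u x) * L2_norm \<mu> (v n)"
        by (rule L2_Cauchy_Schwarz[OF diff_L2[OF continuous_L2[OF \<phi>(1)] u] continuous_L2[OF cv]])
      also have "\<dots> \<le> d * K"
        using \<phi>(2) d(1) by (intro mult_mono L2_norm_mu_le[OF cv v(3)]) (auto simp: L2_norm_def L2_inner_def)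
      finally show ?thesis .
    qed
    moreover have "L2_inner \<mu> (\<lambda>x. \<phi> x - u x) (v n) = L2_inner \<mu> \<phi> (v n) - L2_inner \<mu> u (v n)"
      using L2_mult_integrable[OF u continuous_L2[OF cv]] L2_mult_integrable[OF continuous_L2[OF \<phi>(1)] continuous_L2[OF cv]]
      by (simp add: L2_inner_def left_diff_distrib)
    ultimately show "norm (ip n (un n) (v n) - L2_inner \<mu> u (v n) - 0) < e"
      using n' d(2) unfolding real_norm_def by linarith
  qed
  then show "\<exists>n0. \<forall>n\<ge>n0. norm (ip n (un n) (v n) - L2_inner \<mu> u (v n) - 0) < e"
    by (simp add: eventually_sequentially)
qed

text \<open>A continuous limit may serve as its own approximation, so the constant sequence is a
  witness. Elements of \<open>F\<close> are such limits.\<close>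

lemma KS_convergesI:
  assumes "continuous_on UNIV g" and lim: "(\<lambda>n. nrm n (\<lambda>x. g x - gn n x)) \<longlonglongrightarrow> 0"
  shows "strong_KS_converges p \<mu> gn g"
proof -
  have "(\<lambda>n. ereal (nrm n (\<lambda>x. g x - gn n x))) \<longlonglongrightarrow> ereal 0" using lim by simp
  then have "limsup (\<lambda>n. ereal (nrm n (\<lambda>x. g x - gn n x))) = 0"
    by (simp add: lim_imp_Limsup zero_ereal_def)
  then show ?thesis
    unfolding strong_KS_converges_def using assms(1)
    by (intro exI[of _ "\<lambda>_. g"]) (simp add: L2_norm_def L2_inner_def)
qed

text \<open>With \<open>g\<close> fixed, the growth in \<open>v\<close> is linear with a constant
  independent of \<open>n\<close>; played against quadratic coercivity this yields the a priori
  bound on the error.\<close>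

lemma An_bound:
  assumes g: "g \<in> F"
  shows "\<exists>C\<ge>0. \<forall>n v. \<bar>An n \<alpha> g v\<bar> \<le> C * (sqrt (tr n v v) + nrm n v)"
proof -
  obtain Bg where Bg: "Bg > 0" "\<And>x. \<bar>g x\<bar> \<le> Bg" using bounded_continuous[OF continuous_mem[OF g]] by blast
  have "\<exists>B. \<forall>i\<in>{1..N}. 0 < B i \<and> (\<forall>x. \<bar>b i x\<bar> \<le> B i)"
    using bounded_continuous[OF b_cont] by (intro bchoice) blast
  then obtain B where B: "\<And>i. i \<in> {1..N} \<Longrightarrow> 0 < B i" "\<And>i x. i \<in> {1..N} \<Longrightarrow> \<bar>b i x\<bar> \<le> B i" by blast
  define C1 where "C1 = (\<Sum>i=1..N. B i * (sqrt D + 1) * (sqrt (E g g) * sqrt (E (h i) (h i))))"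
  have C1: "0 \<le> C1"
    unfolding C1_def using B(1) by (intro sum_nonneg mult_nonneg_nonneg) (auto simp: D_nonneg RF1_nonneg g h_mem intro: less_imp_le)
  define C where "C = sqrt (E g g) + C1 + \<bar>\<alpha>\<bar> * Bg"
  have "\<bar>An n \<alpha> g v\<bar> \<le> C * (sqrt (tr n v v) + nrm n v)" for n v
  proof -
    let ?t = "sqrt (tr n v v) + nrm n v"
    have e0: "0 \<le> sqrt (tr n v v)" using trace_nonneg[OF finite_V nonempty_V] by simp
    have l0: "0 \<le> nrm n v" by (rule nrm_nonneg)
    have "\<bar>tr n g v\<bar> \<le> sqrt (tr n g g) * sqrt (tr n v v)" by (rule tr_Cauchy_Schwarz)
    also have "\<dots> \<le> sqrt (E g g) * ?t"
      using e0 l0 by (intro mult_mono) (auto simp: tr_le_energy g RF1_nonneg)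
    finally have 1: "\<bar>tr n g v\<bar> \<le> sqrt (E g g) * ?t" .
    have sup: "\<bar>v x\<bar> \<le> (sqrt D + 1) * ?t" if "x \<in> V n" for x
    proof -
      have "\<bar>v x\<bar> \<le> sqrt D * sqrt (tr n v v) + nrm n v" using H_sup_bound[of n v x] H_eq[OF that] by simp
      also have "\<dots> \<le> (sqrt D + 1) * ?t" using e0 l0 D_nonneg by (simp add: algebra_simps)
      finally show ?thesis .
    qed
    have "\<bar>Qn n g v\<bar> \<le> (\<Sum>i=1..N. \<bar>1/2 * carre n g (h i) (\<lambda>x. b i x * v x)\<bar>)"
      unfolding Qn_eq_carre by (rule sum_abs)
    also have "\<dots> \<le> (\<Sum>i=1..N. B i * (sqrt D + 1) * (sqrt (E g g) * sqrt (E (h i) (h i))) * ?t)"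
    proof (rule sum_mono)
      fix i assume i: "i \<in> {1..N}"
      have "\<bar>carre n g (h i) (\<lambda>x. b i x * v x)\<bar>
          \<le> 2 * (B i * ((sqrt D + 1) * ?t)) * (sqrt (E g g) * sqrt (E (h i) (h i)))"
      proof (rule carre_energy_bound[OF g h_mem[OF i]])
        fix x assume "x \<in> V n"
        then show "\<bar>b i x * v x\<bar> \<le> B i * ((sqrt D + 1) * ?t)"
          unfolding abs_mult using B[OF i] sup by (intro mult_mono) (auto intro: less_imp_le)
      qed
      then show "\<bar>1/2 * carre n g (h i) (\<lambda>x. b i x * v x)\<bar>
          \<le> B i * (sqrt D + 1) * (sqrt (E g g) * sqrt (E (h i) (h i))) * ?t"
        by (simp add: abs_mult mult_ac)
    qed
    also have "\<dots> = C1 * ?t" unfolding C1_def by (rule sum_distrib_right[symmetric])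
    finally have 2: "\<bar>Qn n g v\<bar> \<le> C1 * ?t" .
    have "\<bar>ip n g v\<bar> \<le> nrm n g * nrm n v" by (rule ip_Cauchy_Schwarz)
    also have "\<dots> \<le> Bg * ?t"
      using e0 l0 nrm_le[OF Bg(2)] Bg(1) by (intro mult_mono) auto
    finally have "\<bar>\<alpha> * ip n g v\<bar> \<le> \<bar>\<alpha>\<bar> * (Bg * ?t)"
      unfolding abs_mult by (rule mult_left_mono) simp
    moreover have "C * ?t = sqrt (E g g) * ?t + C1 * ?t + \<bar>\<alpha>\<bar> * (Bg * ?t)"
      by (simp add: C_def algebra_simps)
    ultimately show ?thesis using 1 2 unfolding An_eq by linarith
  qed
  moreover have "0 \<le> C" using C1 Bg(1) by (simp add: C_def RF1_nonneg g)
  ultimately show ?thesis by blast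
qed

text \<open>Stated for one \<alpha> and for functions solving the resolvent equations, so that the
  resolvents enter only through these equations.\<close>

lemma resolvent_KS_convergence:
  assumes \<delta>: "0 < \<delta>" and s: "0 < s" "s < 1"
    and drift: "sqrt (1/2 * drift_energy E F N b h) * (sqrt D + \<delta>) < s"
    and lam: "lam = inverse (4 * \<delta>) * inverse (sqrt D + \<delta>)" and \<alpha>: "lam < \<alpha>"
    and u: "u \<in> L2_space \<mu>" and KS: "strong_KS_converges p \<mu> un u"
    and g: "g \<in> F"
    and geq: "\<And>v. v \<in> F \<Longrightarrow> form_shift \<mu> (A_form E F N b h) \<alpha> g v = L2_inner \<mu> u v"
    and gneq: "\<forall>\<^sub>F n in sequentially. \<forall>v. An n \<alpha> (gn n) v = ip n (un n) v"
  shows "strong_KS_converges p \<mu> gn g"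
proof -
  define v where "v n x = gn n x - g x" for n x
  define e where "e n = sqrt (tr n (v n) (v n))" for n
  define l where "l n = nrm n (v n)" for n
  have e0: "0 \<le> e n" for n using trace_nonneg[OF finite_V nonempty_V] by (simp add: e_def)
  have l0: "0 \<le> l n" for n by (simp add: l_def nrm_nonneg)
  have e2: "(e n)\<^sup>2 = tr n (v n) (v n)" for n
    using trace_nonneg[OF finite_V nonempty_V] by (simp add: e_def)
  \<comment> \<open>Positive because s < 1 and s * lam < lam < \<alpha>.\<close>
  define c where "c = min (1 - s) (\<alpha> - s * lam)"
  have "0 < lam" unfolding lam using \<delta> D_nonneg by (simp add: add_nonneg_pos)
  then have "s * lam < 1 * lam" using s(2) by (intro mult_strict_right_mono)
  then have c: "c > 0" using s \<alpha> by (simp add: c_def)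
  have coercive: "\<forall>\<^sub>F n in sequentially. c * ((e n)\<^sup>2 + (l n)\<^sup>2) \<le> ip n (un n) (v n) - An n \<alpha> g (v n)"
    using eventually_coercive[OF \<delta> s(1) drift lam] gneq
  proof eventually_elim
    fix n
    assume co: "\<forall>v \<alpha>. (1 - s) * tr n v v + (\<alpha> - s * lam) * (nrm n v)\<^sup>2 \<le> An n \<alpha> v v"
      and eq: "\<forall>v. An n \<alpha> (gn n) v = ip n (un n) v"
    have "c * ((e n)\<^sup>2 + (l n)\<^sup>2) \<le> (1 - s) * (e n)\<^sup>2 + (\<alpha> - s * lam) * (l n)\<^sup>2"
      unfolding distrib_left by (intro add_mono mult_right_mono) (auto simp: c_def)
    also have "\<dots> \<le> An n \<alpha> (v n) (v n)" using co by (simp add: e2 l_def)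
    also have "\<dots> = An n \<alpha> (gn n) (v n) - An n \<alpha> g (v n)"
      using An_diff_left[of n \<alpha> "gn n" g "v n"] by (simp add: v_def[abs_def])
    finally show "c * ((e n)\<^sup>2 + (l n)\<^sup>2) \<le> ip n (un n) (v n) - An n \<alpha> g (v n)" using eq by simp
  qed
  obtain U where U: "U \<ge> 0" "\<forall>\<^sub>F n in sequentially. nrm n (un n) \<le> U" using KS_bounded[OF KS] by blast
  obtain C where C: "C \<ge> 0" "\<And>n w. \<bar>An n \<alpha> g w\<bar> \<le> C * (sqrt (tr n w w) + nrm n w)"
    using An_bound[OF g] by blast
  \<comment> \<open>With t = e n + l n, coercivity gives c t^2 \<le> 2 c ((e n)^2 + (l n)^2) \<le> 2
    (U + C) t.\<close>
  define K0 where "K0 = 2 * (U + C) / c"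
  have K0: "K0 \<ge> 0" using U(1) C(1) c by (simp add: K0_def)
  have bounded: "\<forall>\<^sub>F n in sequentially. e n + l n \<le> K0"
    using coercive U(2)
  proof eventually_elim
    fix n assume co: "c * ((e n)\<^sup>2 + (l n)\<^sup>2) \<le> ip n (un n) (v n) - An n \<alpha> g (v n)"
      and Un: "nrm n (un n) \<le> U"
    let ?t = "e n + l n"
    have t0: "0 \<le> ?t" using e0 l0 by (simp add: add_nonneg_nonneg)
    have "\<bar>ip n (un n) (v n)\<bar> \<le> nrm n (un n) * l n" unfolding l_def by (rule ip_Cauchy_Schwarz)
    also have "\<dots> \<le> U * ?t" using Un U(1) e0 l0 by (intro mult_mono) auto
    finally have "\<bar>ip n (un n) (v n)\<bar> \<le> U * ?t" .
    moreover have "\<bar>An n \<alpha> g (v n)\<bar> \<le> C * ?t" using C(2)[of n "v n"] by (simp add: e_def l_def)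
    ultimately have "c * ((e n)\<^sup>2 + (l n)\<^sup>2) \<le> (U + C) * ?t" using co by (simp add: distrib_right)
    moreover have "?t\<^sup>2 \<le> 2 * ((e n)\<^sup>2 + (l n)\<^sup>2)"
      using sum_squares_bound[of "e n" "l n"] by (simp add: power2_sum)
    then have "c * ?t\<^sup>2 \<le> c * (2 * ((e n)\<^sup>2 + (l n)\<^sup>2))" using c by (intro mult_left_mono) auto
    moreover have "(c * ?t) * ?t = c * ?t\<^sup>2" "(2 * (U + C)) * ?t = 2 * ((U + C) * ?t)"
      by (simp_all add: power2_eq_square)
    ultimately have "(c * ?t) * ?t \<le> (2 * (U + C)) * ?t" by linarith
    then have "?t = 0 \<or> c * ?t \<le> 2 * (U + C)" using t0 mult_right_le_imp_le[of "c * ?t" ?t "2 * (U + C)"] by linarith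
    then show "?t \<le> K0"
    proof
      assume "c * ?t \<le> 2 * (U + C)"
      then show ?thesis using c by (simp add: K0_def pos_le_divide_eq mult.commute)
    qed (simp add: K0)
  qed
  \<comment> \<open>The bound on the error holds only for large \<open>n\<close>, whereas the
    uniform limit lemmas ask for bounds at every \<open>n\<close>; the zero function fills the
    remaining indices.\<close>
  define w where "w n = (if e n + l n \<le> K0 then H n (v n) else (\<lambda>_. 0))" for n
  define K where "K = max (K0\<^sup>2) ((sqrt D + 1) * K0)"
  have w: "w n \<in> F" "E (w n) (w n) \<le> K" "\<bar>w n x\<bar> \<le> K" for n x
  proof -
    show "w n \<in> F" by (simp add: w_def H_mem const_mem)
    have Kpos: "0 \<le> K" by (simp add: K_def le_max_iff_disj)
    show "E (w n) (w n) \<le> K"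
    proof (cases "e n + l n \<le> K0")
      case True
      then have "e n \<le> K0" using l0[of n] by linarith
      then have "(e n)\<^sup>2 \<le> K0\<^sup>2" using e0 by (intro power_mono) auto
      with True show ?thesis by (simp add: w_def e2 trace_form_def K_def)
    qed (use Kpos in \<open>simp add: w_def E_const_left const_mem\<close>)
    show "\<bar>w n x\<bar> \<le> K"
    proof (cases "e n + l n \<le> K0")
      case True
      have "\<bar>H n (v n) x\<bar> \<le> sqrt D * e n + l n" using H_sup_bound[of n "v n" x] by (simp add: e_def l_def)
      also have "\<dots> \<le> (sqrt D + 1) * (e n + l n)" using e0[of n] l0[of n] D_nonneg by (simp add: algebra_simps)
      also have "\<dots> \<le> (sqrt D + 1) * K0" using True D_nonneg by (intro mult_left_mono) auto
      finally show ?thesis using True by (simp add: w_def K_def)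
    qed (use Kpos in \<open>simp add: w_def\<close>)
  qed
  \<comment> \<open>The consistency error: the discrete minus the limiting resolvent equation at
    \<open>w n\<close>. No energy term occurs, because \<open>tr n g (v n)\<close> equals
    \<open>E g (w n)\<close> exactly.\<close>
  define R where "R n = (ip n (un n) (w n) - L2_inner \<mu> u (w n))
      - (\<Sum>i=1..N. 1/2 * (carre n g (h i) (\<lambda>x. b i x * w n x)
            - mutual_energy_integral E F g (h i) (\<lambda>x. b i x * w n x)))
      - \<alpha> * (ip n g (w n) - L2_inner \<mu> g (w n))" for n
  have "R \<longlonglongrightarrow> 0 - (\<Sum>i=1..N. 1/2 * 0) - \<alpha> * 0"
    unfolding R_def
    by (intro tendsto_diff tendsto_sum tendsto_mult tendsto_const ip_uniform_limit[OF KS u w]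
        ip_uniform_limit_continuous[OF continuous_mem[OF g] w] carre_uniform_limit[OF g h_mem b_cont w])
  then have R: "R \<longlonglongrightarrow> 0" by simp
  \<comment> \<open>On \<open>V n\<close> the functions \<open>w n\<close> and \<open>v n\<close>
    agree, so every discrete term may be rewritten with \<open>w n\<close>; as an element of
    \<open>F\<close>, \<open>w n\<close> is also admissible in the limiting equation.\<close>
  have "\<forall>\<^sub>F n in sequentially. c * (l n)\<^sup>2 \<le> R n"
    using coercive bounded
  proof eventually_elim
    fix n assume co: "c * ((e n)\<^sup>2 + (l n)\<^sup>2) \<le> ip n (un n) (v n) - An n \<alpha> g (v n)"
      and "e n + l n \<le> K0"
    then have wn: "w n = H n (v n)" by (simp add: w_def)
    then have wv: "w n x = v n x" if "x \<in> V n" for x using H_eq[OF that] by simp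
    have tr_w: "tr n g (v n) = E g (w n)"
      using tr_eq_energy[OF g, of n "v n"] trace_sym[OF finite_V nonempty_V, of n g "v n"]
      by (simp add: wn RF1_sym[OF g H_mem])
    have Q_w: "Qn n g (v n) = (\<Sum>i=1..N. 1/2 * carre n g (h i) (\<lambda>x. b i x * w n x))"
      unfolding Qn_eq_carre
      by (intro sum.cong refl arg_cong[of _ _ "times (1/2)"] carre_cong) (simp add: wv)
    have ip_w: "ip n f (v n) = ip n f (w n)" for f by (rule ip_cong) (simp_all add: wv)
    have "An n \<alpha> g (v n) = E g (w n) + (\<Sum>i=1..N. 1/2 * carre n g (h i) (\<lambda>x. b i x * w n x)) + \<alpha> * ip n g (w n)"
      unfolding An_eq by (simp only: tr_w Q_w ip_w)
    moreover have "E g (w n) + (\<Sum>i=1..N. 1/2 * mutual_energy_integral E F g (h i) (\<lambda>x. b i x * w n x))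
        + \<alpha> * L2_inner \<mu> g (w n) = L2_inner \<mu> u (w n)"
      using geq[OF w(1), of n] by (simp add: form_shift_def A_form_def Q_form_def)
    moreover have "R n = ip n (un n) (w n) - L2_inner \<mu> u (w n)
        - (\<Sum>i=1..N. 1/2 * carre n g (h i) (\<lambda>x. b i x * w n x))
        + (\<Sum>i=1..N. 1/2 * mutual_energy_integral E F g (h i) (\<lambda>x. b i x * w n x))
        - \<alpha> * ip n g (w n) + \<alpha> * L2_inner \<mu> g (w n)"
      unfolding R_def right_diff_distrib sum_subtractf by simp
    ultimately have "ip n (un n) (v n) - An n \<alpha> g (v n) = R n"
      unfolding ip_w by linarith
    moreover have "c * (l n)\<^sup>2 \<le> c * ((e n)\<^sup>2 + (l n)\<^sup>2)" using c by (intro mult_left_mono) auto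
    ultimately show "c * (l n)\<^sup>2 \<le> R n" using co by linarith
  qed
  then have "\<forall>\<^sub>F n in sequentially. (l n)\<^sup>2 \<le> R n / c"
    by eventually_elim (use c in \<open>simp add: pos_le_divide_eq mult.commute\<close>)
  moreover have "(\<lambda>n. R n / c) \<longlonglongrightarrow> 0" using tendsto_divide[OF R tendsto_const[of c]] c by simp
  ultimately have "(\<lambda>n. (l n)\<^sup>2) \<longlonglongrightarrow> 0"
    by (intro Lim_null_comparison[of "\<lambda>n. (l n)\<^sup>2" "\<lambda>n. R n / c"]) simp_all
  from tendsto_real_sqrt[OF this] have "l \<longlonglongrightarrow> 0" using l0 by simp
  moreover have "nrm n (\<lambda>x. g x - gn n x) = l n" for n
    unfolding l_def L2_norm_def ip_eq_sum v_def
    by (intro arg_cong[of _ _ sqrt] sum.cong refl) (simp add: algebra_simps)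
  ultimately show ?thesis by (intro KS_convergesI continuous_mem g) simp
qed

end

theorem proposition4p5:
  fixes E :: "('a::metric_space) form" and F :: "('a \<Rightarrow> real) set"
    and \<mu> :: "'a measure" and V :: "nat \<Rightarrow> 'a set" and \<mu>n :: "nat \<Rightarrow> 'a pmf"
    and N :: nat and b h :: "nat \<Rightarrow> 'a \<Rightarrow> real"
    and \<delta> s lam :: real
    and G :: "real \<Rightarrow> ('a \<Rightarrow> real) \<Rightarrow> ('a \<Rightarrow> real)"
    and Gn :: "nat \<Rightarrow> real \<Rightarrow> ('a \<Rightarrow> real) \<Rightarrow> ('a \<Rightarrow> real)"
  assumes "resistance_form E F"
    and "\<And>x y. ennreal (dist x y) = resistance E F x y"
    and "compact (UNIV :: 'a set)"
    and "sets \<mu> = sets borel" and "prob_space \<mu>"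
    and "\<And>U. open U \<Longrightarrow> U \<noteq> {} \<Longrightarrow> 0 < emeasure \<mu> U"
    and "dirichlet_form \<mu> E F" and "strongly_local E F"
    and "mono V" and "\<And>n. finite (V n)" and "\<And>n. V n \<noteq> {}" and "closure (\<Union>n. V n) = UNIV"
    and "\<And>n. set_pmf (\<mu>n n) = V n"
    and "weakly_converges \<mu>n \<mu>"
    and "\<And>i. i \<in> {1..N} \<Longrightarrow> continuous_on UNIV (b i)"
    and "\<And>i. i \<in> {1..N} \<Longrightarrow> h i \<in> F"
    and "assumption_A E F N b h \<or> assumption_B E F V N b h"
    and "0 < \<delta>" and "0 < s"
    and "sqrt (1/2 * drift_energy E F N b h) * (sqrt (diameter (UNIV :: 'a set)) + \<delta>) < s"
    and "s < 1"
    and "lam = inverse (4 * \<delta>) * inverse (sqrt (diameter (UNIV :: 'a set)) + \<delta>)"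
    and "resolvent_of \<mu> (A_form E F N b h) F lam G"
    and "eventually (\<lambda>n. resolvent_of (measure_pmf (\<mu>n n)) (A_form_fin E F (V n) N b h) UNIV lam (Gn n))
           sequentially"
  shows "\<forall>\<alpha>>lam. \<forall>u\<in>L2_space \<mu>. \<forall>un. (\<forall>n. un n \<in> L2_space (measure_pmf (\<mu>n n))) \<longrightarrow>
           strong_KS_converges \<mu>n \<mu> un u \<longrightarrow>
           strong_KS_converges \<mu>n \<mu> (\<lambda>n. Gn n \<alpha> (un n)) (G \<alpha> u)"
proof (intro allI ballI impI)
  fix \<alpha> u un
  assume \<alpha>: "lam < \<alpha>" and u: "u \<in> L2_space \<mu>" and un: "\<forall>n. un n \<in> L2_space (measure_pmf (\<mu>n n))"
    and KS: "strong_KS_converges \<mu>n \<mu> un u"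
  interpret resistance_form E F by fact
  interpret resistance_metric E F by unfold_locales (rule assms(2))
  interpret approximated_resistance_form E F V by unfold_locales (rule assms(3,9,10,11,12))+
  interpret drift_approximation E F V \<mu> \<mu>n N b h "diameter (UNIV :: 'a set)"
    by (rule drift_approximation.intro[OF approximated_resistance_form_axioms
          drift_approximation_axioms.intro[OF refl assms(4,5,13,14,15,16)]])
  show "strong_KS_converges \<mu>n \<mu> (\<lambda>n. Gn n \<alpha> (un n)) (G \<alpha> u)"
  proof (rule resolvent_KS_convergence[OF assms(18,19,21,20,22) \<alpha> u KS])
    show "G \<alpha> u \<in> F"
      and "\<And>v. v \<in> F \<Longrightarrow> form_shift \<mu> (A_form E F N b h) \<alpha> (G \<alpha> u) v = L2_inner \<mu> u v"
      using assms(23) \<alpha> u unfolding resolvent_of_def by blast+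
    \<comment> \<open>The discrete domain is \<open>UNIV\<close>, so the equation may be tested with
      the error itself, whose values off \<open>V n\<close> are arbitrary.\<close>
    show "\<forall>\<^sub>F n in sequentially. \<forall>v. An n \<alpha> (Gn n \<alpha> (un n)) v = ip n (un n) v"
      using assms(24)
    proof eventually_elim
      fix n assume "resolvent_of (measure_pmf (\<mu>n n)) (A_form_fin E F (V n) N b h) UNIV lam (Gn n)"
      then show "\<forall>v. An n \<alpha> (Gn n \<alpha> (un n)) v = ip n (un n) v"
        using \<alpha> un unfolding resolvent_of_def by blast
    qed
  qed
qed

end
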